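(* Let $G=G(\Gamma)$ be a tubular group which is also a free by $\mathbb{Z}$ group. Then there exists an equitable set for $G(\Gamma)$, and so $G$ acts freely on a CAT(0) cube complex.
   Context: A tubular group $G=G(\Gamma)$ is the fundamental group of a graph of groups over a finite connected graph $\Gamma$ in which every vertex group is isomorphic to $\mathbb{Z}^2$ and every edge group is isomorphic to $\mathbb{Z}$. A free by $\mathbb{Z}$ group is a group of the form $F\rtimes_\alpha\mathbb{Z}$ where $F$ is a free group of finite rank and $\alpha$ is an automorphism of $F$. For elements $\mathbf{x}=(x_1,x_2)$ and $\mathbf{s}=(s_1,s_2)$ of a vertex group, written in coordinates with respect to a basis identifying it with $\mathbb{Z}^2$, the intersection number is $\#[\mathbf{x},\mathbf{s}]=|x_1s_2-x_2s_1|$ (independent of the choice of basis). An equitable set for $G(\Gamma)$ is a choice, for each vertex of $\Gamma$, of a finite family of elements of the vertex group such that: (i) each family generates a finite index subgroup of the respective vertex group; and (ii) for each edge $e$ of $\Gamma$, if a generator of the edge group of $e$ embeds as $\mathbf{x}$ in the vertex group at one end of $e$, with chosen family $\{\mathbf{s}_1,\ldots,\mathbf{s}_m\}$, and as $\mathbf{y}$ in the vertex group at the other end of $e$, with chosen family $\{\mathbf{t}_1,\ldots,\mathbf{t}_n\}$ (the two ends may be the same vertex, in which case the families are the same), then $$\sum_{i=1}^m \#[\mathbf{x},\mathbf{s}_i]=\sum_{j=1}^n \#[\mathbf{y},\mathbf{t}_j].$$ The CAT(0) cube complex is not required to be finite dimensional or locally finite. *)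

theory Defs
  imports
    "HOL-Analysis.Analysis"
    "HOL-Algebra.Bij"
    "HOL-Algebra.Elementary_Groups"
    "HOL-Algebra.Group_Action"
    "Graph_Theory.Graph_Theory"
begin

section \<open>Groups given by generators and relators\<close>

text \<open>A letter \<open>(x, True)\<close> stands for \<open>x\<close> and \<open>(x, False)\<close> for its formal inverse.\<close>

type_synonym 'x word = "('x \<times> bool) list"

definition words :: "'x set \<Rightarrow> 'x word set" where
  "words X = lists (X \<times> UNIV)"

inductive word_eq :: "'x set \<Rightarrow> 'x word set \<Rightarrow> 'x word \<Rightarrow> 'x word \<Rightarrow> bool"
  for X :: "'x set" and R :: "'x word set" where
  refl: "w \<in> words X \<Longrightarrow> word_eq X R w w"
| sym: "word_eq X R u v \<Longrightarrow> word_eq X R v u"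
| trans: "word_eq X R u v \<Longrightarrow> word_eq X R v w \<Longrightarrow> word_eq X R u w"
| cancel: "u \<in> words X \<Longrightarrow> v \<in> words X \<Longrightarrow> x \<in> X
    \<Longrightarrow> word_eq X R (u @ [(x, b), (x, \<not> b)] @ v) (u @ v)"
| relator: "u \<in> words X \<Longrightarrow> v \<in> words X \<Longrightarrow> r \<in> R \<Longrightarrow> r \<in> words X
    \<Longrightarrow> word_eq X R (u @ r @ v) (u @ v)"

definition word_rel :: "'x set \<Rightarrow> 'x word set \<Rightarrow> ('x word \<times> 'x word) set" where
  "word_rel X R = {(u, v). word_eq X R u v}"

definition presented_group :: "'x set \<Rightarrow> 'x word set \<Rightarrow> 'x word set monoid" where
  "presented_group X R =
     \<lparr>carrier = words X // word_rel X R,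
      monoid.mult = (\<lambda>A B. {w. \<exists>u\<in>A. \<exists>v\<in>B. (u @ v, w) \<in> word_rel X R}),
      one = word_rel X R `` {[]}\<rparr>"

definition free_group :: "'x set \<Rightarrow> 'x word set monoid" where
  "free_group X = presented_group X {}"

lemma words_simps [simp]:
  "[] \<in> words X" "u @ v \<in> words X \<longleftrightarrow> u \<in> words X \<and> v \<in> words X"
  "a # v \<in> words X \<longleftrightarrow> fst a \<in> X \<and> v \<in> words X"
  by (auto simp: words_def mem_Times_iff)

lemma word_eq_words: "word_eq X R u v \<Longrightarrow> u \<in> words X \<and> v \<in> words X"
  by (induction rule: word_eq.induct) auto

lemma word_eq_append_left: "word_eq X R u v \<Longrightarrow> w \<in> words X \<Longrightarrow> word_eq X R (w @ u) (w @ v)"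
proof (induction rule: word_eq.induct)
  case (cancel u v x b)
  then show ?case using word_eq.cancel[of "w @ u" X v x R b] by simp
next
  case (relator u v r)
  then show ?case using word_eq.relator[of "w @ u" X v r R] by simp
qed (auto intro: word_eq.refl word_eq.sym word_eq.trans)

lemma word_eq_append_right: "word_eq X R u v \<Longrightarrow> w \<in> words X \<Longrightarrow> word_eq X R (u @ w) (v @ w)"
proof (induction rule: word_eq.induct)
  case (cancel u v x b)
  then show ?case using word_eq.cancel[of u X "v @ w" x R b] by simp
next
  case (relator u v r)
  then show ?case using word_eq.relator[of u X "v @ w" r R] by simp
qed (auto intro: word_eq.refl word_eq.sym word_eq.trans)

lemma word_eq_append:
  "word_eq X R u u' \<Longrightarrow> word_eq X R v v' \<Longrightarrow> word_eq X R (u @ v) (u' @ v')"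
  by (meson word_eq.trans word_eq_append_left word_eq_append_right word_eq_words)

lemma equiv_word_rel: "equiv (words X) (word_rel X R)"
  unfolding equiv_def refl_on_def sym_on_def trans_on_def word_rel_def
  by (auto dest: word_eq_words intro: word_eq.intros)

definition word_class :: "'x set \<Rightarrow> 'x word set \<Rightarrow> 'x word \<Rightarrow> 'x word set" where
  "word_class X R w = word_rel X R `` {w}"

lemma carrier_presented_group: "carrier (presented_group X R) = word_class X R ` words X"
  by (auto simp: presented_group_def word_class_def quotient_def)

lemma word_class_eq_iff:
  "u \<in> words X \<Longrightarrow> v \<in> words X \<Longrightarrow> word_class X R u = word_class X R v \<longleftrightarrow> word_eq X R u v"
  using eq_equiv_class_iff[OF equiv_word_rel, of u X v R]
  by (simp add: word_class_def word_rel_def)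

lemma one_presented_group: "\<one>\<^bsub>presented_group X R\<^esub> = word_class X R []"
  by (simp add: presented_group_def word_class_def)

lemma mult_presented_group:
  assumes "u \<in> words X" "v \<in> words X"
  shows "word_class X R u \<otimes>\<^bsub>presented_group X R\<^esub> word_class X R v = word_class X R (u @ v)"
proof -
  have "(\<exists>u'. word_eq X R u u' \<and> (\<exists>v'. word_eq X R v v' \<and> word_eq X R (u' @ v') w))
      \<longleftrightarrow> word_eq X R (u @ v) w" for w
    using assms by (meson word_eq.refl word_eq.trans word_eq_append)
  then show ?thesis
    by (auto simp: presented_group_def word_class_def word_rel_def)
qed

lemma words_inverse: "w \<in> words X \<Longrightarrow> map (map_prod id Not) (rev w) \<in> words X"
  by (induction w) (auto simp: words_def)

lemma word_eq_inverse:
  "w \<in> words X \<Longrightarrow> word_eq X R (map (map_prod id Not) (rev w) @ w) []"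
proof (induction w)
  case (Cons a w)
  obtain x b where a: "a = (x, b)" by force
  have w': "map (map_prod id Not) (rev w) \<in> words X"
    using Cons.prems by (simp add: words_inverse)
  show ?case
    using word_eq.trans[OF word_eq.cancel[OF w', of w x R "\<not> b"] Cons.IH] Cons.prems a
    by (simp add: id_def)
qed (simp add: word_eq.refl)

lemma group_presented_group: "group (presented_group X R)"
proof (rule groupI)
  fix g assume "g \<in> carrier (presented_group X R)"
  then obtain w where w: "w \<in> words X" "g = word_class X R w"
    by (auto simp: carrier_presented_group)
  let ?w = "map (map_prod id Not) (rev w)"
  have w': "?w \<in> words X"
    using w by (simp add: words_inverse)
  then have "word_class X R ?w \<otimes>\<^bsub>presented_group X R\<^esub> g = \<one>\<^bsub>presented_group X R\<^esub>"
    using w word_eq_inverse[of w X R]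
    by (simp add: mult_presented_group one_presented_group word_class_eq_iff)
  then show "\<exists>h\<in>carrier (presented_group X R).
      h \<otimes>\<^bsub>presented_group X R\<^esub> g = \<one>\<^bsub>presented_group X R\<^esub>"
    using w' by (auto simp: carrier_presented_group)
qed (auto simp: carrier_presented_group mult_presented_group one_presented_group)

section \<open>Free by $\mathbb{Z}$ groups\<close>

text \<open>In \<open>(f, m) \<otimes> (g, n) = (f \<otimes> \<alpha>\<^sup>m(g), m + n)\<close> the integer power of \<open>\<alpha>\<close> is
  taken in the automorphism group of \<open>F\<close>.\<close>

definition semidirect_Z :: "'f monoid \<Rightarrow> ('f \<Rightarrow> 'f) \<Rightarrow> ('f \<times> int) monoid" where
  "semidirect_Z F \<alpha> =
     \<lparr>carrier = carrier F \<times> UNIV,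
      monoid.mult = (\<lambda>(f, m) (g, n). (f \<otimes>\<^bsub>F\<^esub> (\<alpha> [^]\<^bsub>AutoGroup F\<^esub> m) g, m + n)),
      one = (\<one>\<^bsub>F\<^esub>, 0)\<rparr>"

definition free_by_Z :: "'g monoid \<Rightarrow> bool" where
  "free_by_Z G \<longleftrightarrow> (\<exists>(n::nat) \<alpha>. \<alpha> \<in> auto (free_group {..<n}) \<and>
     G \<cong> semidirect_Z (free_group {..<n}) \<alpha>)"

lemma group_semidirect_Z:
  assumes "group F" "\<alpha> \<in> auto F"
  shows "group (semidirect_Z F \<alpha>)"
proof -
  interpret F: group F by fact
  interpret A: group "AutoGroup F" by (rule F.AutoGroup)
  have car: "carrier (AutoGroup F) = auto F"
    by (simp add: AutoGroup_def)
  let ?p = "\<lambda>m::int. \<alpha> [^]\<^bsub>AutoGroup F\<^esub> m"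
  have p: "?p m \<in> auto F" for m
    using A.int_pow_closed[of \<alpha> m] assms(2) car by simp
  have closed: "?p m f \<in> carrier F" if "f \<in> carrier F" for m f
    using p[of m] that by (auto simp: auto_def hom_def)
  have hom: "?p m (f \<otimes>\<^bsub>F\<^esub> g) = ?p m f \<otimes>\<^bsub>F\<^esub> ?p m g"
    if "f \<in> carrier F" "g \<in> carrier F" for m f g
    using p[of m] that by (auto simp: auto_def hom_def)
  have add: "?p (m + n) f = ?p m (?p n f)" if "f \<in> carrier F" for m n f
  proof -
    have "?p (m + n) = ?p m \<otimes>\<^bsub>AutoGroup F\<^esub> ?p n"
      using A.int_pow_mult[of \<alpha> m n] assms(2) car by simp
    then show ?thesis
      using p[of m] p[of n] that
      by (simp add: AutoGroup_def BijGroup_def auto_def compose_def)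
  qed
  have zero: "?p 0 f = f" if "f \<in> carrier F" for f
    using that by (simp add: AutoGroup_def BijGroup_def)
  show ?thesis
  proof (rule groupI)
    fix x assume "x \<in> carrier (semidirect_Z F \<alpha>)"
    then obtain f m where x: "x = (f, m)" "f \<in> carrier F"
      by (auto simp: semidirect_Z_def)
    let ?y = "(?p (- m) (inv\<^bsub>F\<^esub> f), - m)"
    have "?p (- m) (inv\<^bsub>F\<^esub> f) \<otimes>\<^bsub>F\<^esub> ?p (- m) f = ?p (- m) \<one>\<^bsub>F\<^esub>"
      using x hom[of "inv\<^bsub>F\<^esub> f" f "- m"] by simp
    also have "\<dots> = \<one>\<^bsub>F\<^esub>"
      by (metis F.l_cancel_one F.one_closed F.r_one closed hom)
    finally have "?y \<otimes>\<^bsub>semidirect_Z F \<alpha>\<^esub> x = \<one>\<^bsub>semidirect_Z F \<alpha>\<^esub>"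
      using x by (simp add: semidirect_Z_def)
    moreover have "?y \<in> carrier (semidirect_Z F \<alpha>)"
      using x closed by (simp add: semidirect_Z_def)
    ultimately show "\<exists>y\<in>carrier (semidirect_Z F \<alpha>).
        y \<otimes>\<^bsub>semidirect_Z F \<alpha>\<^esub> x = \<one>\<^bsub>semidirect_Z F \<alpha>\<^esub>"
      by blast
  qed (auto simp: semidirect_Z_def closed hom add zero F.m_assoc simp del: int_pow_0)
qed

section \<open>Graphs of groups and tubular groups\<close>

text \<open>The arcs of \<open>base \<G>\<close> are the geometric edges of the graph, each with one chosen
  orientation; loops and multiple edges are allowed. The edge group of \<open>e\<close> maps to the
  vertex group of \<open>tail e\<close> by \<open>tail_map \<G> e\<close> and to that of \<open>head e\<close> by
  \<open>head_map \<G> e\<close>.\<close>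

record ('v, 'e, 'a, 'b) graph_of_groups =
  base :: "('v, 'e) pre_digraph"
  vgroup :: "'v \<Rightarrow> 'a monoid"
  egroup :: "'e \<Rightarrow> 'b monoid"
  tail_map :: "'e \<Rightarrow> 'b \<Rightarrow> 'a"
  head_map :: "'e \<Rightarrow> 'b \<Rightarrow> 'a"

definition is_graph_of_groups :: "('v, 'e, 'a, 'b) graph_of_groups \<Rightarrow> bool" where
  "is_graph_of_groups \<G> \<longleftrightarrow>
     wf_digraph (base \<G>) \<and>
     (\<forall>v\<in>verts (base \<G>). group (vgroup \<G> v)) \<and>
     (\<forall>e\<in>arcs (base \<G>). group (egroup \<G> e) \<and>
        tail_map \<G> e \<in> hom (egroup \<G> e) (vgroup \<G> (tail (base \<G>) e)) \<and>
        inj_on (tail_map \<G> e) (carrier (egroup \<G> e)) \<and>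
        head_map \<G> e \<in> hom (egroup \<G> e) (vgroup \<G> (head (base \<G>) e)) \<and>
        inj_on (head_map \<G> e) (carrier (egroup \<G> e)))"

text \<open>\<open>Digraph_Component.connected\<close> ignores orientations and includes non-emptiness. The
  notion of tree in \<open>Digraph_Component\<close> only excludes directed cycles, which is too weak
  here; a spanning tree is instead a set of edges that connects all vertices and none of whose
  edges can be removed.\<close>

definition spanning_tree_arcs :: "('v, 'e) pre_digraph \<Rightarrow> 'e set \<Rightarrow> bool" where
  "spanning_tree_arcs \<Gamma> T \<longleftrightarrow>
     T \<subseteq> arcs \<Gamma> \<and> Digraph_Component.connected (\<Gamma>\<lparr>arcs := T\<rparr>) \<and>
     (\<forall>e\<in>T. \<not> Digraph_Component.connected (\<Gamma>\<lparr>arcs := T - {e}\<rparr>))"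

text \<open>The fundamental group with respect to a spanning tree \<open>T\<close>: generated by all elements of
  the vertex groups and a stable letter for each edge, subject to the multiplication tables of the
  vertex groups, the relations $t_e\, h_e(c)\, t_e^{-1} = \tau_e(c)$ for the two embeddings
  $h_e$, $\tau_e$ of an edge group element $c$ at head and tail, and $t_e = 1$ for $e$ in \<open>T\<close>.\<close>

datatype ('v, 'a, 'e) gog_gen = Vertex_Elt 'v 'a | Stable_Letter 'e

definition gog_gens :: "('v, 'e, 'a, 'b) graph_of_groups \<Rightarrow> ('v, 'a, 'e) gog_gen set" where
  "gog_gens \<G> =
     {Vertex_Elt v g |v g. v \<in> verts (base \<G>) \<and> g \<in> carrier (vgroup \<G> v)} \<union>
     Stable_Letter ` arcs (base \<G>)"

definition gog_relators ::
  "('v, 'e, 'a, 'b) graph_of_groups \<Rightarrow> 'e set \<Rightarrow> ('v, 'a, 'e) gog_gen word set" where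
  "gog_relators \<G> T =
     {[(Vertex_Elt v g, True), (Vertex_Elt v h, True), (Vertex_Elt v (g \<otimes>\<^bsub>vgroup \<G> v\<^esub> h), False)]
       |v g h. v \<in> verts (base \<G>) \<and> g \<in> carrier (vgroup \<G> v) \<and> h \<in> carrier (vgroup \<G> v)} \<union>
     {[(Stable_Letter e, True), (Vertex_Elt (head (base \<G>) e) (head_map \<G> e c), True),
       (Stable_Letter e, False), (Vertex_Elt (tail (base \<G>) e) (tail_map \<G> e c), False)]
       |e c. e \<in> arcs (base \<G>) \<and> c \<in> carrier (egroup \<G> e)} \<union>
     {[(Stable_Letter e, True)] |e. e \<in> T}"

definition fundamental_group ::
  "('v, 'e, 'a, 'b) graph_of_groups \<Rightarrow> 'e set \<Rightarrow> ('v, 'a, 'e) gog_gen word set monoid" where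
  "fundamental_group \<G> T = presented_group (gog_gens \<G>) (gog_relators \<G> T)"

definition Z2 :: "(int \<times> int) monoid" where
  "Z2 = integer_group \<times>\<times> integer_group"

definition tubular :: "('v, 'e, 'a, 'b) graph_of_groups \<Rightarrow> bool" where
  "tubular \<G> \<longleftrightarrow>
     is_graph_of_groups \<G> \<and> fin_digraph (base \<G>) \<and> Digraph_Component.connected (base \<G>) \<and>
     (\<forall>v\<in>verts (base \<G>). vgroup \<G> v \<cong> Z2) \<and>
     (\<forall>e\<in>arcs (base \<G>). egroup \<G> e \<cong> integer_group)"

section \<open>Equitable sets\<close>

definition det2 :: "int \<times> int \<Rightarrow> int \<times> int \<Rightarrow> int" where
  "det2 x s = fst x * snd s - fst s * snd x"

text \<open>By \<open>intersection_number_eq\<close> below, the chosen identification with $\mathbb{Z}^2$ is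
  immaterial.\<close>

definition intersection_number :: "'a monoid \<Rightarrow> 'a \<Rightarrow> 'a \<Rightarrow> int" where
  "intersection_number A x s = (let \<phi> = (SOME \<phi>. \<phi> \<in> iso A Z2) in \<bar>det2 (\<phi> x) (\<phi> s)\<bar>)"

lemma hom_Z2_linear:
  assumes "\<psi> \<in> hom Z2 Z2"
  shows "\<psi> x = (fst x * fst (\<psi> (1, 0)) + snd x * fst (\<psi> (0, 1)),
                fst x * snd (\<psi> (1, 0)) + snd x * snd (\<psi> (0, 1)))"
proof -
  have add: "\<psi> (a + b) = \<psi> a + \<psi> b" for a b
    using hom_mult[OF assms, of a b] by (cases a; cases b; cases "\<psi> a"; cases "\<psi> b") (simp add: Z2_def)
  have zero: "\<psi> 0 = 0"
    using add[of 0 0] by simp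
  have neg: "\<psi> (- a) = - \<psi> a" for a
    using add[of a "- a"] zero by (simp add: eq_neg_iff_add_eq_0 add.commute)
  have nat: "\<psi> (int n * fst a, int n * snd a) = (int n * fst (\<psi> a), int n * snd (\<psi> a))" for n a
  proof (induction n)
    case (Suc n)
    have "\<psi> (int (Suc n) * fst a, int (Suc n) * snd a)
        = \<psi> (int n * fst a, int n * snd a) + \<psi> a"
      by (subst add[symmetric], rule arg_cong[of _ _ \<psi>]) (simp add: prod_eq_iff algebra_simps)
    then show ?case
      by (simp add: Suc prod_eq_iff algebra_simps)
  qed (use zero in \<open>simp add: zero_prod_def\<close>)
  have int: "\<psi> (k * fst a, k * snd a) = (k * fst (\<psi> a), k * snd (\<psi> a))" for k a
  proof (cases "k \<ge> 0")
    case True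
    then show ?thesis using nat[of "nat k" a] by simp
  next
    case False
    then show ?thesis
      using nat[of "nat (- k)" a] neg[of "(nat (- k) * fst a, nat (- k) * snd a)"]
      by (simp add: prod_eq_iff)
  qed
  have "\<psi> x = \<psi> (fst x * fst (1::int, 0::int), fst x * snd (1::int, 0::int))
            + \<psi> (snd x * fst (0::int, 1::int), snd x * snd (0::int, 1::int))"
    by (subst add[symmetric]) simp
  then show ?thesis
    unfolding int by simp
qed

lemma intersection_number_eq:
  assumes "group A" "\<phi> \<in> iso A Z2" "x \<in> carrier A" "s \<in> carrier A"
  shows "intersection_number A x s = \<bar>det2 (\<phi> x) (\<phi> s)\<bar>"
proof -
  have Z2: "group Z2"
    by (simp add: Z2_def DirProd_group)
  have det: "det2 (\<psi> a) (\<psi> b) = det2 (\<psi> (1, 0)) (\<psi> (0, 1)) * det2 a b"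
    if "\<psi> \<in> hom Z2 Z2" for \<psi> a b
    by (subst hom_Z2_linear[OF that, of a], subst hom_Z2_linear[OF that, of b])
       (simp add: det2_def algebra_simps)
  define \<phi>' where "\<phi>' = (SOME \<phi>. \<phi> \<in> iso A Z2)"
  have \<phi>': "\<phi>' \<in> iso A Z2"
    unfolding \<phi>'_def using someI[of "\<lambda>\<phi>. \<phi> \<in> iso A Z2", OF assms(2)] .
  define \<psi> where "\<psi> = \<phi>' \<circ> inv_into (carrier A) \<phi>"
  define \<xi> where "\<xi> = \<phi> \<circ> inv_into (carrier A) \<phi>'"
  have \<psi>: "\<psi> \<in> iso Z2 Z2"
    unfolding \<psi>_def using group.iso_set_sym[OF assms(1,2)] \<phi>' by (rule iso_set_trans)
  have \<xi>: "\<xi> \<in> iso Z2 Z2"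
    unfolding \<xi>_def using group.iso_set_sym[OF assms(1) \<phi>'] assms(2) by (rule iso_set_trans)
  have inj: "inj_on \<phi> (carrier A)" "inj_on \<phi>' (carrier A)"
    using assms(2) \<phi>' by (auto simp: iso_def bij_betw_def)
  have surj: "\<phi> ` carrier A = UNIV" "\<phi>' ` carrier A = UNIV"
    using assms(2) \<phi>' by (auto simp: iso_def bij_betw_def Z2_def)
  have \<xi>\<psi>: "\<xi> (\<psi> y) = y" for y
  proof -
    have "inv_into (carrier A) \<phi> y \<in> carrier A"
      using surj by (metis UNIV_I inv_into_into)
    then show ?thesis
      unfolding \<xi>_def \<psi>_def using inj surj
      by (simp add: f_inv_into_f inv_into_f_f)
  qed
  define d where "d = det2 (\<psi> (1, 0)) (\<psi> (0, 1))"
  have "1 = det2 (\<xi> (\<psi> (1, 0))) (\<xi> (\<psi> (0, 1)))"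
    by (simp add: \<xi>\<psi> det2_def)
  also have "\<dots> = det2 (\<xi> (1, 0)) (\<xi> (0, 1)) * d"
    unfolding d_def using \<xi> by (intro det) (simp add: iso_def)
  finally have "d dvd 1"
    by (metis dvd_triv_right)
  then have d: "\<bar>d\<bar> = 1"
    by simp
  have "\<psi> (\<phi> a) = \<phi>' a" if "a \<in> carrier A" for a
    unfolding \<psi>_def using inj that by simp
  then have "det2 (\<phi>' x) (\<phi>' s) = d * det2 (\<phi> x) (\<phi> s)"
    using det[of \<psi> "\<phi> x" "\<phi> s"] \<psi> assms(3,4) by (simp add: d_def iso_def)
  then show ?thesis
    using d by (simp add: intersection_number_def Let_def abs_mult flip: \<phi>'_def)
qed

text \<open>The finite families are lists, so that repetitions count.\<close>

definition equitable_set :: "('v, 'e, 'a, 'b) graph_of_groups \<Rightarrow> ('v \<Rightarrow> 'a list) \<Rightarrow> bool" where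
  "equitable_set \<G> S \<longleftrightarrow>
     (\<forall>v\<in>verts (base \<G>). set (S v) \<subseteq> carrier (vgroup \<G> v) \<and>
        finite (rcosets\<^bsub>vgroup \<G> v\<^esub> (generate (vgroup \<G> v) (set (S v))))) \<and>
     (\<forall>e\<in>arcs (base \<G>). \<forall>c\<in>carrier (egroup \<G> e).
        generate (egroup \<G> e) {c} = carrier (egroup \<G> e) \<longrightarrow>
        (let u = tail (base \<G>) e; w = head (base \<G>) e in
         (\<Sum>s\<leftarrow>S u. intersection_number (vgroup \<G> u) (tail_map \<G> e c) s) =
         (\<Sum>t\<leftarrow>S w. intersection_number (vgroup \<G> w) (head_map \<G> e c) t)))"

section \<open>CAT(0) spaces\<close>

definition geodesic_path ::
  "'p set \<Rightarrow> ('p \<Rightarrow> 'p \<Rightarrow> real) \<Rightarrow> 'p \<Rightarrow> 'p \<Rightarrow> real \<Rightarrow> (real \<Rightarrow> 'p) \<Rightarrow> bool" where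
  "geodesic_path M d x y l c \<longleftrightarrow>
     0 \<le> l \<and> c 0 = x \<and> c l = y \<and> c \<in> {0..l} \<rightarrow> M \<and>
     (\<forall>s\<in>{0..l}. \<forall>t\<in>{0..l}. d (c s) (c t) = \<bar>s - t\<bar>)"

text \<open>The comparison inequality for geodesic triangles. Any two sides of a triangle share a vertex,
  here called \<open>x\<close>; for two points on the same side the inequality is an equality.\<close>

definition CAT0_space :: "'p set \<Rightarrow> ('p \<Rightarrow> 'p \<Rightarrow> real) \<Rightarrow> bool" where
  "CAT0_space M d \<longleftrightarrow>
     Metric_space M d \<and>
     (\<forall>x\<in>M. \<forall>y\<in>M. \<exists>l c. geodesic_path M d x y l c) \<and>
     (\<forall>x\<in>M. \<forall>y\<in>M. \<forall>z\<in>M. \<forall>l c l' c'.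
        geodesic_path M d x y l c \<longrightarrow> geodesic_path M d x z l' c' \<longrightarrow>
        (\<forall>x' y' z' :: real^2.
           dist x' y' = d x y \<longrightarrow> dist x' z' = d x z \<longrightarrow> dist y' z' = d y z \<longrightarrow>
           (\<forall>p\<in>c ` {0..l}. \<forall>q\<in>c' ` {0..l'}.
              \<forall>p'\<in>closed_segment x' y'. \<forall>q'\<in>closed_segment x' z'.
                dist x' p' = d x p \<longrightarrow> dist x' q' = d x q \<longrightarrow> d p q \<le> dist p' q')))"

section \<open>Cube complexes\<close>

definition unit_cube :: "nat \<Rightarrow> (nat \<Rightarrow> real) set" where
  "unit_cube n = ({..<n} \<rightarrow>\<^sub>E {0..1})"

definition cube_dist :: "nat \<Rightarrow> (nat \<Rightarrow> real) \<Rightarrow> (nat \<Rightarrow> real) \<Rightarrow> real" where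
  "cube_dist n a b = L2_set (\<lambda>i. a i - b i) {..<n}"

definition cube_face :: "nat \<Rightarrow> (nat \<Rightarrow> real) set \<Rightarrow> bool" where
  "cube_face n A \<longleftrightarrow> (\<exists>I c. I \<subseteq> {..<n} \<and> c \<in> I \<rightarrow> {0, 1} \<and>
     A = {a \<in> unit_cube n. \<forall>i\<in>I. a i = c i})"

definition cube_isometry ::
  "nat \<Rightarrow> (nat \<Rightarrow> real) set \<Rightarrow> nat \<Rightarrow> (nat \<Rightarrow> real) set \<Rightarrow> ((nat \<Rightarrow> real) \<Rightarrow> (nat \<Rightarrow> real)) \<Rightarrow> bool" where
  "cube_isometry n A m B h \<longleftrightarrow>
     bij_betw h A B \<and> (\<forall>a\<in>A. \<forall>b\<in>A. cube_dist m (h a) (h b) = cube_dist n a b)"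

text \<open>A cubical complex in the sense of Bridson and Haefliger (Metric Spaces of Non-Positive
  Curvature, Definition I.7.32), described by the set of the maps \<open>p\<close> from the unit cubes into the
  complex: each \<open>p\<close> is injective, and two cubes are disjoint or meet in a common face along which
  they are glued isometrically. There is no bound on the dimensions of the cubes and no finiteness
  condition.\<close>

type_synonym 'p cubical_complex = "(nat \<times> ((nat \<Rightarrow> real) \<Rightarrow> 'p)) set"

definition cc_points :: "'p cubical_complex \<Rightarrow> 'p set" where
  "cc_points K = (\<Union>(n, p)\<in>K. p ` unit_cube n)"

definition is_cubical_complex :: "'p cubical_complex \<Rightarrow> bool" where
  "is_cubical_complex K \<longleftrightarrow>
     (\<forall>(n, p)\<in>K. inj_on p (unit_cube n)) \<and>
     (\<forall>(n, p)\<in>K. \<forall>(m, q)\<in>K. p ` unit_cube n \<inter> q ` unit_cube m \<noteq> {} \<longrightarrow>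
        (\<exists>A B h. cube_face n A \<and> cube_face m B \<and> cube_isometry n A m B h \<and>
           (\<forall>a\<in>unit_cube n. \<forall>b\<in>unit_cube m. p a = q b \<longleftrightarrow> a \<in> A \<and> b = h a)))"

text \<open>\<open>cc_string K x y l\<close>: there are points \<open>x = x\<^sub>0, \<dots>, x\<^sub>m = y\<close>, consecutive ones lying in a
  common cube, whose distances within these cubes add up to \<open>l\<close>. The intrinsic distance is the
  infimum of such lengths; the value for points not joined by a string is a dummy.\<close>

inductive cc_string :: "'p cubical_complex \<Rightarrow> 'p \<Rightarrow> 'p \<Rightarrow> real \<Rightarrow> bool" for K where
  start: "x \<in> cc_points K \<Longrightarrow> cc_string K x x 0"
| step: "cc_string K x (p a) l \<Longrightarrow> (n, p) \<in> K \<Longrightarrow> a \<in> unit_cube n \<Longrightarrow> b \<in> unit_cube n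
    \<Longrightarrow> cc_string K x (p b) (l + cube_dist n a b)"

definition cc_dist :: "'p cubical_complex \<Rightarrow> 'p \<Rightarrow> 'p \<Rightarrow> real" where
  "cc_dist K x y = (if \<exists>l. cc_string K x y l then Inf {l. cc_string K x y l} else 0)"

definition CAT0_cube_complex :: "'p cubical_complex \<Rightarrow> bool" where
  "CAT0_cube_complex K \<longleftrightarrow>
     is_cubical_complex K \<and> cc_points K \<noteq> {} \<and>
     (\<forall>x\<in>cc_points K. \<forall>y\<in>cc_points K. \<exists>l. cc_string K x y l) \<and>
     CAT0_space (cc_points K) (cc_dist K)"

text \<open>Group elements act by cubical automorphisms, mapping each cube isometrically onto a cube.\<close>

definition cubical_action ::
  "'g monoid \<Rightarrow> 'p cubical_complex \<Rightarrow> ('g \<Rightarrow> 'p \<Rightarrow> 'p) \<Rightarrow> bool" where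
  "cubical_action G K \<phi> \<longleftrightarrow>
     group_action G (cc_points K) \<phi> \<and>
     (\<forall>g\<in>carrier G. \<forall>(n, p)\<in>K. \<exists>q h. (n, q) \<in> K \<and>
        cube_isometry n (unit_cube n) n (unit_cube n) h \<and>
        (\<forall>a\<in>unit_cube n. \<phi> g (p a) = q (h a)))"

definition free_action :: "'g monoid \<Rightarrow> 'p set \<Rightarrow> ('g \<Rightarrow> 'p \<Rightarrow> 'p) \<Rightarrow> bool" where
  "free_action G E \<phi> \<longleftrightarrow> (\<forall>x\<in>E. stabilizer G \<phi> x = {\<one>\<^bsub>G\<^esub>})"

text \<open>HOL cannot quantify over the type of points of the complex, so one type is fixed. For the
  countably infinite groups considered here it is no restriction: if \<open>G\<close> acts freely on some
  CAT(0) cube complex, it also acts freely on the convex subcomplex spanned by an orbit of vertices,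
  which has at most continuum many points and so can be realised on \<open>'g set \<Rightarrow> real\<close>.\<close>

definition acts_freely_on_CAT0_cube_complex :: "'g monoid \<Rightarrow> bool" where
  "acts_freely_on_CAT0_cube_complex G \<longleftrightarrow>
     (\<exists>(K :: ('g set \<Rightarrow> real) cubical_complex) \<phi>.
        CAT0_cube_complex K \<and> cubical_action G K \<phi> \<and> free_action G (cc_points K) \<phi>)"

end

theory Submission
  imports Defs
begin

text \<open>A group acts freely on a CAT(0) cube complex as soon as it acts on a set \<open>W\<close>, moves a subset
  \<open>A\<close> only by finite amounts, and every non-trivial element translates some orbit from outside \<open>A\<close>
  to inside \<open>A\<close>. The complex is the cube of all \<open>h : W \<rightarrow> [0, 1]\<close> that differ from the indicator of
  \<open>A\<close> in finitely many places. It is a convex subset of an inner product space, hence CAT(0). For a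
  tubular group with a free kernel two such actions suffice.

  Elements that are not conjugate into a vertex group are translations of the Bass--Serre tree, with
  \<open>A\<close> the set of edges oriented away from a base point.

  For the vertex groups let \<open>h\<close> be the projection to \<open>\<int>\<close>. It does not vanish on any edge group,
  because otherwise two adjacent vertex groups would commute with each other. On each vertex group
  choose a second linear function \<open>k\<close> and let the group translate two copies of \<open>\<int>\<close> by \<open>M h + k\<close> and
  \<open>M h - k\<close>. For large \<open>M\<close> a generator \<open>x\<close> of an edge group translates both copies in the same
  direction, with \<open>2 M h(x)\<close> orbits in total. This number is the same at both ends of the edge, so the
  actions can be glued along the edge groups; it is also the number in the equitable condition for
  the two vectors whose intersection numbers with \<open>x\<close> are \<open>\<bar>M h(x) \<plusminus> k(x)\<bar>\<close>.\<close>

section \<open>The infinite cube\<close>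

text \<open>The fundamental group comes as a presentation relative to a spanning tree, and all
  information about it is extracted from explicit actions rather than from a normal form theorem.
  Data that respect the edge relations, with arbitrary images of the stable letters, are corrected
  by a gauge \<beta> on the vertices that makes the tree letters trivial
  (\<open>spanning_tree_gauge\<close>, \<open>P_hom_exists\<close>). So one copy of Z^2 can serve
  for all vertex groups: the tree is that of a multiple HNN extension of Z^2 with one stable letter
  per edge. Its action also shows that the vertex groups embed and that, across an edge, elements
  outside the edge group do not commute. Of the free kernel only a trace of cyclic centralizers is
  used (\<open>cyclic_roots\<close>): a common exponent takes the centralizer of x into the powers
  of x, and roots of that exponent are unique there. The points of the complex must have type
  \<open>'g set \<Rightarrow> real\<close>, so W has to inject into \<open>'g set\<close>; it is
  kept countable for this purpose.\<close>

definition commensurator :: "'i set \<Rightarrow> ('i \<Rightarrow> 'i) monoid" where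
  "commensurator A =
     \<lparr>carrier = {f. bij f \<and> finite {i. (f i \<in> A) \<noteq> (i \<in> A)}}, monoid.mult = (\<circ>), one = id\<rparr>"

lemma commensurator_simps [simp]:
  "f \<in> carrier (commensurator A) \<longleftrightarrow> bij f \<and> finite {i. (f i \<in> A) \<noteq> (i \<in> A)}"
  "f \<otimes>\<^bsub>commensurator A\<^esub> g = f \<circ> g"
  "\<one>\<^bsub>commensurator A\<^esub> = id"
  by (simp_all add: commensurator_def)

lemma commensurator_inv_closed:
  assumes "bij f" "finite {i. (f i \<in> A) \<noteq> (i \<in> A)}"
  shows "bij (inv_into UNIV f)" "finite {i. (inv_into UNIV f i \<in> A) \<noteq> (i \<in> A)}"
proof -
  show "bij (inv_into UNIV f)"
    using assms by (simp add: bij_imp_bij_inv)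
  have f: "f (inv_into UNIV f i) = i" for i
    by (rule surj_f_inv_f[OF bij_is_surj[OF assms(1)]])
  have "{i. (inv_into UNIV f i \<in> A) \<noteq> (i \<in> A)} \<subseteq> f ` {i. (f i \<in> A) \<noteq> (i \<in> A)}"
  proof
    fix i assume "i \<in> {i. (inv_into UNIV f i \<in> A) \<noteq> (i \<in> A)}"
    then have "inv_into UNIV f i \<in> {i. (f i \<in> A) \<noteq> (i \<in> A)}"
      unfolding mem_Collect_eq f by blast
    then show "i \<in> f ` {i. (f i \<in> A) \<noteq> (i \<in> A)}"
      using f by (metis imageI)
  qed
  then show "finite {i. (inv_into UNIV f i \<in> A) \<noteq> (i \<in> A)}"
    by (rule finite_surj[OF assms(2)])
qed

lemma group_commensurator: "group (commensurator A)"
proof (rule groupI)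
  fix f g assume f: "f \<in> carrier (commensurator A)" and g: "g \<in> carrier (commensurator A)"
  have "{i. (f (g i) \<in> A) \<noteq> (i \<in> A)}
      \<subseteq> g -` {i. (f i \<in> A) \<noteq> (i \<in> A)} \<union> {i. (g i \<in> A) \<noteq> (i \<in> A)}"
    by auto
  moreover have "finite (g -` {i. (f i \<in> A) \<noteq> (i \<in> A)})"
    using f g by (intro finite_vimageI) (auto simp: bij_is_inj)
  ultimately have "finite {i. (f (g i) \<in> A) \<noteq> (i \<in> A)}"
    using g finite_subset by fastforce
  then show "f \<otimes>\<^bsub>commensurator A\<^esub> g \<in> carrier (commensurator A)"
    using f g by (simp add: bij_comp)
next
  fix f assume f: "f \<in> carrier (commensurator A)"
  then show "\<exists>g\<in>carrier (commensurator A). g \<otimes>\<^bsub>commensurator A\<^esub> f = \<one>\<^bsub>commensurator A\<^esub>"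
    using commensurator_inv_closed[of f A] bij_is_inj[of f]
    by (intro bexI[of _ "inv_into UNIV f"]) simp_all
qed (simp_all add: comp_assoc)

lemma inv_commensurator:
  assumes "f \<in> carrier (commensurator A)"
  shows "inv\<^bsub>commensurator A\<^esub> f = inv_into UNIV f"
proof -
  interpret group "commensurator A" by (rule group_commensurator)
  show ?thesis
    using assms commensurator_inv_closed[of f A] bij_is_inj[of f] by (intro inv_equality) simp_all
qed

section \<open>The infinite cube as a convex subset of an inner product space\<close>

definition cube_points :: "'i set \<Rightarrow> ('i \<Rightarrow> real) set" where
  "cube_points A = {h. (\<forall>i. 0 \<le> h i \<and> h i \<le> 1) \<and> finite {i. h i \<noteq> indicat_real A i}}"

text \<open>The l2 distance, summed only over the places where the functions differ, so that it
  makes sense on an infinite index type; if infinitely many places differ, the value is the dummy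
  0.\<close>

definition fin_dist :: "('i \<Rightarrow> real) \<Rightarrow> ('i \<Rightarrow> real) \<Rightarrow> real" where
  "fin_dist h k = L2_set (\<lambda>i. h i - k i) {i. h i \<noteq> k i}"

lemma fin_dist_eq:
  assumes "finite S" "{i. h i \<noteq> k i} \<subseteq> S"
  shows "fin_dist h k = L2_set (\<lambda>i. h i - k i) S"
  unfolding fin_dist_def L2_set_def
  using assms by (intro arg_cong[of _ _ sqrt] sum.mono_neutral_left) auto

lemma fin_dist_sq:
  assumes "finite S" "{i. h i \<noteq> k i} \<subseteq> S"
  shows "(fin_dist h k)\<^sup>2 = (\<Sum>i\<in>S. (h i - k i)\<^sup>2)"
  unfolding fin_dist_eq[OF assms] L2_set_def by (simp add: sum_nonneg)

lemma fin_dist_nonneg [simp]: "0 \<le> fin_dist h k"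
  by (simp add: fin_dist_def)

lemma fin_dist_refl [simp]: "fin_dist h h = 0"
  by (simp add: fin_dist_def)

lemma fin_dist_commute: "fin_dist h k = fin_dist k h"
proof -
  have "{i. h i \<noteq> k i} = {i. k i \<noteq> h i}"
    by auto
  then show ?thesis
    by (simp add: fin_dist_def L2_set_def power2_commute)
qed

lemma cube_points_diff_finite:
  assumes "h \<in> cube_points A" "k \<in> cube_points A"
  shows "finite {i. h i \<noteq> k i}"
proof (rule finite_subset)
  show "{i. h i \<noteq> k i} \<subseteq> {i. h i \<noteq> indicat_real A i} \<union> {i. k i \<noteq> indicat_real A i}"
    by auto
  show "finite ({i. h i \<noteq> indicat_real A i} \<union> {i. k i \<noteq> indicat_real A i})"
    using assms by (simp add: cube_points_def)
qed

lemma Metric_space_fin_dist: "Metric_space (cube_points A) fin_dist"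
proof
  fix h k assume hk: "h \<in> cube_points A" "k \<in> cube_points A"
  show "fin_dist h k = 0 \<longleftrightarrow> h = k"
    using cube_points_diff_finite[OF hk]
    by (auto simp: fin_dist_def L2_set_eq_0_iff fun_eq_iff)
  fix m assume m: "m \<in> cube_points A"
  define S where "S = {i. h i \<noteq> k i} \<union> {i. k i \<noteq> m i} \<union> {i. h i \<noteq> m i}"
  have S: "finite S"
    using cube_points_diff_finite[OF hk(1) m] cube_points_diff_finite[OF hk]
      cube_points_diff_finite[OF hk(2) m] by (simp add: S_def)
  have eq: "fin_dist h k = L2_set (\<lambda>i. h i - k i) S" "fin_dist k m = L2_set (\<lambda>i. k i - m i) S"
    "fin_dist h m = L2_set (\<lambda>i. h i - m i) S"
    using S by (auto intro!: fin_dist_eq simp: S_def)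
  show "fin_dist h m \<le> fin_dist h k + fin_dist k m"
    unfolding eq using L2_set_triangle_ineq[of "\<lambda>i. h i - k i" "\<lambda>i. k i - m i" S] by simp
qed (auto simp: fin_dist_commute)

text \<open>Equality case of the triangle inequality. By Stewart's identity the squared distance
  from p to (1 - t) x + t y is a combination of the three given squared distances, here (1 - t) t^2
  + t (1 - t)^2 - t (1 - t) = 0 times the square of \<open>fin_dist x y\<close>. Hence geodesics are
  affine segments.\<close>

lemma fin_dist_affine:
  assumes fin: "finite S" "{i. x i \<noteq> y i} \<subseteq> S" "{i. x i \<noteq> p i} \<subseteq> S"
    and d: "fin_dist x p = t * fin_dist x y" "fin_dist p y = (1 - t) * fin_dist x y"
  shows "p i = (1 - t) * x i + t * y i"
proof (cases "i \<in> S")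
  case False
  then have "x i = y i" "x i = p i"
    using fin by auto
  then show ?thesis
    by (simp add: algebra_simps)
next
  case True
  have "{i. p i \<noteq> y i} \<subseteq> {i. x i \<noteq> y i} \<union> {i. x i \<noteq> p i}"
    by auto
  then have py: "{i. p i \<noteq> y i} \<subseteq> S"
    using fin by blast
  have "(\<Sum>i\<in>S. (p i - ((1 - t) * x i + t * y i))\<^sup>2)
      = (1 - t) * (\<Sum>i\<in>S. (x i - p i)\<^sup>2) + t * (\<Sum>i\<in>S. (p i - y i)\<^sup>2)
        - t * (1 - t) * (\<Sum>i\<in>S. (x i - y i)\<^sup>2)"
    unfolding sum_distrib_left sum.distrib[symmetric] sum_subtractf[symmetric]
    by (rule sum.cong[OF HOL.refl]) (simp add: power2_eq_square algebra_simps)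
  also have "\<dots> = (1 - t) * (fin_dist x p)\<^sup>2 + t * (fin_dist p y)\<^sup>2
      - t * (1 - t) * (fin_dist x y)\<^sup>2"
    using fin py by (simp add: fin_dist_sq)
  also have "\<dots> = 0"
    unfolding d by (simp add: power2_eq_square algebra_simps)
  finally have "\<forall>i\<in>S. (p i - ((1 - t) * x i + t * y i))\<^sup>2 = 0"
    using fin(1) by (subst (asm) sum_nonneg_eq_0_iff) auto
  then show ?thesis
    using True by simp
qed

text \<open>The right-hand side involves only t, u and the side lengths. Since
  \<open>dist_law_of_cosines\<close> has the same right-hand side in the plane, the comparison
  inequality becomes an equality.\<close>

lemma fin_dist_law_of_cosines:
  assumes fin: "finite S" "{i. x i \<noteq> y i} \<subseteq> S" "{i. x i \<noteq> z i} \<subseteq> S"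
    and p: "\<And>i. p i = (1 - t) * x i + t * y i" and q: "\<And>i. q i = (1 - u) * x i + u * z i"
  shows "(fin_dist p q)\<^sup>2 = t\<^sup>2 * (fin_dist x y)\<^sup>2 + u\<^sup>2 * (fin_dist x z)\<^sup>2
    - t * u * ((fin_dist x y)\<^sup>2 + (fin_dist x z)\<^sup>2 - (fin_dist y z)\<^sup>2)"
proof -
  have "{i. y i \<noteq> z i} \<subseteq> {i. x i \<noteq> y i} \<union> {i. x i \<noteq> z i}"
    "{i. p i \<noteq> q i} \<subseteq> {i. x i \<noteq> y i} \<union> {i. x i \<noteq> z i}"
    by (auto simp: p q algebra_simps)
  then have sub: "{i. y i \<noteq> z i} \<subseteq> S" "{i. p i \<noteq> q i} \<subseteq> S"
    using fin by blast+
  show ?thesis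
    unfolding fin_dist_sq[OF fin(1) fin(2)] fin_dist_sq[OF fin(1) fin(3)]
      fin_dist_sq[OF fin(1) sub(1)] fin_dist_sq[OF fin(1) sub(2)]
    unfolding sum_distrib_left sum.distrib[symmetric] sum_subtractf[symmetric]
    by (rule sum.cong[OF HOL.refl], unfold p q) (simp add: power2_eq_square algebra_simps)
qed

lemma dist_law_of_cosines:
  fixes x y z :: "'a :: real_inner"
  shows "(dist ((1 - t) *\<^sub>R x + t *\<^sub>R y) ((1 - u) *\<^sub>R x + u *\<^sub>R z))\<^sup>2
    = t\<^sup>2 * (dist x y)\<^sup>2 + u\<^sup>2 * (dist x z)\<^sup>2
      - t * u * ((dist x y)\<^sup>2 + (dist x z)\<^sup>2 - (dist y z)\<^sup>2)"
proof -
  define a b where "a = y - x" and "b = z - x"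
  have eq: "(1 - t) *\<^sub>R x + t *\<^sub>R y - ((1 - u) *\<^sub>R x + u *\<^sub>R z) = t *\<^sub>R a - u *\<^sub>R b"
    "x - y = - a" "x - z = - b" "y - z = a - b"
    by (simp_all add: a_def b_def algebra_simps)
  show ?thesis
    unfolding dist_norm eq norm_minus_cancel power2_norm_eq_inner
    by (simp add: inner_diff_left inner_diff_right inner_commute[of b a]
        power2_eq_square algebra_simps)
qed

lemma CAT0_cube_points: "CAT0_space (cube_points A) fin_dist"
  unfolding CAT0_space_def
proof (intro conjI ballI allI impI)
  show "Metric_space (cube_points A) fin_dist"
    by (rule Metric_space_fin_dist)
next
  fix x y assume x: "x \<in> cube_points A" and y: "y \<in> cube_points A"
  define l where "l = fin_dist x y"
  define c where "c = (\<lambda>s i. (1 - s / l) * x i + s / l * y i)"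
  have S: "finite {i. x i \<noteq> y i}"
    by (rule cube_points_diff_finite[OF x y])
  have c0: "c 0 = x"
    by (simp add: c_def)
  have cl: "c l = y"
  \<comment> \<open>Division by 0 makes c constantly x here, so x = y has to be known.\<close>
  proof (cases "l = 0")
    case True
    then have "x = y"
      using x y Metric_space.zero[OF Metric_space_fin_dist] unfolding l_def by blast
    then show ?thesis
      by (simp add: c_def fun_eq_iff algebra_simps)
  qed (simp add: c_def)
  have "c s \<in> cube_points A" if s: "s \<in> {0..l}" for s
  proof -
    have "0 \<le> s / l" "s / l \<le> 1"
      using s by (auto simp: divide_le_eq_1)
    then have "0 \<le> c s i \<and> c s i \<le> 1" for i
      using x y convex_bound_le[of "x i" 1 "y i" "1 - s / l" "s / l"]
      unfolding c_def cube_points_def by (auto intro!: add_nonneg_nonneg mult_nonneg_nonneg simp del: times_divide_eq_left)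
    moreover have "{i. c s i \<noteq> indicat_real A i}
        \<subseteq> {i. x i \<noteq> indicat_real A i} \<union> {i. y i \<noteq> indicat_real A i}"
      by (auto simp: c_def algebra_simps)
    moreover have "finite ({i. x i \<noteq> indicat_real A i} \<union> {i. y i \<noteq> indicat_real A i})"
      using x y by (simp add: cube_points_def)
    ultimately have "\<forall>i. 0 \<le> c s i \<and> c s i \<le> 1" "finite {i. c s i \<noteq> indicat_real A i}"
      using finite_subset by blast+
    then show ?thesis
      by (simp add: cube_points_def)
  qed
  moreover have "fin_dist (c s) (c t) = \<bar>s - t\<bar>" if "s \<in> {0..l}" "t \<in> {0..l}" for s t
  proof -
    have "(fin_dist (c s) (c t))\<^sup>2 = ((s / l) * l - (t / l) * l)\<^sup>2"
      using fin_dist_law_of_cosines[OF S order_refl order_refl, of "c s" "s / l" "c t" "t / l"]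
      by (simp add: c_def flip: l_def) (simp add: power2_eq_square algebra_simps)
    also have "\<dots> = (s - t)\<^sup>2"
      using that by (cases "l = 0") auto
    finally have "sqrt ((fin_dist (c s) (c t))\<^sup>2) = sqrt ((s - t)\<^sup>2)"
      by (rule arg_cong)
    then show ?thesis
      by simp
  qed
  ultimately show "\<exists>l c. geodesic_path (cube_points A) fin_dist x y l c"
    using c0 cl by (intro exI[of _ l] exI[of _ c]) (auto simp: geodesic_path_def l_def)
next
  fix x y z l c l' c' p q and x' y' z' p' q' :: "real^2"
  assume xyz: "x \<in> cube_points A" "y \<in> cube_points A" "z \<in> cube_points A"
    and c: "geodesic_path (cube_points A) fin_dist x y l c"
    and c': "geodesic_path (cube_points A) fin_dist x z l' c'"
    and d: "dist x' y' = fin_dist x y" "dist x' z' = fin_dist x z" "dist y' z' = fin_dist y z"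
    and p: "p \<in> c ` {0..l}" and q: "q \<in> c' ` {0..l'}"
    and p': "p' \<in> closed_segment x' y'" and q': "q' \<in> closed_segment x' z'"
    and dp: "dist x' p' = fin_dist x p" and dq: "dist x' q' = fin_dist x q"
  \<comment> \<open>The parameter t of p' on the comparison side also locates p: its distances to
    the two ends are t and 1 - t times the side, so \<open>fin_dist_affine\<close> applies. Both
    sides of the triangle need this, hence the general y, l, c.\<close>
  have geo: "\<exists>t. p' = (1 - t) *\<^sub>R x' + t *\<^sub>R y' \<and> (\<forall>i. p i = (1 - t) * x i + t * y i)"
    if xy: "x \<in> cube_points A" "y \<in> cube_points A"
      and c: "geodesic_path (cube_points A) fin_dist x y l c" and p: "p \<in> c ` {0..l}"
      and d: "dist x' y' = fin_dist x y" and p': "p' \<in> closed_segment x' y'"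
      and dp: "dist x' p' = fin_dist x p" for y l c p and y' p' :: "real^2"
  proof -
    obtain t where t: "p' = (1 - t) *\<^sub>R x' + t *\<^sub>R y'" "0 \<le> t" "t \<le> 1"
      using p' by (auto simp: closed_segment_def)
    obtain s where s: "p = c s" "s \<in> {0..l}"
      using p by auto
    have c0: "c 0 = x" "c l = y" "0 \<le> l"
      and iso: "\<And>s t. s \<in> {0..l} \<Longrightarrow> t \<in> {0..l} \<Longrightarrow> fin_dist (c s) (c t) = \<bar>s - t\<bar>"
      and pX: "p \<in> cube_points A"
      using c s by (auto simp: geodesic_path_def)
    have "fin_dist x p = s" "fin_dist p y = l - s" "fin_dist x y = l"
      using iso[of 0 s] iso[of s l] iso[of 0 l] s c0 by auto
    moreover have "dist x' p' = t * dist x' y'"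
    proof -
      have "x' - p' = t *\<^sub>R (x' - y')"
        by (simp add: t algebra_simps)
      then show ?thesis
        using t(2) by (simp add: dist_norm)
    qed
    ultimately have "fin_dist x p = t * fin_dist x y" "fin_dist p y = (1 - t) * fin_dist x y"
      using dp d by (auto simp: algebra_simps)
    then have "p i = (1 - t) * x i + t * y i" for i
      using cube_points_diff_finite[OF xy] cube_points_diff_finite[OF xy(1) pX]
      by (intro fin_dist_affine[of "{i. x i \<noteq> y i} \<union> {i. x i \<noteq> p i}"]) auto
    then show ?thesis
      using t by blast
  qed
  obtain t where t: "p' = (1 - t) *\<^sub>R x' + t *\<^sub>R y'" "\<And>i. p i = (1 - t) * x i + t * y i"
    using geo[OF xyz(1,2) c p d(1) p' dp] by blast
  obtain u where u: "q' = (1 - u) *\<^sub>R x' + u *\<^sub>R z'" "\<And>i. q i = (1 - u) * x i + u * z i"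
    using geo[OF xyz(1,3) c' q d(2) q' dq] by blast
  have "(fin_dist p q)\<^sup>2 = (dist p' q')\<^sup>2"
    unfolding t(1) u(1) dist_law_of_cosines d
    using cube_points_diff_finite xyz t(2) u(2)
    by (intro fin_dist_law_of_cosines[of "{i. x i \<noteq> y i} \<union> {i. x i \<noteq> z i}"]) auto
  then show "fin_dist p q \<le> dist p' q'"
    by (simp add: power2_eq_iff_nonneg)
qed


section \<open>The cubical structure and its intrinsic metric\<close>

definition face_map :: "(nat \<Rightarrow> 'i) \<Rightarrow> nat \<Rightarrow> ('i \<Rightarrow> real) \<Rightarrow> (nat \<Rightarrow> real) \<Rightarrow> 'i \<Rightarrow> real" where
  "face_map s n v a i = (if i \<in> s ` {..<n} then a (the_inv_into {..<n} s i) else v i)"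

text \<open>Faces are listed with every enumeration s of their free coordinates and every base
  vertex v. This redundancy makes the family invariant under the commensurator, with
  \<open>id\<close> as the isometry between the parameter cubes.\<close>

definition infinite_cube :: "'i set \<Rightarrow> ('i \<Rightarrow> real) cubical_complex" where
  "infinite_cube A = {(n, face_map s n v) |n s v.
     inj_on s {..<n} \<and> v \<in> cube_points A \<and> (\<forall>i. v i \<in> {0, 1})}"

lemma face_map_image:
  "inj_on s {..<n} \<Longrightarrow> j < n \<Longrightarrow> face_map s n v a (s j) = a j"
  by (simp add: face_map_def the_inv_into_f_f)

lemma face_map_off: "i \<notin> s ` {..<n} \<Longrightarrow> face_map s n v a i = v i"
  by (simp add: face_map_def)

lemma face_map_diff: "{i. face_map s n v a i \<noteq> face_map s n v b i} \<subseteq> s ` {..<n}"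
  by (auto simp: face_map_def)

lemma unit_cube_bounds: "a \<in> unit_cube n \<Longrightarrow> j < n \<Longrightarrow> 0 \<le> a j \<and> a j \<le> 1"
  by (auto simp: unit_cube_def PiE_iff)

lemma face_map_in_cube_points:
  assumes "inj_on s {..<n}" "v \<in> cube_points A" "a \<in> unit_cube n"
  shows "face_map s n v a \<in> cube_points A"
proof -
  have "0 \<le> face_map s n v a i \<and> face_map s n v a i \<le> 1" for i
  proof (cases "i \<in> s ` {..<n}")
    case True
    then obtain j where "j < n" "i = s j"
      by auto
    then show ?thesis
      using assms unit_cube_bounds by (simp add: face_map_image)
  next
    case False
    then show ?thesis
      using assms(2) by (simp add: face_map_off cube_points_def)
  qed
  moreover have "{i. face_map s n v a i \<noteq> indicat_real A i}
      \<subseteq> s ` {..<n} \<union> {i. v i \<noteq> indicat_real A i}"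
    by (auto simp: face_map_def)
  then have "finite {i. face_map s n v a i \<noteq> indicat_real A i}"
    by (rule finite_subset) (use assms(2) in \<open>simp add: cube_points_def\<close>)
  ultimately show ?thesis
    by (simp add: cube_points_def)
qed

lemma cube_dist_eq_fin_dist:
  assumes "inj_on s {..<n}"
  shows "cube_dist n a b = fin_dist (face_map s n v a) (face_map s n v b)"
proof -
  have "fin_dist (face_map s n v a) (face_map s n v b)
      = L2_set (\<lambda>i. face_map s n v a i - face_map s n v b i) (s ` {..<n})"
    by (rule fin_dist_eq[OF _ face_map_diff]) simp
  also have "\<dots> = cube_dist n a b"
    using assms by (simp add: L2_set_def cube_dist_def sum.reindex face_map_image)
  finally show ?thesis ..
qed

lemma inj_on_face_map:
  assumes "inj_on s {..<n}"
  shows "inj_on (face_map s n v) (unit_cube n)"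
proof (rule inj_onI)
  fix a b assume ab: "a \<in> unit_cube n" "b \<in> unit_cube n" "face_map s n v a = face_map s n v b"
  have "a j = b j" if "j \<in> {..<n}" for j
    using fun_cong[OF ab(3), of "s j"] that assms by (simp add: face_map_image)
  then show "a = b"
    using ab(1,2) unfolding unit_cube_def by (intro PiE_ext)
qed

text \<open>Both points differ from the vertex \<open>indicat_real A\<close> at finitely many
  places; letting these places vary gives a finite-dimensional cube through both. Thus any two
  points are joined by a string of one step.\<close>

lemma common_cube:
  assumes "h \<in> cube_points A" "k \<in> cube_points A"
  obtains n p a b where "(n, p) \<in> infinite_cube A" "a \<in> unit_cube n" "b \<in> unit_cube n"
    "p a = h" "p b = k"
proof -
  define S where "S = {i. h i \<noteq> indicat_real A i} \<union> {i. k i \<noteq> indicat_real A i}"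
  have "finite S"
    using assms by (simp add: S_def cube_points_def)
  then obtain s where s: "bij_betw s {..<card S} S"
    using ex_bij_betw_nat_finite[of S] by (auto simp: atLeast0LessThan)
  define n where "n = card S"
  define c where "c = (\<lambda>h::'a \<Rightarrow> real. restrict (h \<circ> s) {..<n})"
  have inj: "inj_on s {..<n}" and img: "s ` {..<n} = S"
    using s by (auto simp: bij_betw_def n_def)
  have "indicat_real A \<in> cube_points A" "\<forall>i. indicat_real A i \<in> {0, 1}"
    by (auto simp: cube_points_def indicator_def)
  then have "(n, face_map s n (indicat_real A)) \<in> infinite_cube A"
    using inj by (auto simp: infinite_cube_def)
  moreover have "c h \<in> unit_cube n" if "h \<in> cube_points A" for h
    using that by (auto simp: c_def unit_cube_def cube_points_def)
  moreover have "face_map s n (indicat_real A) (c f) = f" if "f \<in> {h, k}" for f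
  proof
    fix i show "face_map s n (indicat_real A) (c f) i = f i"
    proof (cases "i \<in> s ` {..<n}")
      case True
      then obtain j where "j < n" "i = s j"
        by auto
      then show ?thesis
        using inj by (simp add: face_map_image c_def)
    next
      case False
      then show ?thesis
        using that img by (auto simp: face_map_off S_def)
    qed
  qed
  ultimately show thesis
    using that assms by blast
qed

lemma cc_points_infinite_cube: "cc_points (infinite_cube A) = cube_points A"
proof
  show "cc_points (infinite_cube A) \<subseteq> cube_points A"
    by (auto simp: cc_points_def infinite_cube_def intro: face_map_in_cube_points)
  show "cube_points A \<subseteq> cc_points (infinite_cube A)"
  proof
    fix h assume h: "h \<in> cube_points A"
    from common_cube[OF h h] show "h \<in> cc_points (infinite_cube A)"
      unfolding cc_points_def by blast
  qed
qed

text \<open>The point given by a is read off again in the coordinates of the second face. It lies on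
  that face because the condition on a freezes the directions that are free only in the first face,
  and \<open>agree\<close> matches the base vertices where neither face is free. Used in both
  directions, this glues two faces along their intersection.\<close>

lemma face_maps_glue:
  assumes inj: "inj_on s {..<n}" "inj_on s' {..<m}"
    and v: "\<forall>i. v i \<in> {0, 1::real}"
    and agree: "\<And>i. i \<notin> s ` {..<n} \<Longrightarrow> i \<notin> s' ` {..<m} \<Longrightarrow> v i = v' i"
    and a: "a \<in> unit_cube n" "\<forall>j\<in>{j \<in> {..<n}. s j \<notin> s' ` {..<m}}. a j = v' (s j)"
  defines "b \<equiv> restrict (face_map s n v a \<circ> s') {..<m}"
  shows "b \<in> unit_cube m" "\<forall>j\<in>{j \<in> {..<m}. s' j \<notin> s ` {..<n}}. b j = v (s' j)"
    "face_map s' m v' b = face_map s n v a"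
proof -
  have "0 \<le> face_map s n v a i \<and> face_map s n v a i \<le> 1" for i
  proof (cases "i \<in> s ` {..<n}")
    case True
    then obtain j where "j < n" "i = s j"
      by auto
    then show ?thesis
      using inj a unit_cube_bounds by (simp add: face_map_image)
  next
    case False
    then show ?thesis
      using v[rule_format, of i] by (auto simp: face_map_off)
  qed
  then show "b \<in> unit_cube m"
    by (auto simp: b_def unit_cube_def)
  show "\<forall>j\<in>{j \<in> {..<m}. s' j \<notin> s ` {..<n}}. b j = v (s' j)"
    by (auto simp: b_def face_map_off)
  show "face_map s' m v' b = face_map s n v a"
  proof
    fix i
    consider (1) k where "k < m" "i = s' k"
      | (2) j where "i \<notin> s' ` {..<m}" "j < n" "i = s j" | (3) "i \<notin> s ` {..<n}" "i \<notin> s' ` {..<m}"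
      by auto
    then show "face_map s' m v' b i = face_map s n v a i"
    proof cases
      case 1
      then show ?thesis using inj by (simp add: face_map_image b_def)
    next
      case 2
      then have "a j = v' (s j)"
        using a(2) by simp
      then show ?thesis using inj 2 by (simp add: face_map_image face_map_off)
    next
      case 3
      then show ?thesis by (simp add: face_map_off agree)
    qed
  qed
qed

lemma is_cubical_complex_infinite_cube: "is_cubical_complex (infinite_cube A)"
proof -
  have meet: "\<exists>B C h. cube_face n B \<and> cube_face m C \<and> cube_isometry n B m C h \<and>
      (\<forall>a\<in>unit_cube n. \<forall>b\<in>unit_cube m.
         face_map s n v a = face_map s' m v' b \<longleftrightarrow> a \<in> B \<and> b = h a)"
    if inj: "inj_on s {..<n}" "inj_on s' {..<m}"
      and v: "\<forall>i. v i \<in> {0, 1}" "\<forall>i. v' i \<in> {0, 1}"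
      and ne: "face_map s n v ` unit_cube n \<inter> face_map s' m v' ` unit_cube m \<noteq> {}"
    for s s' :: "nat \<Rightarrow> 'a" and n m v v'
  proof -
    let ?p = "face_map s n v" and ?q = "face_map s' m v'"
    let ?I = "{j \<in> {..<n}. s j \<notin> s' ` {..<m}}" and ?J = "{j \<in> {..<m}. s' j \<notin> s ` {..<n}}"
    \<comment> \<open>B and C are the intersection of the two faces as seen from each of them; h and
      h' are the changes of coordinates.\<close>
    define B where "B = {a \<in> unit_cube n. \<forall>j\<in>?I. a j = (v' \<circ> s) j}"
    define C where "C = {b \<in> unit_cube m. \<forall>j\<in>?J. b j = (v \<circ> s') j}"
    define h where "h = (\<lambda>a. restrict (?p a \<circ> s') {..<m})"
    define h' where "h' = (\<lambda>b. restrict (?q b \<circ> s) {..<n})"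
    obtain a0 b0 where "?p a0 = ?q b0"
      using ne by auto
    then have agree: "v i = v' i" if "i \<notin> s ` {..<n}" "i \<notin> s' ` {..<m}" for i
      using that by (metis face_map_off)
    have h: "h a \<in> C" "?q (h a) = ?p a" if "a \<in> B" for a
      using face_maps_glue[OF inj v(1) agree, of a] that by (auto simp: B_def C_def h_def)
    have h': "h' b \<in> B" "?p (h' b) = ?q b" if "b \<in> C" for b
      using face_maps_glue[OF inj(2,1) v(2) agree[symmetric], of b] that
      by (auto simp: B_def C_def h'_def)
    have sub: "B \<subseteq> unit_cube n" "C \<subseteq> unit_cube m"
      by (auto simp: B_def C_def)
    have injp: "inj_on ?p (unit_cube n)" and injq: "inj_on ?q (unit_cube m)"
      using inj inj_on_face_map by blast+
    have "inj_on h B"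
      using h(2) injp sub by (intro inj_onI) (metis inj_on_eq_iff subsetD)
    moreover have "h ` B = C"
    proof (intro equalityI subsetI)
      fix b assume b: "b \<in> C"
      then have "?q (h (h' b)) = ?q b"
        using h h' by simp
      then have "h (h' b) = b"
        using b h h' sub injq by (meson inj_on_eq_iff subsetD)
      then show "b \<in> h ` B"
        using h' b by force
    qed (use h in auto)
    moreover have "cube_dist m (h a) (h b) = cube_dist n a b" if "a \<in> B" "b \<in> B" for a b
      using that h(2) inj by (simp add: cube_dist_eq_fin_dist[of s' m _ _ v'] cube_dist_eq_fin_dist[of s n _ _ v])
    ultimately have "cube_isometry n B m C h"
      by (simp add: cube_isometry_def bij_betw_def)
    moreover have "cube_face n B"
      unfolding cube_face_def
    proof (intro exI[of _ ?I] exI[of _ "v' \<circ> s"] conjI)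
      show "v' \<circ> s \<in> ?I \<rightarrow> {0, 1}"
        using v by (simp add: Pi_def)
    qed (auto simp: B_def)
    moreover have "cube_face m C"
      unfolding cube_face_def
    proof (intro exI[of _ ?J] exI[of _ "v \<circ> s'"] conjI)
      show "v \<circ> s' \<in> ?J \<rightarrow> {0, 1}"
        using v by (simp add: Pi_def)
    qed (auto simp: C_def)
    moreover have "?p a = ?q b \<longleftrightarrow> a \<in> B \<and> b = h a"
      if "a \<in> unit_cube n" "b \<in> unit_cube m" for a b
    proof
      assume eq: "?p a = ?q b"
      have "a j = v' (s j)" if "j < n" "s j \<notin> s' ` {..<m}" for j
        using fun_cong[OF eq, of "s j"] that inj by (simp add: face_map_image face_map_off)
      then have "a \<in> B"
        using that by (simp add: B_def)
      moreover from this have "?q b = ?q (h a)"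
        using eq h by simp
      then have "b = h a"
        using injq that(2) h(1)[OF \<open>a \<in> B\<close>] sub by (meson inj_on_eq_iff subsetD)
      ultimately show "a \<in> B \<and> b = h a" ..
    next
      assume "a \<in> B \<and> b = h a"
      then show "?p a = ?q b"
        using h by simp
    qed
    ultimately show ?thesis
      by blast
  qed
  have K: "\<exists>s v. p = face_map s n v \<and> inj_on s {..<n} \<and> (\<forall>i. v i \<in> {0, 1})"
    if "(n, p) \<in> infinite_cube A" for n p
    using that unfolding infinite_cube_def by blast
  show ?thesis
    unfolding is_cubical_complex_def
  proof (intro conjI ballI; clarify)
    fix n p assume "(n, p) \<in> infinite_cube A"
    from K[OF this] show "inj_on p (unit_cube n)"
      by (auto intro: inj_on_face_map)
  next
    fix n p m q assume np: "(n, p) \<in> infinite_cube A" and mq: "(m, q) \<in> infinite_cube A"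
      and ne: "p ` unit_cube n \<inter> q ` unit_cube m \<noteq> {}"
    obtain s v where s: "p = face_map s n v" "inj_on s {..<n}" "\<forall>i. v i \<in> {0, 1}"
      using K[OF np] by blast
    obtain s' v' where s': "q = face_map s' m v'" "inj_on s' {..<m}" "\<forall>i. v' i \<in> {0, 1}"
      using K[OF mq] by blast
    show "\<exists>B C h. cube_face n B \<and> cube_face m C \<and> cube_isometry n B m C h \<and>
      (\<forall>a\<in>unit_cube n. \<forall>b\<in>unit_cube m. p a = q b \<longleftrightarrow> a \<in> B \<and> b = h a)"
      using meet[OF s(2) s'(2) s(3) s'(3)] ne unfolding s(1) s'(1) by blast
  qed
qed

text \<open>Inside a cube the cube distance is \<open>fin_dist\<close>, so by the triangle
  inequality no string is shorter than the straight segment.\<close>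

lemma cc_string_fin_dist:
  assumes "cc_string (infinite_cube A) h k l"
  shows "h \<in> cube_points A \<and> k \<in> cube_points A \<and> fin_dist h k \<le> l"
  using assms
proof induction
  case (start h)
  then show ?case
    by (simp add: cc_points_infinite_cube)
next
  case (step h p a l n b)
  then obtain s v where p: "p = face_map s n v" "inj_on s {..<n}" "v \<in> cube_points A"
    by (auto simp: infinite_cube_def)
  then have "p b \<in> cube_points A"
    using step.hyps face_map_in_cube_points by blast
  moreover have "fin_dist h (p b) \<le> fin_dist h (p a) + fin_dist (p a) (p b)"
    using Metric_space.triangle[OF Metric_space_fin_dist] step.IH calculation by blast
  moreover have "fin_dist (p a) (p b) = cube_dist n a b"
    using p cube_dist_eq_fin_dist by metis
  ultimately show ?case
    using step.IH by simp
qed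

lemma cc_string_direct:
  assumes "h \<in> cube_points A" "k \<in> cube_points A"
  shows "cc_string (infinite_cube A) h k (fin_dist h k)"
proof -
  obtain n p a b where c: "(n, p) \<in> infinite_cube A" "a \<in> unit_cube n" "b \<in> unit_cube n"
    "p a = h" "p b = k"
    using common_cube[OF assms] .
  then have "cube_dist n a b = fin_dist h k"
    by (auto simp: infinite_cube_def cube_dist_eq_fin_dist)
  then show ?thesis
    using cc_string.step[OF _ c(1,2,3), of h 0] cc_string.start[of h] assms c
    by (simp add: cc_points_infinite_cube)
qed

lemma cc_dist_infinite_cube:
  assumes "h \<in> cube_points A" "k \<in> cube_points A"
  shows "cc_dist (infinite_cube A) h k = fin_dist h k"
proof -
  have "Inf {l. cc_string (infinite_cube A) h k l} = fin_dist h k"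
    using cc_string_direct[OF assms] cc_string_fin_dist by (intro cInf_eq_minimum) auto
  then show ?thesis
    using cc_string_direct[OF assms] by (auto simp: cc_dist_def)
qed

lemma geodesic_path_cong:
  assumes "\<And>x y. x \<in> M \<Longrightarrow> y \<in> M \<Longrightarrow> d x y = d' x y"
  shows "geodesic_path M d x y l c \<longleftrightarrow> geodesic_path M d' x y l c"
  using assms by (auto simp: geodesic_path_def Pi_iff)

text \<open>\<open>Metric_space\<close> asks for symmetry and non-negativity on the whole type,
  while d and d' are compared only on M; hence the separate hypothesis \<open>met\<close>.\<close>

lemma CAT0_space_cong:
  assumes CAT: "CAT0_space M d" and eq: "\<And>x y. x \<in> M \<Longrightarrow> y \<in> M \<Longrightarrow> d' x y = d x y"
    and met: "Metric_space M d'"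
  shows "CAT0_space M d'"
proof -
  have geo: "geodesic_path M d' x y l c \<longleftrightarrow> geodesic_path M d x y l c" for x y l c
    by (rule geodesic_path_cong[OF eq])
  have "c ` {0..l} \<subseteq> M" if "geodesic_path M d x y l c" for x y l c
    using that by (auto simp: geodesic_path_def)
  then show ?thesis
    using CAT met unfolding CAT0_space_def geo
    by (simp add: eq subset_iff)
qed

lemma CAT0_cube_complex_infinite_cube: "CAT0_cube_complex (infinite_cube A)"
proof -
  have "Metric_space (cube_points A) (cc_dist (infinite_cube A))"
  proof -
    interpret M: Metric_space "cube_points A" fin_dist
      by (rule Metric_space_fin_dist)
    have nonneg: "0 \<le> cc_dist (infinite_cube A) h k" for h k
    proof (cases "\<exists>l. cc_string (infinite_cube A) h k l")
      case True
      then show ?thesis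
        using cc_string_fin_dist[of A h k] cc_dist_infinite_cube[of h A k] by fastforce
    qed (simp add: cc_dist_def)
    have comm: "cc_dist (infinite_cube A) h k = cc_dist (infinite_cube A) k h" for h k
    proof (cases "h \<in> cube_points A \<and> k \<in> cube_points A")
      case True
      then show ?thesis
        by (simp add: cc_dist_infinite_cube fin_dist_commute)
    next
      case False
      then have "\<not> cc_string (infinite_cube A) h k l" "\<not> cc_string (infinite_cube A) k h l" for l
        using cc_string_fin_dist by blast+
      then show ?thesis
        by (simp add: cc_dist_def)
    qed
    show ?thesis
      using nonneg comm M.triangle
      by unfold_locales (auto simp: cc_dist_infinite_cube)
  qed
  then have "CAT0_space (cube_points A) (cc_dist (infinite_cube A))"
    using CAT0_space_cong[OF CAT0_cube_points, of A "cc_dist (infinite_cube A)"]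
    by (simp add: cc_dist_infinite_cube)
  moreover have "indicat_real A \<in> cube_points A"
    by (simp add: cube_points_def indicator_def)
  ultimately show ?thesis
    using is_cubical_complex_infinite_cube[of A] cc_string_direct[of _ A]
    unfolding CAT0_cube_complex_def cc_points_infinite_cube by blast
qed


section \<open>Fixed points in the cube and free actions\<close>

definition fixfree :: "'i set \<Rightarrow> ('i \<Rightarrow> 'i) \<Rightarrow> bool" where
  "fixfree A f \<longleftrightarrow> \<not> (\<exists>h. finite {i. h i \<noteq> indicat_real A i} \<and> h \<circ> f = h)"

text \<open>A fixed h would be constant on Y, yet it is 1 at almost every point of Y in A and 0 at
  almost every other point of Y. In both applications Y is one orbit of the cyclic group generated
  by f.\<close>

lemma fixfreeI:
  assumes "infinite (Y \<inter> A)" "infinite (Y - A)"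
    and const: "\<And>h y z. (h :: _ \<Rightarrow> real) \<circ> f = h \<Longrightarrow> y \<in> Y \<Longrightarrow> z \<in> Y \<Longrightarrow> h y = h z"
  shows "fixfree A f"
  unfolding fixfree_def
proof
  assume "\<exists>h. finite {i. h i \<noteq> indicat_real A i} \<and> h \<circ> f = h"
  then obtain h where h: "finite {i. h i \<noteq> indicat_real A i}" "h \<circ> f = h"
    by blast
  obtain y where y: "y \<in> Y \<inter> A" "y \<notin> {i. h i \<noteq> indicat_real A i}"
    using assms(1) h(1) by (meson finite_subset subsetI)
  obtain z where z: "z \<in> Y - A" "z \<notin> {i. h i \<noteq> indicat_real A i}"
    using assms(2) h(1) by (meson finite_subset subsetI)
  have "h y = h z"
    using const[OF h(2)] y z by blast
  then show False
    using y z by simp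
qed

text \<open>If h is fixed by the conjugate, then h composed with b is fixed by f, and it still
  differs from the indicator in finitely many places because b moves only finitely many points into
  or out of A.\<close>

lemma fixfree_conj:
  assumes f: "fixfree A f" and b: "b \<in> carrier (commensurator A)"
  shows "fixfree A (b \<circ> f \<circ> inv_into UNIV b)"
  unfolding fixfree_def
proof
  assume "\<exists>h. finite {i. h i \<noteq> indicat_real A i} \<and> h \<circ> (b \<circ> f \<circ> inv_into UNIV b) = h"
  then obtain h where h: "finite {i. h i \<noteq> indicat_real A i}"
    "h \<circ> (b \<circ> f \<circ> inv_into UNIV b) = h"
    by blast
  have inj: "inj b"
    using b by (simp add: bij_is_inj)
  have "(h \<circ> b) \<circ> f = (h \<circ> (b \<circ> f \<circ> inv_into UNIV b)) \<circ> b"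
    using inj by (simp add: comp_assoc)
  then have "(h \<circ> b) \<circ> f = h \<circ> b"
    by (simp only: h)
  moreover have "finite {i. (h \<circ> b) i \<noteq> indicat_real A i}"
  proof (rule finite_subset)
    show "{i. (h \<circ> b) i \<noteq> indicat_real A i}
        \<subseteq> b -` {i. h i \<noteq> indicat_real A i} \<union> {i. (b i \<in> A) \<noteq> (i \<in> A)}"
      by (auto simp: indicator_def)
    show "finite (b -` {i. h i \<noteq> indicat_real A i} \<union> {i. (b i \<in> A) \<noteq> (i \<in> A)})"
      using b finite_vimageI[OF h(1) inj] by simp
  qed
  ultimately show False
    using f unfolding fixfree_def by blast
qed

lemma commensurator_preserves_cube_points:
  assumes f: "f \<in> carrier (commensurator A)" and h: "h \<in> cube_points A"
  shows "h \<circ> f \<in> cube_points A"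
proof -
  have "{i. (h \<circ> f) i \<noteq> indicat_real A i}
      \<subseteq> f -` {i. h i \<noteq> indicat_real A i} \<union> {i. (f i \<in> A) \<noteq> (i \<in> A)}"
    by (auto simp: indicator_def)
  moreover have "finite (f -` {i. h i \<noteq> indicat_real A i} \<union> {i. (f i \<in> A) \<noteq> (i \<in> A)})"
    using f h finite_vimageI[OF _ bij_is_inj, of "{i. h i \<noteq> indicat_real A i}" f]
    by (simp add: cube_points_def)
  ultimately have "finite {i. (h \<circ> f) i \<noteq> indicat_real A i}"
    by (rule finite_subset)
  then show ?thesis
    using h by (simp add: cube_points_def)
qed

lemma face_map_comp:
  assumes f: "bij f" and s: "inj_on s {..<n}"
  shows "face_map s n v a \<circ> inv_into UNIV f = face_map (f \<circ> s) n (v \<circ> inv_into UNIV f) a"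
proof
  fix i
  have inj: "inj_on (f \<circ> s) {..<n}"
    using s by (rule comp_inj_on) (rule inj_on_subset[OF bij_is_inj[OF f] subset_UNIV])
  show "(face_map s n v a \<circ> inv_into UNIV f) i = face_map (f \<circ> s) n (v \<circ> inv_into UNIV f) a i"
  proof (cases "i \<in> (f \<circ> s) ` {..<n}")
    case True
    then obtain j where j: "j < n" "i = (f \<circ> s) j"
      by auto
    then have "inv_into UNIV f i = s j"
      using inv_f_f[OF bij_is_inj[OF f]] by simp
    then show ?thesis
      unfolding j(2) face_map_image[OF inj j(1)] using s j by (simp add: face_map_image)
  next
    case False
    moreover have "f (inv_into UNIV f i) = i"
      by (rule surj_f_inv_f[OF bij_is_surj[OF f]])
    ultimately have "inv_into UNIV f i \<notin> s ` {..<n}"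
      by force
    then show ?thesis
      using False by (simp add: face_map_off)
  qed
qed

text \<open>The index type is \<open>'g set\<close> because
  \<open>acts_freely_on_CAT0_cube_complex\<close> prescribes the point type
  \<open>'g set \<Rightarrow> real\<close>; the next lemma admits other index types. Stabilizers are
  trivial at all points and not only at vertices, since \<open>fixfree\<close> excludes all
  real-valued fixed functions near the indicator.\<close>

lemma acts_freely_on_CAT0_cube_complexI:
  fixes G :: "'g monoid" and A :: "'g set set"
  assumes G: "group G" and hom: "\<rho> \<in> hom G (commensurator A)"
    and free: "\<And>g. g \<in> carrier G \<Longrightarrow> g \<noteq> \<one>\<^bsub>G\<^esub> \<Longrightarrow> fixfree A (\<rho> g)"
  shows "acts_freely_on_CAT0_cube_complex G"
proof -
  interpret G: group G by fact
  interpret K: group "commensurator A" by (rule group_commensurator)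
  interpret \<rho>: group_hom G "commensurator A" \<rho>
    using hom G group_commensurator by (simp add: group_hom_def group_hom_axioms_def)
  define X where "X = cube_points A"
  define \<phi> where "\<phi> = (\<lambda>g. \<lambda>h\<in>X. h \<circ> \<rho> (inv\<^bsub>G\<^esub> g))"
  have \<rho>: "\<rho> g \<in> carrier (commensurator A)" if "g \<in> carrier G" for g
    using that by (rule \<rho>.hom_closed)
  have X: "h \<circ> \<rho> g \<in> X" if "h \<in> X" "g \<in> carrier G" for h g
    using commensurator_preserves_cube_points[OF \<rho>] that by (simp add: X_def)
  have mult: "\<rho> (g \<otimes>\<^bsub>G\<^esub> g') = \<rho> g \<circ> \<rho> g'" if "g \<in> carrier G" "g' \<in> carrier G" for g g'
    using \<rho>.hom_mult[OF that] by simp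
  have comp: "\<phi> (g \<otimes>\<^bsub>G\<^esub> g') h = \<phi> g (\<phi> g' h)"
    if "g \<in> carrier G" "g' \<in> carrier G" "h \<in> X" for g g' h
  proof -
    have "\<rho> (inv\<^bsub>G\<^esub> (g \<otimes>\<^bsub>G\<^esub> g')) = \<rho> (inv\<^bsub>G\<^esub> g') \<circ> \<rho> (inv\<^bsub>G\<^esub> g)"
      using that mult[of "inv\<^bsub>G\<^esub> g'" "inv\<^bsub>G\<^esub> g"] by (simp add: G.inv_mult_group)
    then show ?thesis
      using that X[of h "inv\<^bsub>G\<^esub> g'"] by (simp add: \<phi>_def comp_assoc)
  qed
  have one: "\<phi> \<one>\<^bsub>G\<^esub> h = h" if "h \<in> X" for h
    using that \<rho>.hom_one by (simp add: \<phi>_def)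
  have closed: "\<phi> g h \<in> X" if "g \<in> carrier G" "h \<in> X" for g h
    using that X by (simp add: \<phi>_def del: \<rho>.hom_inv)
  have inv: "\<phi> (inv\<^bsub>G\<^esub> g) (\<phi> g h) = h" "\<phi> g (\<phi> (inv\<^bsub>G\<^esub> g) h) = h"
    if "g \<in> carrier G" "h \<in> X" for g h
    using that comp[of "inv\<^bsub>G\<^esub> g" g h] comp[of g "inv\<^bsub>G\<^esub> g" h] one by simp_all
  have bij: "\<phi> g \<in> Bij X" if g: "g \<in> carrier G" for g
  proof -
    have "bij_betw (\<phi> g) X X"
      by (rule bij_betw_byWitness[where f' = "\<phi> (inv\<^bsub>G\<^esub> g)"]) (use g inv closed in auto)
    then show ?thesis
      by (simp add: Bij_def \<phi>_def)
  qed
  have "\<phi> \<in> hom G (BijGroup X)"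
  proof (rule homI)
    fix g g' assume g: "g \<in> carrier G" "g' \<in> carrier G"
    show "\<phi> (g \<otimes>\<^bsub>G\<^esub> g') = \<phi> g \<otimes>\<^bsub>BijGroup X\<^esub> \<phi> g'"
    proof
      fix h show "\<phi> (g \<otimes>\<^bsub>G\<^esub> g') h = (\<phi> g \<otimes>\<^bsub>BijGroup X\<^esub> \<phi> g') h"
        using g bij comp by (cases "h \<in> X") (auto simp: BijGroup_def compose_def \<phi>_def)
    qed
  qed (simp add: BijGroup_def bij)
  then have act: "group_action G X \<phi>"
    using G group_BijGroup by (auto simp: group_action_def group_hom_def group_hom_axioms_def)
  have "cubical_action G (infinite_cube A) \<phi>"
    unfolding cubical_action_def cc_points_infinite_cube X_def[symmetric]
  proof (intro conjI ballI act; clarify)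
    fix g n p assume g: "g \<in> carrier G" and "(n, p) \<in> infinite_cube A"
    then obtain s v where p: "p = face_map s n v" "inj_on s {..<n}" "v \<in> X" "\<forall>i. v i \<in> {0, 1}"
      by (auto simp: infinite_cube_def X_def)
    have b: "bij (\<rho> g)"
      using \<rho>[OF g] by simp
    have inv_eq: "\<rho> (inv\<^bsub>G\<^esub> g) = inv_into UNIV (\<rho> g)"
      using \<rho>.hom_inv[OF g] inv_commensurator[OF \<rho>[OF g]] by simp
    let ?q = "face_map (\<rho> g \<circ> s) n (v \<circ> \<rho> (inv\<^bsub>G\<^esub> g))"
    have "inj_on (\<rho> g \<circ> s) {..<n}"
      using p(2) by (rule comp_inj_on) (rule inj_on_subset[OF bij_is_inj[OF b] subset_UNIV])
    then have "(n, ?q) \<in> infinite_cube A"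
      using X[OF p(3), of "inv\<^bsub>G\<^esub> g"] g p(4) unfolding infinite_cube_def X_def by fastforce
    moreover have "\<phi> g (p a) = ?q a" if "a \<in> unit_cube n" for a
      using that p face_map_in_cube_points[of s n v A a] face_map_comp[OF b p(2), of v a]
      by (simp add: \<phi>_def X_def inv_eq del: \<rho>.hom_inv)
    moreover have "cube_isometry n (unit_cube n) n (unit_cube n) id"
      by (simp add: cube_isometry_def)
    ultimately show "\<exists>q h. (n, q) \<in> infinite_cube A \<and>
        cube_isometry n (unit_cube n) n (unit_cube n) h \<and> (\<forall>a\<in>unit_cube n. \<phi> g (p a) = q (h a))"
      by (metis id_apply)
  qed
  moreover have "free_action G X \<phi>"
    unfolding free_action_def
  proof
    fix h assume h: "h \<in> X"
    have "g = \<one>\<^bsub>G\<^esub>" if g: "g \<in> carrier G" "\<phi> g h = h" for g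
    proof (rule ccontr)
      assume "g \<noteq> \<one>\<^bsub>G\<^esub>"
      then have "inv\<^bsub>G\<^esub> g \<noteq> \<one>\<^bsub>G\<^esub>"
        using g by simp
      then have "fixfree A (\<rho> (inv\<^bsub>G\<^esub> g))"
        using free[of "inv\<^bsub>G\<^esub> g"] g by (simp del: \<rho>.hom_inv)
      moreover have "h \<circ> \<rho> (inv\<^bsub>G\<^esub> g) = h"
        using g h by (simp add: \<phi>_def del: \<rho>.hom_inv)
      ultimately show False
        using h unfolding fixfree_def X_def cube_points_def by blast
    qed
    then show "stabilizer G \<phi> h = {\<one>\<^bsub>G\<^esub>}"
      using one[OF h] by (auto simp: stabilizer_def)
  qed
  ultimately show ?thesis
    unfolding acts_freely_on_CAT0_cube_complex_def
    using CAT0_cube_complex_infinite_cube[of A] cc_points_infinite_cube[of A]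
    by (intro exI[of _ "infinite_cube A"] exI[of _ \<phi>]) (simp add: X_def)
qed

text \<open>The permutations are extended by the identity outside the range of \<iota>, where no
  point belongs to the new set; a fixed function of the extension restricts along \<iota> to a fixed
  function of the original.\<close>

lemma acts_freely_on_CAT0_cube_complex_transport:
  fixes G :: "'g monoid" and \<iota> :: "'w \<Rightarrow> 'g set" and A :: "'w set"
  assumes G: "group G" and inj: "inj \<iota>" and hom: "\<rho> \<in> hom G (commensurator A)"
    and free: "\<And>g. g \<in> carrier G \<Longrightarrow> g \<noteq> \<one>\<^bsub>G\<^esub> \<Longrightarrow> fixfree A (\<rho> g)"
  shows "acts_freely_on_CAT0_cube_complex G"
proof -
  interpret G: group G by fact
  define \<tau> where "\<tau> = (\<lambda>f i. if i \<in> range \<iota> then \<iota> (f (inv_into UNIV \<iota> i)) else i)"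
  have \<tau>: "\<tau> f (\<iota> w) = \<iota> (f w)" for f w
    using inj by (simp add: \<tau>_def)
  have off: "\<tau> f i = i" if "i \<notin> range \<iota>" for f i
    using that by (simp add: \<tau>_def)
  have comp: "\<tau> (f \<circ> g) = \<tau> f \<circ> \<tau> g" for f g
  proof
    fix i show "\<tau> (f \<circ> g) i = (\<tau> f \<circ> \<tau> g) i"
      by (cases "i \<in> range \<iota>") (auto simp: \<tau> off)
  qed
  have id: "\<tau> id = id"
  proof
    fix i show "\<tau> id i = id i"
      by (cases "i \<in> range \<iota>") (auto simp: \<tau> off)
  qed
  have closed: "\<tau> f \<in> carrier (commensurator (\<iota> ` A))" if "f \<in> carrier (commensurator A)" for f
  proof -
    have f: "bij f" "finite {i. (f i \<in> A) \<noteq> (i \<in> A)}"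
      using that by simp_all
    have "\<tau> f \<circ> \<tau> (inv_into UNIV f) = id" "\<tau> (inv_into UNIV f) \<circ> \<tau> f = id"
      using bij_is_inj[OF f(1)] bij_is_surj[OF f(1)] unfolding inj_iff surj_iff
      by (simp_all add: comp[symmetric] id)
    then have "bij (\<tau> f)"
      by (metis o_bij)
    moreover have "{i. (\<tau> f i \<in> \<iota> ` A) \<noteq> (i \<in> \<iota> ` A)} \<subseteq> \<iota> ` {i. (f i \<in> A) \<noteq> (i \<in> A)}"
    proof
      fix i assume i: "i \<in> {i. (\<tau> f i \<in> \<iota> ` A) \<noteq> (i \<in> \<iota> ` A)}"
      then obtain w where w: "i = \<iota> w"
        using off[of i] by (cases "i \<in> range \<iota>") auto
      then show "i \<in> \<iota> ` {i. (f i \<in> A) \<noteq> (i \<in> A)}"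
        using i inj by (auto simp: \<tau> inj_image_mem_iff)
    qed
    ultimately show ?thesis
      using f(2) by (simp add: finite_surj)
  qed
  have "(\<lambda>g. \<tau> (\<rho> g)) \<in> hom G (commensurator (\<iota> ` A))"
  proof (rule homI)
    fix g assume "g \<in> carrier G"
    then show "\<tau> (\<rho> g) \<in> carrier (commensurator (\<iota> ` A))"
      using hom by (intro closed) (auto simp: hom_def)
  next
    fix g h assume "g \<in> carrier G" "h \<in> carrier G"
    then show "\<tau> (\<rho> (g \<otimes>\<^bsub>G\<^esub> h)) = \<tau> (\<rho> g) \<otimes>\<^bsub>commensurator (\<iota> ` A)\<^esub> \<tau> (\<rho> h)"
      using hom by (simp add: hom_def comp)
  qed
  moreover have "fixfree (\<iota> ` A) (\<tau> (\<rho> g))" if "g \<in> carrier G" "g \<noteq> \<one>\<^bsub>G\<^esub>" for g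
    unfolding fixfree_def
  proof
    assume "\<exists>h. finite {i. h i \<noteq> indicat_real (\<iota> ` A) i} \<and> h \<circ> \<tau> (\<rho> g) = h"
    then obtain h where h: "finite {i. h i \<noteq> indicat_real (\<iota> ` A) i}" "h \<circ> \<tau> (\<rho> g) = h"
      by blast
    have "(h \<circ> \<iota>) \<circ> \<rho> g = h \<circ> \<iota>"
    proof
      fix w show "((h \<circ> \<iota>) \<circ> \<rho> g) w = (h \<circ> \<iota>) w"
        using fun_cong[OF h(2), of "\<iota> w"] by (simp add: \<tau>)
    qed
    moreover have "{w. (h \<circ> \<iota>) w \<noteq> indicat_real A w} = \<iota> -` {i. h i \<noteq> indicat_real (\<iota> ` A) i}"
      using inj by (auto simp: indicator_def inj_image_mem_iff)
    then have "finite {w. (h \<circ> \<iota>) w \<noteq> indicat_real A w}"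
      using finite_vimageI[OF h(1) inj] by simp
    ultimately show False
      using free[OF that] unfolding fixfree_def by blast
  qed
  ultimately show ?thesis
    by (rule acts_freely_on_CAT0_cube_complexI[OF G])
qed

lemma hom_map_sum:
  assumes \<rho>: "\<rho> \<in> hom G (commensurator A)" and \<rho>': "\<rho>' \<in> hom G (commensurator A')"
  shows "(\<lambda>g. map_sum (\<rho> g) (\<rho>' g)) \<in> hom G (commensurator (A <+> A'))"
proof (rule homI)
  fix g assume g: "g \<in> carrier G"
  let ?f = "\<rho> g" and ?f' = "\<rho>' g"
  have f: "?f \<in> carrier (commensurator A)" "?f' \<in> carrier (commensurator A')"
    using \<rho> \<rho>' g by (auto simp: hom_def Pi_iff)
  have "bij ?f" "bij ?f'"
    using f by simp_all
  then have "inv_into UNIV ?f \<circ> ?f = id" "?f \<circ> inv_into UNIV ?f = id"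
    "inv_into UNIV ?f' \<circ> ?f' = id" "?f' \<circ> inv_into UNIV ?f' = id"
    by (metis bij_is_inj bij_is_surj inj_iff surj_iff)+
  then have "bij (map_sum ?f ?f')"
    by (intro o_bij[of "map_sum (inv_into UNIV ?f) (inv_into UNIV ?f')"])
      (simp_all add: map_sum.comp map_sum.id)
  moreover have "{i. (map_sum ?f ?f' i \<in> A <+> A') \<noteq> (i \<in> A <+> A')}
      \<subseteq> Inl ` {i. (?f i \<in> A) \<noteq> (i \<in> A)} \<union> Inr ` {i. (?f' i \<in> A') \<noteq> (i \<in> A')}"
  proof
    fix i assume "i \<in> {i. (map_sum ?f ?f' i \<in> A <+> A') \<noteq> (i \<in> A <+> A')}"
    then show "i \<in> Inl ` {i. (?f i \<in> A) \<noteq> (i \<in> A)} \<union> Inr ` {i. (?f' i \<in> A') \<noteq> (i \<in> A')}"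
      by (cases i) auto
  qed
  then have "finite {i. (map_sum ?f ?f' i \<in> A <+> A') \<noteq> (i \<in> A <+> A')}"
    by (rule finite_subset) (use f in simp)
  ultimately show "map_sum ?f ?f' \<in> carrier (commensurator (A <+> A'))"
    by simp
next
  fix g h assume "g \<in> carrier G" "h \<in> carrier G"
  then show "map_sum (\<rho> (g \<otimes>\<^bsub>G\<^esub> h)) (\<rho>' (g \<otimes>\<^bsub>G\<^esub> h))
      = map_sum (\<rho> g) (\<rho>' g) \<otimes>\<^bsub>commensurator (A <+> A')\<^esub> map_sum (\<rho> h) (\<rho>' h)"
    using \<rho> \<rho>' by (simp add: hom_def map_sum.comp)
qed

text \<open>Fixed functions on a disjoint union restrict to fixed functions on both summands, so
  each group element has to be fixed-point free on only one of them. This lets the tree and the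
  walls share the work.\<close>

lemma fixfree_map_sum:
  assumes "fixfree A f \<or> fixfree A' f'"
  shows "fixfree (A <+> A') (map_sum f f')"
  unfolding fixfree_def
proof
  assume "\<exists>h. finite {i. h i \<noteq> indicat_real (A <+> A') i} \<and> h \<circ> map_sum f f' = h"
  then obtain h where h: "finite {i. h i \<noteq> indicat_real (A <+> A') i}" "h \<circ> map_sum f f' = h"
    by blast
  have "(h \<circ> Inl) \<circ> f = h \<circ> Inl" "(h \<circ> Inr) \<circ> f' = h \<circ> Inr"
    using fun_cong[OF h(2)] by (auto simp: fun_eq_iff) (metis map_sum.simps)+
  moreover have "{w. (h \<circ> Inl) w \<noteq> indicat_real A w} = Inl -` {i. h i \<noteq> indicat_real (A <+> A') i}"
    "{w. (h \<circ> Inr) w \<noteq> indicat_real A' w} = Inr -` {i. h i \<noteq> indicat_real (A <+> A') i}"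
    by (auto simp: indicator_def)
  then have "finite {w. (h \<circ> Inl) w \<noteq> indicat_real A w}"
    "finite {w. (h \<circ> Inr) w \<noteq> indicat_real A' w}"
    using finite_vimageI[OF h(1) inj_Inl] finite_vimageI[OF h(1) inj_Inr] by simp_all
  ultimately show False
    using assms unfolding fixfree_def by blast
qed

section \<open>Homomorphisms from presented groups\<close>

fun eval_word :: "('g, 'm) monoid_scheme \<Rightarrow> ('x \<Rightarrow> 'g) \<Rightarrow> 'x word \<Rightarrow> 'g" where
  "eval_word K f [] = \<one>\<^bsub>K\<^esub>"
| "eval_word K f (y # w) = (if snd y then f (fst y) else inv\<^bsub>K\<^esub> f (fst y)) \<otimes>\<^bsub>K\<^esub> eval_word K f w"

context group
begin

lemma eval_word_closed: "f \<in> X \<rightarrow> carrier G \<Longrightarrow> w \<in> words X \<Longrightarrow> eval_word G f w \<in> carrier G"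
  by (induction w) (auto simp: Pi_iff)

lemma eval_word_append:
  "f \<in> X \<rightarrow> carrier G \<Longrightarrow> u \<in> words X \<Longrightarrow> v \<in> words X
    \<Longrightarrow> eval_word G f (u @ v) = eval_word G f u \<otimes> eval_word G f v"
  by (induction u) (auto simp: Pi_iff m_assoc eval_word_closed)

lemma eval_word_eq:
  assumes f: "f \<in> X \<rightarrow> carrier G"
    and R: "\<And>r. r \<in> R \<Longrightarrow> r \<in> words X \<Longrightarrow> eval_word G f r = \<one>"
    and eq: "word_eq X R u v"
  shows "eval_word G f u = eval_word G f v"
  using eq
proof induction
  case (cancel u v x b)
  have "f x \<in> carrier G"
    using f cancel by auto
  then have "eval_word G f [(x, b), (x, \<not> b)] = \<one>"
    by auto
  then show ?case
    using f cancel eval_word_append[of f X "[(x, b), (x, \<not> b)]" v] eval_word_closed[of f X v]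
    by (simp add: eval_word_append del: append_Cons eval_word.simps)
next
  case (relator u v r)
  then show ?case
    using f R eval_word_closed[of f X v] by (simp add: eval_word_append)
qed simp_all

lemma presented_group_hom:
  assumes f: "f \<in> X \<rightarrow> carrier G"
    and R: "\<And>r. r \<in> R \<Longrightarrow> r \<in> words X \<Longrightarrow> eval_word G f r = \<one>"
  shows "\<exists>\<rho>\<in>hom (presented_group X R) G. \<forall>w\<in>words X. \<rho> (word_class X R w) = eval_word G f w"
proof -
  define \<rho> where "\<rho> = (\<lambda>C. eval_word G f (SOME w. w \<in> words X \<and> C = word_class X R w))"
  have \<rho>: "\<rho> (word_class X R w) = eval_word G f w" if w: "w \<in> words X" for w
  proof -
    define u where "u = (SOME u. u \<in> words X \<and> word_class X R w = word_class X R u)"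
    have "u \<in> words X \<and> word_class X R w = word_class X R u"
      unfolding u_def by (rule someI[of _ w]) (use w in simp)
    then have "word_eq X R w u"
      using word_class_eq_iff[OF w] by blast
    then show ?thesis
      using eval_word_eq[OF f R] unfolding \<rho>_def u_def by simp
  qed
  moreover have "\<rho> \<in> hom (presented_group X R) G"
    using f by (intro homI)
      (auto simp: carrier_presented_group mult_presented_group \<rho> eval_word_closed eval_word_append)
  ultimately show ?thesis
    by blast
qed

end

section \<open>Centralizers in free groups\<close>

definition flip_letter :: "'x \<times> bool \<Rightarrow> 'x \<times> bool" where
  "flip_letter y = (fst y, \<not> snd y)"

text \<open>Left multiplication by a letter on reduced words. These maps satisfy the relations of
  the free group (van der Waerden's argument), so equal elements act equally, by
  \<open>act_word_cong\<close>; applied to the empty word they produce the reduced form.\<close>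

definition push :: "'x \<times> bool \<Rightarrow> 'x word \<Rightarrow> 'x word" where
  "push y p = (if p \<noteq> [] \<and> hd p = flip_letter y then tl p else y # p)"

abbreviation reduced :: "'x word \<Rightarrow> bool" where
  "reduced \<equiv> successively (\<lambda>y z. z \<noteq> flip_letter y)"

abbreviation act_word :: "'x word \<Rightarrow> 'x word \<Rightarrow> 'x word" where
  "act_word w p \<equiv> foldr push w p"

lemma flip_letter_simps [simp]:
  "flip_letter (flip_letter y) = y" "fst (flip_letter y) = fst y" "flip_letter y \<noteq> y"
  "y \<noteq> flip_letter y"
  by (simp_all add: flip_letter_def prod_eq_iff)

lemma reduced_push: "reduced p \<Longrightarrow> reduced (push y p)"
  by (cases p) (auto simp: push_def successively_Cons)

lemma reduced_act_word: "reduced p \<Longrightarrow> reduced (act_word w p)"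
  by (induction w) (auto intro: reduced_push)

lemma push_push_flip: "reduced p \<Longrightarrow> push y (push (flip_letter y) p) = p"
  by (cases p) (auto simp: push_def successively_Cons)

lemma act_word_cong:
  assumes "word_eq X {} u v" "reduced p"
  shows "act_word u p = act_word v p"
  using assms
proof (induction arbitrary: p)
  case (cancel u v x b)
  then show ?case
    using push_push_flip[OF reduced_act_word[of p v], of "(x, b)"] by (simp add: flip_letter_def)
qed simp_all

lemma act_word_reduced: "reduced (p @ q) \<Longrightarrow> act_word p q = p @ q"
  by (induction p) (auto simp: successively_Cons push_def)

lemma word_eq_push:
  assumes "fst y \<in> X" "p \<in> words X"
  shows "word_eq X R (y # p) (push y p)" "push y p \<in> words X"
proof -
  obtain x b where y: "y = (x, b)"
    by force
  show "word_eq X R (y # p) (push y p)"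
  proof (cases "p \<noteq> [] \<and> hd p = flip_letter y")
    case True
    then obtain q where "p = (x, \<not> b) # q"
      by (cases p) (auto simp: flip_letter_def y)
    then show ?thesis
      using assms word_eq.cancel[of "[]" X q x R b] by (simp add: push_def flip_letter_def y)
  next
    case False
    then show ?thesis
      using assms by (auto simp: push_def intro: word_eq.refl)
  qed
  then show "push y p \<in> words X"
    using word_eq_words by blast
qed

lemma word_eq_act_word:
  assumes "w \<in> words X" "p \<in> words X"
  shows "word_eq X R (w @ p) (act_word w p)"
  using assms
proof (induction w)
  case (Cons y w)
  then have "word_eq X R (y # w @ p) (y # act_word w p)"
    using word_eq_append_left[of X R "w @ p" "act_word w p" "[y]"] by simp
  moreover have "act_word w p \<in> words X"
    using Cons word_eq_words by fastforce
  then have "word_eq X R (y # act_word w p) (push y (act_word w p))"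
    using Cons.prems by (intro word_eq_push) auto
  ultimately show ?case
    by (auto intro: word_eq.trans)
qed (simp add: word_eq.refl)

text \<open>The number j counts the letters cancelled on each side where u meets q.\<close>

lemma act_word_overlap:
  assumes "reduced u" "reduced q"
  shows "\<exists>j. j \<le> length u \<and> j \<le> length q \<and> act_word u q = take (length u - j) u @ drop j q"
  using assms(1)
proof (induction u)
  case (Cons y u)
  then obtain j where j: "j \<le> length u" "j \<le> length q"
      "act_word u q = take (length u - j) u @ drop j q"
    by (auto simp: successively_Cons)
  show ?case
  \<comment> \<open>While a letter of u survives, y meets its neighbour in a reduced word and cannot
    cancel; only after u has been used up can y reach q.\<close>
  proof (cases "length u = j")
    case False
    then have "take (length u - j) u \<noteq> []" "hd (take (length u - j) u) = hd u" "u \<noteq> []"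
      using j by (auto simp: hd_take)
    moreover from this have "hd u \<noteq> flip_letter y"
      using Cons.prems by (simp add: successively_Cons)
    ultimately have "act_word (y # u) q = y # take (length u - j) u @ drop j q"
      using j by (simp add: push_def)
    moreover have "length (y # u) - j = Suc (length u - j)"
      using False j by simp
    ultimately show ?thesis
      using j by (intro exI[of _ j]) simp
  next
    case True
    then have eq: "act_word u q = drop j q"
      using j by simp
    show ?thesis
    proof (cases "drop j q \<noteq> [] \<and> hd (drop j q) = flip_letter y")
      case strip: True
      then have "act_word (y # u) q = drop (Suc j) q" "Suc j \<le> length q"
        using eq by (auto simp: push_def drop_Suc tl_drop)
      then show ?thesis
        using True by (intro exI[of _ "Suc j"]) simp
    next
      case False
      then have "act_word (y # u) q = y # drop j q"
        using eq by (auto simp: push_def)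
      then show ?thesis
        using True j by (intro exI[of _ j]) simp
    qed
  qed
qed simp

section \<open>Periodic words and the elements commuting with a cyclically reduced word\<close>

definition cyclic_prefix :: "'a list \<Rightarrow> nat \<Rightarrow> 'a list" where
  "cyclic_prefix x n = map (\<lambda>i. x ! (i mod length x)) [0..<n]"

lemma length_cyclic_prefix [simp]: "length (cyclic_prefix x n) = n"
  by (simp add: cyclic_prefix_def)

lemma nth_cyclic_prefix [simp]: "i < n \<Longrightarrow> cyclic_prefix x n ! i = x ! (i mod length x)"
  by (simp add: cyclic_prefix_def)

lemma cyclic_prefix_in_words:
  assumes "x \<in> words X" "x \<noteq> []"
  shows "cyclic_prefix x n \<in> words X"
proof -
  have "x ! (i mod length x) \<in> set x" for i
    using assms(2) by simp
  then have "set (cyclic_prefix x n) \<subseteq> set x"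
    by (auto simp: cyclic_prefix_def)
  then show ?thesis
    using assms(1) by (auto simp: words_def lists_eq_set)
qed

lemma reduced_cyclic_prefix:
  assumes "x \<noteq> []" "reduced (x @ x)"
  shows "reduced (cyclic_prefix x n)"
proof -
  have "x ! (Suc i mod length x) \<noteq> flip_letter (x ! (i mod length x))" for i
  proof -
    let ?j = "i mod length x"
    have j: "?j < length x"
      using assms by simp
    have "(x @ x) ! Suc ?j \<noteq> flip_letter ((x @ x) ! ?j)"
      using successively_nth[OF assms(2), of ?j] j by simp
    moreover have "(x @ x) ! ?j = x ! ?j"
      using j by (simp add: nth_append)
    moreover have "(x @ x) ! Suc ?j = x ! (Suc i mod length x)"
      using j by (auto simp: nth_append mod_Suc)
    ultimately show ?thesis
      by simp
  qed
  then show ?thesis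
    by (simp add: successively_conv_nth)
qed

lemma cyclic_prefix_Suc_mult:
  assumes "x \<noteq> []"
  shows "cyclic_prefix x (Suc m * length x) = x @ cyclic_prefix x (m * length x)"
proof (rule nth_equalityI)
  fix i assume "i < length (cyclic_prefix x (Suc m * length x))"
  then show "cyclic_prefix x (Suc m * length x) ! i = (x @ cyclic_prefix x (m * length x)) ! i"
    using le_mod_geq[of "length x" i] by (simp add: nth_append)
qed simp

lemma concat_replicate_eq_cyclic_prefix:
  "x \<noteq> [] \<Longrightarrow> concat (replicate m x) = cyclic_prefix x (m * length x)"
  by (induction m) (simp_all add: cyclic_prefix_Suc_mult del: mult_Suc, simp add: cyclic_prefix_def)

text \<open>A word disturbs only a bounded initial piece of a long periodic word: it replaces the
  first m letters by c, with c and m independent of the length l.\<close>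

lemma act_word_on_cyclic_prefix:
  "\<exists>c m l0. \<forall>l\<ge>l0. act_word f (cyclic_prefix x l)
     = c @ map (\<lambda>i. x ! (i mod length x)) [m..<l]"
proof (induction f)
  case Nil
  show ?case
    by (intro exI[of _ "[]"] exI[of _ 0]) (simp add: cyclic_prefix_def)
next
  case (Cons y f)
  then obtain c m l0 where IH: "\<And>l. l \<ge> l0 \<Longrightarrow> act_word f (cyclic_prefix x l)
     = c @ map (\<lambda>i. x ! (i mod length x)) [m..<l]"
    by blast
  show ?case
  proof (cases c)
    case (Cons z d)
    then have "act_word (y # f) (cyclic_prefix x l)
        = (if z = flip_letter y then d else y # c) @ map (\<lambda>i. x ! (i mod length x)) [m..<l]"
      if "l \<ge> l0" for l
      using IH[OF that] by (simp add: push_def)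
    then show ?thesis
      by blast
  next
    case Nil
    \<comment> \<open>With c empty, y meets letter m of the periodic word, which is present only for
      l > m.\<close>
    have "act_word (y # f) (cyclic_prefix x l)
        = (if x ! (m mod length x) = flip_letter y then [] else [y])
          @ map (\<lambda>i. x ! (i mod length x))
              [(if x ! (m mod length x) = flip_letter y then Suc m else m)..<l]"
      if "l \<ge> max l0 (Suc m)" for l
      using IH[of l] that Nil by (simp add: push_def upt_conv_Cons)
    then show ?thesis
      by blast
  qed
qed

text \<open>An element commuting with the cyclically reduced \<open>x\<close> fixes the end \<open>x x x \<dots>\<close> of the Cayley
  tree, so on long prefixes of this infinite word it acts as a shift by some \<open>k\<close>.\<close>

lemma commuting_word_shifts:
  assumes x: "x \<in> words X" "x \<noteq> []" "reduced (x @ x)"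
    and f: "f \<in> words X" "word_eq X {} (f @ x) (x @ f)"
  shows "\<exists>k l0. \<forall>l\<ge>l0. 0 \<le> int l + k \<and>
    act_word f (cyclic_prefix x l) = cyclic_prefix x (nat (int l + k))"
proof -
  let ?n = "length x" and ?\<omega> = "\<lambda>i. x ! (i mod length x)"
  obtain c m l0 where c: "\<And>l. l \<ge> l0 \<Longrightarrow> act_word f (cyclic_prefix x l) = c @ map ?\<omega> [m..<l]"
    using act_word_on_cyclic_prefix by blast
  define q where "q = act_word f []"
  have n: "?n > 0"
    using x by simp
  then have le: "m \<le> m * ?n" for m
    by (cases ?n) simp_all
  have pow: "cyclic_prefix x (M * ?n) \<in> words X \<and>
      word_eq X {} (f @ cyclic_prefix x (M * ?n)) (cyclic_prefix x (M * ?n) @ f)" for M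
  proof (induction M)
    case (Suc M)
    let ?p = "cyclic_prefix x (M * ?n)"
    have "word_eq X {} (f @ x @ ?p) (x @ f @ ?p)"
      using word_eq_append_right[OF f(2), of ?p] Suc by simp
    moreover have "word_eq X {} (x @ f @ ?p) (x @ ?p @ f)"
      using word_eq_append_left[of X "{}" "f @ ?p" "?p @ f" x] Suc x by simp
    ultimately have "word_eq X {} (f @ x @ ?p) (x @ ?p @ f)"
      by (rule word_eq.trans)
    then show ?case
      using x Suc by (simp add: cyclic_prefix_Suc_mult del: mult_Suc)
  qed (use f in \<open>simp add: cyclic_prefix_def word_eq.refl\<close>)
  have red: "reduced (cyclic_prefix x l)" for l
    using x by (simp add: reduced_cyclic_prefix)
  \<comment> \<open>The two sides of f x^M = x^M f are computed differently: on the left f disturbs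
    only an initial piece, on the right x^M keeps all but at most \<open>length q\<close> of its
    letters.\<close>
  have E: "c @ map ?\<omega> [m..<M * ?n] = act_word (cyclic_prefix x (M * ?n)) q" if "M * ?n \<ge> l0" for M
    using act_word_cong[OF conjunct2[OF pow[of M]], of "[]"] c[OF that] red[of "M * ?n"]
      act_word_reduced[of "cyclic_prefix x (M * ?n)" "[]"]
    by (simp add: q_def)
  have F: "\<exists>j\<le>length q. act_word (cyclic_prefix x (M * ?n)) q
      = take (M * ?n - j) (cyclic_prefix x (M * ?n)) @ drop j q" for M
    using act_word_overlap[OF red[of "M * ?n"], of q] reduced_act_word[of "[]" f]
    by (auto simp: q_def)
  have agree: "(c @ map ?\<omega> [m..<M * ?n]) ! i = ?\<omega> i"
    if M: "M * ?n \<ge> l0" "i + length q < M * ?n" for M i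
  proof -
    obtain j where "j \<le> length q" "c @ map ?\<omega> [m..<M * ?n]
        = take (M * ?n - j) (cyclic_prefix x (M * ?n)) @ drop j q"
      using E[OF M(1)] F[of M] by auto
    moreover from this have "i < M * ?n - j"
      using M by linarith
    ultimately show ?thesis
      using M by (simp add: nth_append)
  qed
  have c_eq: "c ! i = ?\<omega> i" if "i < length c" for i
  proof -
    define M where "M = l0 + i + length q + 1"
    show ?thesis
      using le[of M] agree[of M i] that by (simp add: M_def nth_append)
  qed
  \<comment> \<open>Letter m + i of the periodic word now stands at position
    \<open>length c + i\<close>, where it must agree with the periodic word again; this gives the
    shift k = \<open>length c\<close> - m.\<close>
  have shift: "?\<omega> (m + i) = ?\<omega> (length c + i)" for i
  proof -
    define M where "M = l0 + m + i + length c + length q + 1"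
    show ?thesis
      using le[of M] agree[of M "length c + i"] by (simp add: M_def nth_append)
  qed
  have "c @ map ?\<omega> [m..<l] = cyclic_prefix x (nat (int l + (int (length c) - int m)))"
    if "l \<ge> m" for l
  proof (rule nth_equalityI)
    show "length (c @ map ?\<omega> [m..<l])
        = length (cyclic_prefix x (nat (int l + (int (length c) - int m))))"
      using that by simp
    fix i assume "i < length (c @ map ?\<omega> [m..<l])"
    then show "(c @ map ?\<omega> [m..<l]) ! i
        = cyclic_prefix x (nat (int l + (int (length c) - int m))) ! i"
      using that c_eq[of i] shift[of "i - length c"] by (auto simp: nth_append)
  qed
  then show ?thesis
    using c by (intro exI[of _ "int (length c) - int m"] exI[of _ "max l0 m"]) auto
qed


lemma word_class_pow:
  assumes "w \<in> words X"
  shows "concat (replicate n w) \<in> words X"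
    "word_class X R w [^]\<^bsub>presented_group X R\<^esub> (n::nat) = word_class X R (concat (replicate n w))"
proof -
  interpret group "presented_group X R" by (rule group_presented_group)
  show w: "concat (replicate n w) \<in> words X" for n
    using assms by (induction n) auto
  show "word_class X R w [^]\<^bsub>presented_group X R\<^esub> (n::nat) = word_class X R (concat (replicate n w))"
  proof (induction n)
    case (Suc n)
    have "word_class X R w \<in> carrier (presented_group X R)"
      using assms by (auto simp: carrier_presented_group)
    then show ?case
      unfolding nat_pow_Suc2[OF \<open>word_class X R w \<in> carrier (presented_group X R)\<close>] Suc
      using assms w mult_presented_group[of w X "concat (replicate n w)" R] by simp
  qed (simp add: one_presented_group)
qed

text \<open>What is used of the cyclicity of the centralizer of x: one exponent n takes all of it
  into the powers of x, and n-th roots within it are unique. In this form the property is stable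
  under conjugation and can be pulled back along injective homomorphisms.\<close>

definition cyclic_roots :: "('f, 'm) monoid_scheme \<Rightarrow> 'f \<Rightarrow> bool" where
  "cyclic_roots F x \<longleftrightarrow> (\<exists>n::nat. 0 < n \<and> (\<forall>f\<in>carrier F. f \<otimes>\<^bsub>F\<^esub> x = x \<otimes>\<^bsub>F\<^esub> f \<longrightarrow>
     (\<exists>k::int. f [^]\<^bsub>F\<^esub> n = x [^]\<^bsub>F\<^esub> k) \<and>
     (\<forall>g\<in>carrier F. g \<otimes>\<^bsub>F\<^esub> x = x \<otimes>\<^bsub>F\<^esub> g \<longrightarrow> g [^]\<^bsub>F\<^esub> n = f [^]\<^bsub>F\<^esub> n \<longrightarrow> g = f)))"

lemma (in group) pow_conj:
  assumes "a \<in> carrier G" "f \<in> carrier G"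
  shows "(a \<otimes> f \<otimes> inv a) [^] (n::nat) = a \<otimes> f [^] n \<otimes> inv a"
    "(a \<otimes> f \<otimes> inv a) [^] (k::int) = a \<otimes> f [^] k \<otimes> inv a"
proof -
  have nat: "(a \<otimes> f \<otimes> inv a) [^] (n::nat) = a \<otimes> f [^] n \<otimes> inv a" for n
  proof (induction n)
    case (Suc n)
    have "a \<otimes> f [^] n \<otimes> inv a \<otimes> (a \<otimes> f \<otimes> inv a) = a \<otimes> f [^] n \<otimes> (inv a \<otimes> a) \<otimes> f \<otimes> inv a"
      using assms by (simp only: m_assoc inv_closed m_closed nat_pow_closed)
    then show ?case
      using Suc assms by (simp add: m_assoc)
  qed (use assms in simp)
  then show "(a \<otimes> f \<otimes> inv a) [^] (n::nat) = a \<otimes> f [^] n \<otimes> inv a" .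
  show "(a \<otimes> f \<otimes> inv a) [^] (k::int) = a \<otimes> f [^] k \<otimes> inv a"
  proof (cases k rule: int_cases2)
    case (nonneg n)
    show ?thesis
      unfolding nonneg int_pow_int by (rule nat)
  next
    case (nonpos n)
    have "inv (a \<otimes> f [^] n \<otimes> inv a) = a \<otimes> inv (f [^] n) \<otimes> inv a"
      using assms by (simp add: inv_mult_group m_assoc)
    then show ?thesis
      using assms unfolding nonpos
      by (simp only: int_pow_neg int_pow_int nat m_closed inv_closed)
  qed
qed

lemma (in group) cyclic_roots_conj:
  assumes x: "x \<in> carrier G" "cyclic_roots G x" and a: "a \<in> carrier G"
  shows "cyclic_roots G (a \<otimes> x \<otimes> inv a)"
proof -
  let ?c = "\<lambda>f. inv a \<otimes> f \<otimes> a"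
  obtain n :: nat where n: "0 < n"
    "\<And>f. f \<in> carrier G \<Longrightarrow> f \<otimes> x = x \<otimes> f \<Longrightarrow> \<exists>k::int. f [^] n = x [^] k"
    "\<And>f g. f \<in> carrier G \<Longrightarrow> f \<otimes> x = x \<otimes> f \<Longrightarrow> g \<in> carrier G \<Longrightarrow> g \<otimes> x = x \<otimes> g
      \<Longrightarrow> g [^] n = f [^] n \<Longrightarrow> g = f"
    using x(2) unfolding cyclic_roots_def by blast
  have c: "?c f \<in> carrier G" "f = a \<otimes> ?c f \<otimes> inv a" if "f \<in> carrier G" for f
  proof -
    have "a \<otimes> ?c f \<otimes> inv a = (a \<otimes> inv a) \<otimes> f \<otimes> (a \<otimes> inv a)"
      using that a by (simp only: m_assoc inv_closed m_closed)
    then show "f = a \<otimes> ?c f \<otimes> inv a" "?c f \<in> carrier G"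
      using that a by simp_all
  qed
  have comm: "?c f \<otimes> x = x \<otimes> ?c f"
    if f: "f \<in> carrier G" "f \<otimes> (a \<otimes> x \<otimes> inv a) = (a \<otimes> x \<otimes> inv a) \<otimes> f" for f
  proof -
    have "?c f \<otimes> x = inv a \<otimes> (f \<otimes> (a \<otimes> x \<otimes> inv a)) \<otimes> a"
      using f(1) a x(1) by (simp add: m_assoc)
    also have "\<dots> = inv a \<otimes> ((a \<otimes> x \<otimes> inv a) \<otimes> f) \<otimes> a"
      by (simp only: f(2))
    also have "\<dots> = (inv a \<otimes> a) \<otimes> x \<otimes> ?c f"
      using f(1) a x(1) by (simp only: m_assoc inv_closed m_closed)
    finally show ?thesis
      using a x(1) by simp
  qed
  have pow: "f [^] n = a \<otimes> (?c f [^] n) \<otimes> inv a" if "f \<in> carrier G" for f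
    using pow_conj(1)[OF a c(1)[OF that], of n] c(2)[OF that] by simp
  show ?thesis
    unfolding cyclic_roots_def
  proof (intro exI[of _ n] conjI ballI impI n(1))
    fix f assume f: "f \<in> carrier G" "f \<otimes> (a \<otimes> x \<otimes> inv a) = (a \<otimes> x \<otimes> inv a) \<otimes> f"
    obtain k :: int where "?c f [^] n = x [^] k"
      using n(2)[OF c(1) comm] f by blast
    then show "\<exists>k::int. f [^] n = (a \<otimes> x \<otimes> inv a) [^] k"
      using pow[OF f(1)] pow_conj(2)[OF a x(1)] by metis
    fix g assume g: "g \<in> carrier G" "g \<otimes> (a \<otimes> x \<otimes> inv a) = (a \<otimes> x \<otimes> inv a) \<otimes> g"
      "g [^] n = f [^] n"
    then have "?c g [^] n = ?c f [^] n"
      using pow[OF f(1)] pow[OF g(1)] c(1) f(1) a by simp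
    then have "?c g = ?c f"
      using n(3)[OF c(1) comm c(1) comm] f g by blast
    then show "g = f"
      using f(1) g(1) a by simp
  qed
qed

text \<open>The exponent is n = \<open>length x\<close>. If f shifts the periodic word by k, then
  its n-th power shifts it by n k, as does the k-th power of x, so the two agree. Moreover k
  determines f, because f times a large power of x is the prefix of the shifted length, and the n-th
  power of f determines k.\<close>

lemma cyclic_roots_cyclically_reduced:
  assumes x: "x \<in> words X" "x \<noteq> []" "reduced (x @ x)"
  shows "cyclic_roots (free_group X) (word_class X {} x)"
proof -
  let ?F = "free_group X" and ?cl = "word_class X {}" and ?n = "length x"
  interpret F: group "free_group X"
    unfolding free_group_def by (rule group_presented_group)
  have car: "carrier ?F = ?cl ` words X" and
    mult: "\<And>u v. u \<in> words X \<Longrightarrow> v \<in> words X \<Longrightarrow> ?cl u \<otimes>\<^bsub>?F\<^esub> ?cl v = ?cl (u @ v)"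
    unfolding free_group_def by (simp_all add: carrier_presented_group mult_presented_group)
  have n: "?n > 0"
    using x by simp
  then have le: "m \<le> m * ?n" for m
    by (cases ?n) simp_all
  have P: "cyclic_prefix x l \<in> words X" for l
    using x by (simp add: cyclic_prefix_in_words)
  have X: "?cl x \<in> carrier ?F"
    using x by (simp add: car)
  have Xpow: "?cl x [^]\<^bsub>?F\<^esub> m = ?cl (cyclic_prefix x (m * ?n))" for m :: nat
    using word_class_pow(2)[OF x(1), of "{}" m] concat_replicate_eq_cyclic_prefix[OF x(2)]
    by (simp add: free_group_def)
  have inj: "l = l'" if "?cl (cyclic_prefix x l) = ?cl (cyclic_prefix x l')" for l l'
  proof -
    have "word_eq X {} (cyclic_prefix x l) (cyclic_prefix x l')"
      using that P by (simp add: word_class_eq_iff)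
    then have "act_word (cyclic_prefix x l) [] = act_word (cyclic_prefix x l') []"
      by (rule act_word_cong) simp
    then have "cyclic_prefix x l = cyclic_prefix x l'"
      using act_word_reduced[of "cyclic_prefix x l" "[]"] reduced_cyclic_prefix[OF x(2,3), of l]
        act_word_reduced[of "cyclic_prefix x l'" "[]"] reduced_cyclic_prefix[OF x(2,3), of l']
      by simp
    then have "length (cyclic_prefix x l) = length (cyclic_prefix x l')"
      by (rule arg_cong)
    then show ?thesis
      by (simp only: length_cyclic_prefix)
  qed
  have key: "\<exists>(k::int) L::nat. f [^]\<^bsub>?F\<^esub> ?n = ?cl x [^]\<^bsub>?F\<^esub> k \<and> (\<forall>m\<ge>L.
      f \<otimes>\<^bsub>?F\<^esub> ?cl x [^]\<^bsub>?F\<^esub> m = ?cl (cyclic_prefix x (nat (int (m * ?n) + k))))"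
    if f: "f \<in> carrier ?F" "f \<otimes>\<^bsub>?F\<^esub> ?cl x = ?cl x \<otimes>\<^bsub>?F\<^esub> f" for f
  proof -
    obtain u where u: "u \<in> words X" "f = ?cl u"
      using f(1) by (auto simp: car)
    have "word_eq X {} (u @ x) (x @ u)"
      using f(2) u x by (simp add: mult word_class_eq_iff)
    from commuting_word_shifts[OF x u(1) this] obtain k l0 where k: "\<And>l. l \<ge> l0 \<Longrightarrow> 0 \<le> int l + k"
      "\<And>l. l \<ge> l0 \<Longrightarrow> act_word u (cyclic_prefix x l) = cyclic_prefix x (nat (int l + k))"
      by blast
    \<comment> \<open>Every application of u may shorten the prefix by |k|, and at least l0 letters
      must remain before each one; hence the bound on l.\<close>
    have pow: "act_word (concat (replicate j u)) (cyclic_prefix x l)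
        = cyclic_prefix x (nat (int l + int j * k))" if "l \<ge> l0 + j * nat \<bar>k\<bar>" for l j
      using that
    proof (induction j)
      case (Suc j)
      have "- (int j * k) \<le> int j * \<bar>k\<bar>"
        using mult_left_mono[of "- k" "\<bar>k\<bar>" "int j"] by simp
      moreover have "l0 + j * nat \<bar>k\<bar> \<le> l"
        using Suc.prems by simp
      then have "int (l0 + j * nat \<bar>k\<bar>) \<le> int l"
        by (simp only: of_nat_le_iff)
      then have "int l0 + int j * \<bar>k\<bar> \<le> int l"
        by simp
      ultimately have l0: "int l0 \<le> int l + int j * k"
        by linarith
      have "act_word (concat (replicate (Suc j) u)) (cyclic_prefix x l)
          = act_word u (cyclic_prefix x (nat (int l + int j * k)))"
        using Suc by (simp add: algebra_simps)
      also have "\<dots> = cyclic_prefix x (nat (int (nat (int l + int j * k)) + k))"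
        using l0 by (intro k(2)) linarith
      also have "int (nat (int l + int j * k)) + k = int l + int (Suc j) * k"
        using l0 by (simp add: algebra_simps)
      finally show ?case .
    qed simp
    have act: "?cl w \<otimes>\<^bsub>?F\<^esub> ?cl (cyclic_prefix x l) = ?cl (act_word w (cyclic_prefix x l))"
      if "w \<in> words X" for w l
    proof -
      have eq: "word_eq X {} (w @ cyclic_prefix x l) (act_word w (cyclic_prefix x l))"
        using that P by (rule word_eq_act_word)
      show ?thesis
        using word_eq_words[OF eq] eq unfolding mult[OF that P] by (simp add: word_class_eq_iff)
    qed
    define m where "m = l0 + ?n * nat \<bar>k\<bar>"
    have "act_word (concat (replicate ?n u)) (cyclic_prefix x (m * ?n))
        = cyclic_prefix x (nat (int (m * ?n) + int ?n * k))"
      using le[of m] by (intro pow) (simp add: m_def)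
    moreover have "nat \<bar>k\<bar> \<le> ?n * nat \<bar>k\<bar>"
      using le[of "nat \<bar>k\<bar>"] by (simp only: mult.commute)
    then have mk: "0 \<le> int m + k"
      unfolding m_def by linarith
    have "int (m * ?n) + int ?n * k = (int m + k) * int ?n"
      by (simp add: algebra_simps)
    then have "nat (int (m * ?n) + int ?n * k) = nat (int m + k) * ?n"
      by (simp only: nat_mult_distrib[OF mk] nat_int)
    ultimately have "f [^]\<^bsub>?F\<^esub> ?n \<otimes>\<^bsub>?F\<^esub> ?cl x [^]\<^bsub>?F\<^esub> m = ?cl x [^]\<^bsub>?F\<^esub> nat (int m + k)"
      using word_class_pow(1)[OF u(1), of ?n] word_class_pow(2)[OF u(1), of "{}" ?n]
      by (simp add: Xpow act u(2) flip: free_group_def)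
    also have "\<dots> = ?cl x [^]\<^bsub>?F\<^esub> (k + int m)"
    proof -
      have "k + int m = int (nat (int m + k))"
        using mk by linarith
      then show ?thesis
        by (simp only: int_pow_int)
    qed
    also have "\<dots> = ?cl x [^]\<^bsub>?F\<^esub> k \<otimes>\<^bsub>?F\<^esub> ?cl x [^]\<^bsub>?F\<^esub> m"
      using X by (simp add: F.int_pow_mult int_pow_int)
    finally have "f [^]\<^bsub>?F\<^esub> ?n = ?cl x [^]\<^bsub>?F\<^esub> k"
      using f X by simp
    moreover have "f \<otimes>\<^bsub>?F\<^esub> ?cl x [^]\<^bsub>?F\<^esub> m = ?cl (cyclic_prefix x (nat (int (m * ?n) + k)))"
      if "m \<ge> l0" for m :: nat
    proof -
      have "l0 \<le> m * ?n"
        using le[of m] that by linarith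
      then show ?thesis
        using k(2)[of "m * ?n"] act[OF u(1)] by (simp add: Xpow u(2))
    qed
    ultimately show ?thesis
      by blast
  qed
  show ?thesis
    unfolding cyclic_roots_def
  proof (intro exI[of _ ?n] conjI ballI impI n)
    fix f assume f: "f \<in> carrier ?F" "f \<otimes>\<^bsub>?F\<^esub> ?cl x = ?cl x \<otimes>\<^bsub>?F\<^esub> f"
    show "\<exists>k::int. f [^]\<^bsub>?F\<^esub> ?n = ?cl x [^]\<^bsub>?F\<^esub> k"
      using key[OF f] by blast
    fix g assume g: "g \<in> carrier ?F" "g \<otimes>\<^bsub>?F\<^esub> ?cl x = ?cl x \<otimes>\<^bsub>?F\<^esub> g"
      "g [^]\<^bsub>?F\<^esub> ?n = f [^]\<^bsub>?F\<^esub> ?n"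
    obtain k L where k: "f [^]\<^bsub>?F\<^esub> ?n = ?cl x [^]\<^bsub>?F\<^esub> (k::int)" "\<And>m::nat. m \<ge> L \<Longrightarrow>
        f \<otimes>\<^bsub>?F\<^esub> ?cl x [^]\<^bsub>?F\<^esub> m = ?cl (cyclic_prefix x (nat (int (m * ?n) + k)))"
      using key[OF f] by blast
    obtain k' L' where k': "g [^]\<^bsub>?F\<^esub> ?n = ?cl x [^]\<^bsub>?F\<^esub> (k'::int)" "\<And>m::nat. m \<ge> L' \<Longrightarrow>
        g \<otimes>\<^bsub>?F\<^esub> ?cl x [^]\<^bsub>?F\<^esub> m = ?cl (cyclic_prefix x (nat (int (m * ?n) + k')))"
      using key[OF g(1,2)] by blast
    \<comment> \<open>Adding M makes both exponents non-negative, so that the powers of x become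
      prefixes and \<open>inj\<close> compares their lengths.\<close>
    define M where "M = nat \<bar>k\<bar> + nat \<bar>k'\<bar>"
    have "?cl x [^]\<^bsub>?F\<^esub> (k + int M) = ?cl x [^]\<^bsub>?F\<^esub> (k' + int M)"
      using k(1) k'(1) g(3) X by (simp add: F.int_pow_mult)
    moreover have "int (nat (k + int M)) = k + int M" "int (nat (k' + int M)) = k' + int M"
      unfolding M_def by linarith+
    ultimately have "?cl x [^]\<^bsub>?F\<^esub> int (nat (k + int M)) = ?cl x [^]\<^bsub>?F\<^esub> int (nat (k' + int M))"
      by (simp only:)
    then have "?cl x [^]\<^bsub>?F\<^esub> nat (k + int M) = ?cl x [^]\<^bsub>?F\<^esub> nat (k' + int M)"
      by (simp only: int_pow_int)
    then have "nat (k + int M) * ?n = nat (k' + int M) * ?n"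
      unfolding Xpow by (rule inj)
    then have "nat (k + int M) = nat (k' + int M)"
      using n by simp
    then have "k = k'"
      unfolding M_def by linarith
    then have "g \<otimes>\<^bsub>?F\<^esub> ?cl x [^]\<^bsub>?F\<^esub> max L L' = f \<otimes>\<^bsub>?F\<^esub> ?cl x [^]\<^bsub>?F\<^esub> max L L'"
      using k(2)[of "max L L'"] k'(2)[of "max L L'"] by simp
    then show "g = f"
      using f g X by simp
  qed
qed

text \<open>A reduced word whose last letter is inverse to its first is y v y^-1 with v reduced and
  shorter, so induction on the length and conjugation reduce the claim to cyclically reduced
  words.\<close>

theorem free_group_cyclic_roots:
  assumes "g \<in> carrier (free_group X)" "g \<noteq> \<one>\<^bsub>free_group X\<^esub>"
  shows "cyclic_roots (free_group X) g"
proof -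
  let ?F = "free_group X" and ?cl = "word_class X {}"
  interpret F: group "free_group X"
    unfolding free_group_def by (rule group_presented_group)
  have car: "carrier ?F = ?cl ` words X" and
    mult: "\<And>u v. u \<in> words X \<Longrightarrow> v \<in> words X \<Longrightarrow> ?cl u \<otimes>\<^bsub>?F\<^esub> ?cl v = ?cl (u @ v)" and
    one: "\<one>\<^bsub>?F\<^esub> = ?cl []"
    unfolding free_group_def
    by (simp_all add: carrier_presented_group mult_presented_group one_presented_group)
  have main: "cyclic_roots ?F (?cl u)" if "u \<in> words X" "u \<noteq> []" "reduced u" for u
    using that
  proof (induction "length u" arbitrary: u rule: less_induct)
    case less
    show ?case
    proof (cases "hd u = flip_letter (last u)")
      case False
      then have "reduced (u @ u)"
        using less.prems by (simp add: successively_append_iff)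
      then show ?thesis
        using less.prems cyclic_roots_cyclically_reduced by blast
    next
      case True
      then have "tl u \<noteq> []"
        using less.prems by (cases u) auto
      define y where "y = hd u"
      define v where "v = butlast (tl u)"
      have u: "u = [y] @ v @ [flip_letter y]"
        using True less.prems \<open>tl u \<noteq> []\<close> by (cases u) (auto simp: y_def v_def)
      have v: "v \<in> words X" "v \<noteq> []" "reduced v" "[y] \<in> words X" "[flip_letter y] \<in> words X"
        using less.prems(1,3) by (auto simp: u successively_Cons successively_append_iff)
      have "word_eq X {} ([y] @ [flip_letter y]) []"
        using word_eq.cancel[of "[]" X "[]" "fst y" "{}" "snd y"] v(4) by (simp add: flip_letter_def)
      then have "?cl [y] \<otimes>\<^bsub>?F\<^esub> ?cl [flip_letter y] = \<one>\<^bsub>?F\<^esub>"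
        using v by (simp add: mult one word_class_eq_iff)
      moreover have cl: "?cl [y] \<in> carrier ?F" "?cl [flip_letter y] \<in> carrier ?F"
        using v by (simp_all add: car)
      ultimately have "?cl [flip_letter y] = inv\<^bsub>?F\<^esub> ?cl [y]"
        using F.inv_equality[OF F.inv_comm[OF _ cl] cl] by simp
      then have "?cl u = ?cl [y] \<otimes>\<^bsub>?F\<^esub> ?cl v \<otimes>\<^bsub>?F\<^esub> inv\<^bsub>?F\<^esub> ?cl [y]"
        using v by (simp add: u mult flip: \<open>?cl [flip_letter y] = inv\<^bsub>?F\<^esub> ?cl [y]\<close>)
      moreover have "cyclic_roots ?F (?cl v)"
        using less.hyps[of v] v by (simp add: u)
      ultimately show ?thesis
        using F.cyclic_roots_conj[of "?cl v" "?cl [y]"] v by (simp add: car)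
    qed
  qed
  obtain w where w: "w \<in> words X" "g = ?cl w"
    using assms(1) by (auto simp: car)
  have eq: "word_eq X {} w (act_word w [])"
    using word_eq_act_word[OF w(1), of "[]" "{}"] by simp
  then have "g = ?cl (act_word w [])" "act_word w [] \<in> words X"
    using w word_eq_words[OF eq] by (simp_all add: word_class_eq_iff)
  moreover from this have "act_word w [] \<noteq> []"
    using assms(2) by (metis one)
  ultimately show ?thesis
    using main reduced_act_word[of "[]" w] by simp
qed

section \<open>The tree of a multiple HNN extension of the plane lattice\<close>

definition smul :: "int \<Rightarrow> int \<times> int \<Rightarrow> int \<times> int" where
  "smul m a = (m * fst a, m * snd a)"

lemma smul_simps [simp]:
  "smul 0 a = 0" "smul m 0 = 0" "smul 1 a = a" "smul (- m) a = - smul m a"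
  "smul m (- a) = - smul m a"
  by (auto simp: smul_def prod_eq_iff)

lemma smul_add: "smul (m + n) a = smul m a + smul n a"
  by (simp add: smul_def algebra_simps)

lemma smul_cancel: "a \<noteq> 0 \<Longrightarrow> smul m a = smul n a \<longleftrightarrow> m = n"
  by (auto simp: smul_def prod_eq_iff)

lemma (in group) additive_smul:
  assumes closed: "\<And>a. f a \<in> carrier G" and add: "\<And>a b. f (a + b) = f a \<otimes> f b"
  shows "f 0 = \<one>" "f (- a) = inv f a" "f (smul m a) = f a [^] m"
proof -
  show zero: "f 0 = \<one>"
    using add[of 0 0] closed[of 0] by simp
  show uminus: "f (- a) = inv f a" for a
    using add[of "- a" a] inv_equality[of "f (- a)" "f a"] closed zero by simp
  have nat: "f (smul (int n) a) = f a [^] n" for n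
  proof (induction n)
    case (Suc n)
    have "smul (int (Suc n)) a = smul (int n) a + a"
      using smul_add[of "int n" 1 a] by (simp add: add.commute)
    then show ?case
      using Suc by (simp add: add)
  qed (simp add: zero)
  show "f (smul m a) = f a [^] m"
  proof (cases m rule: int_cases2)
    case (nonneg n)
    then show ?thesis by (simp add: int_pow_int nat)
  next
    case (nonpos n)
    then show ?thesis
      using closed by (simp add: int_pow_neg int_pow_int nat uminus)
  qed
qed

text \<open>The letter \<open>(k, True)\<close> stands for a stable letter, \<open>(k, False)\<close> for its inverse; the letter
  \<open>e\<close> conjugates \<open>x (flip_letter e)\<close> to \<open>x e\<close>. Letters with \<open>x e = 0\<close> are free factors.\<close>

locale rose =
  fixes x :: "'k \<times> bool \<Rightarrow> int \<times> int"
  assumes x_flip_0: "x (flip_letter e) = 0 \<longleftrightarrow> x e = 0"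
begin

text \<open>A representative of the coset of g modulo the multiples of \<open>x e\<close>. The
  predicate under \<open>SOME\<close> depends only on the coset, which makes \<open>crep\<close>
  constant on cosets, and the trivial coset gets 0, so that membership in the edge group reads
  \<open>crep e g = 0\<close>. For \<open>x e = 0\<close> every g represents itself.\<close>

definition crep :: "'k \<times> bool \<Rightarrow> int \<times> int \<Rightarrow> int \<times> int" where
  "crep e g = (if \<exists>m. g = smul m (x e) then 0 else SOME r. \<exists>m. g = r + smul m (x e))"

definition cquo :: "'k \<times> bool \<Rightarrow> int \<times> int \<Rightarrow> int" where
  "cquo e g = (if x e = 0 then 0 else SOME m. g = crep e g + smul m (x e))"

lemma crep_decomp: "g = crep e g + smul (cquo e g) (x e)"
proof -
  have ex: "\<exists>m. g = crep e g + smul m (x e)"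
  proof (cases "\<exists>m. g = smul m (x e)")
    case True
    then show ?thesis by (simp add: crep_def)
  next
    case False
    have "\<exists>r m. g = r + smul m (x e)"
      by (intro exI[of _ g] exI[of _ 0]) simp
    then show ?thesis
      using False someI_ex[of "\<lambda>r. \<exists>m. g = r + smul m (x e)"] by (simp add: crep_def)
  qed
  show ?thesis
  proof (cases "x e = 0")
    case True
    then show ?thesis
      using ex by simp
  next
    case False
    then show ?thesis
      using someI_ex[OF ex] by (simp add: cquo_def)
  qed
qed

lemma crep_add [simp]: "crep e (g + smul m (x e)) = crep e g"
proof -
  have eq: "(\<exists>n. g + smul m (x e) = r + smul n (x e)) \<longleftrightarrow> (\<exists>n. g = r + smul n (x e))" for r
  proof
    assume "\<exists>n. g + smul m (x e) = r + smul n (x e)"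
    then obtain n where "g + smul m (x e) = r + smul n (x e)" ..
    then have "g = r + smul (n + - m) (x e)"
      by (simp only: smul_add smul_simps) (simp add: algebra_simps)
    then show "\<exists>n. g = r + smul n (x e)" ..
  next
    assume "\<exists>n. g = r + smul n (x e)"
    then obtain n where "g = r + smul n (x e)" ..
    then have "g + smul m (x e) = r + smul (n + m) (x e)"
      by (simp add: smul_add add.assoc)
    then show "\<exists>n. g + smul m (x e) = r + smul n (x e)" ..
  qed
  have "(\<exists>n. g + smul m (x e) = smul n (x e)) \<longleftrightarrow> (\<exists>n. g = smul n (x e))"
    using eq[of 0] by simp
  then show ?thesis
    unfolding crep_def eq by (simp only:)
qed

lemma crep_eq_0_iff: "crep e g = 0 \<longleftrightarrow> (\<exists>m. g = smul m (x e))"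
  using crep_decomp[of g e] by (auto simp: crep_def)

lemma crep_smul [simp]: "crep e (smul m (x e)) = 0"
  using crep_eq_0_iff by blast

lemma crep_0 [simp]: "crep e 0 = 0"
  using crep_smul[of e 0] by simp

lemma crep_crep_add [simp]: "crep e (h + crep e g) = crep e (h + g)"
proof -
  have "h + crep e g = (h + g) + smul (- cquo e g) (x e)"
    using crep_decomp[of g e] by (simp add: algebra_simps)
  then show ?thesis
    by (simp only: crep_add)
qed

lemma crep_uminus_eq_0: "crep e (- g) = 0 \<longleftrightarrow> crep e g = 0"
proof -
  have *: "crep e (- g) = 0" if "crep e g = 0" for g
    using that unfolding crep_eq_0_iff by (metis smul_simps(4))
  show ?thesis
    using *[of g] *[of "- g"] by auto
qed

lemma crep_trivial: "x e = 0 \<Longrightarrow> crep e g = g"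
  using crep_decomp[of g e] by simp

lemma cquo_add:
  assumes "x e \<noteq> 0"
  shows "cquo e (g + smul m (x e)) = cquo e g + m"
proof -
  have "g + smul m (x e) = crep e g + smul (cquo e (g + smul m (x e))) (x e)"
    using crep_decomp[of "g + smul m (x e)" e] by simp
  moreover have "g + smul m (x e) = crep e g + smul (cquo e g + m) (x e)"
    using crep_decomp[of g e] by (simp add: smul_add add.assoc[symmetric])
  ultimately have "smul (cquo e (g + smul m (x e))) (x e) = smul (cquo e g + m) (x e)"
    by (metis add_left_cancel)
  then show ?thesis
    using smul_cancel[OF assms] by blast
qed

lemma cquo_smul:
  assumes "x e \<noteq> 0"
  shows "cquo e (smul m (x e)) = m"
proof -
  have "smul (cquo e 0) (x e) = smul 0 (x e)"
    using crep_decomp[of 0 e] by simp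
  then have "cquo e 0 = 0"
    using smul_cancel[OF assms] by blast
  then show ?thesis
    using cquo_add[OF assms, of 0 m] by simp
qed

section \<open>Normal forms and the action on the Bass--Serre tree\<close>

definition starts :: "((int \<times> int) \<times> 'k \<times> bool) list \<Rightarrow> 'k \<times> bool \<Rightarrow> bool" where
  "starts p e \<longleftrightarrow> p \<noteq> [] \<and> hd p = (0, e)"

lemma starts_simps [simp]: "\<not> starts [] e" "starts (y # p) e \<longleftrightarrow> y = (0, e)"
  by (simp_all add: starts_def)

text \<open>A list (r1, e1), (r2, e2), ... stands for the coset r1 t_e1 r2 t_e2 ... Z^2 in the HNN
  extension, that is, for a vertex of the tree. Normal lists are the normal forms of such cosets:
  each r is a coset representative, and no t_e is followed directly by its inverse.\<close>

fun normal :: "((int \<times> int) \<times> 'k \<times> bool) list \<Rightarrow> bool" where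
  "normal [] \<longleftrightarrow> True"
| "normal ((r, e) # p) \<longleftrightarrow> crep e r = r \<and> normal p \<and> \<not> starts p (flip_letter e)"

text \<open>Left multiplication by g. The sum g + r splits into a representative and a multiple of
  \<open>x e\<close>, and this multiple passes across t_e as the same multiple of
  \<open>x (flip_letter e)\<close>. What is left at the end of the list is absorbed by the
  coset.\<close>

fun shift :: "int \<times> int \<Rightarrow> ((int \<times> int) \<times> 'k \<times> bool) list \<Rightarrow> ((int \<times> int) \<times> 'k \<times> bool) list" where
  "shift g [] = []"
| "shift g ((r, e) # p)
    = (crep e (g + r), e) # shift (smul (cquo e (g + r)) (x (flip_letter e))) p"

lemma length_shift [simp]: "length (shift g p) = length p"
  by (induction g p rule: shift.induct) auto

lemma shift_eq_Nil [simp]: "shift g p = [] \<longleftrightarrow> p = []"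
  by (cases p) auto

text \<open>Multiples of \<open>x e\<close> fix the edge e at the base vertex, so a carry arriving
  behind a letter never creates a cancellation.\<close>

lemma starts_shift: "normal p \<Longrightarrow> starts (shift (smul m (x e)) p) e \<longleftrightarrow> starts p e"
proof (induction p)
  case (Cons y p)
  obtain r f where y: "y = (r, f)"
    by (cases y) blast
  show ?case
    using Cons.prems crep_add[of e r m] by (auto simp: y add.commute)
qed simp

lemma normal_shift: "normal p \<Longrightarrow> normal (shift g p)"
proof (induction g p rule: shift.induct)
  case (2 g r e p)
  have "crep e (crep e (g + r)) = crep e (g + r)"
    using crep_crep_add[of e 0 "g + r"] by simp
  then show ?case
    using 2 by (simp add: starts_shift)
qed simp

lemma shift_0: "normal p \<Longrightarrow> shift 0 p = p"
proof (induction p)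
  case (Cons y p)
  obtain r e where y: "y = (r, e)"
    by (cases y) blast
  have "smul (cquo e r) (x (flip_letter e)) = 0"
  proof (cases "x e = 0")
    case True
    then show ?thesis
      using x_flip_0[of e] by simp
  next
    case False
    have "smul (cquo e r) (x e) = smul 0 (x e)"
      using crep_decomp[of r e] Cons.prems by (simp add: y)
    then have "cquo e r = 0"
      using smul_cancel[OF False] by blast
    then show ?thesis
      by simp
  qed
  then show ?case
    using Cons by (simp add: y)
qed simp

lemma shift_shift: "shift g (shift h p) = shift (g + h) p"
proof (induction p arbitrary: g h)
  case (Cons y p)
  obtain r e where y: "y = (r, e)"
    by (cases y) blast
  have "smul (cquo e (g + crep e (h + r))) (x (flip_letter e)) + smul (cquo e (h + r)) (x (flip_letter e))
      = smul (cquo e (g + (h + r))) (x (flip_letter e))"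
  proof (cases "x e = 0")
    case True
    then show ?thesis
      using x_flip_0[of e] by simp
  next
    case False
    have "g + (h + r) = (g + crep e (h + r)) + smul (cquo e (h + r)) (x e)"
      using crep_decomp[of "h + r" e] by (simp add: add.assoc)
    then have "cquo e (g + (h + r)) = cquo e ((g + crep e (h + r)) + smul (cquo e (h + r)) (x e))"
      by (rule arg_cong)
    also have "\<dots> = cquo e (g + crep e (h + r)) + cquo e (h + r)"
      by (rule cquo_add[OF False])
    finally show ?thesis
      by (simp add: smul_add)
  qed
  then show ?case
    using Cons by (simp add: y add.assoc)
qed simp

text \<open>A point \<open>(p, b)\<close> is an edge of the Bass--Serre tree, given by the reduced path \<open>p\<close> leading to
  it, with one of its two orientations.\<close>

definition edge :: "((int \<times> int) \<times> 'k \<times> bool) list \<times> bool \<Rightarrow> bool" where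
  "edge w \<longleftrightarrow> normal (fst w) \<and> fst w \<noteq> []"

definition rotate_edge ::
    "int \<times> int \<Rightarrow> ((int \<times> int) \<times> 'k \<times> bool) list \<times> bool \<Rightarrow> ((int \<times> int) \<times> 'k \<times> bool) list \<times> bool" where
  "rotate_edge g w = (if edge w then (shift g (fst w), snd w) else w)"

text \<open>Left multiplication by t_e. An edge is named by the path from the base vertex to its far
  end. The edge named by t_e^-1 joins the base vertex to t_e^-1 Z^2, and t_e takes it to the edge
  between t_e Z^2 and the base vertex, with near and far end exchanged; this is the only edge whose
  orientation bit flips.\<close>

definition cross_edge ::
    "'k \<times> bool \<Rightarrow> ((int \<times> int) \<times> 'k \<times> bool) list \<times> bool \<Rightarrow> ((int \<times> int) \<times> 'k \<times> bool) list \<times> bool" where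
  "cross_edge e w =
     (if \<not> edge w then w
      else if fst w = [(0, flip_letter e)] then ([(0, e)], \<not> snd w)
      else if starts (fst w) (flip_letter e) then (tl (fst w), snd w)
      else ((0, e) # fst w, snd w))"

lemma edge_rotate [simp]: "edge (rotate_edge g w) \<longleftrightarrow> edge w"
  by (auto simp: rotate_edge_def edge_def normal_shift)

lemma edge_cross [simp]: "edge (cross_edge e w) \<longleftrightarrow> edge w"
proof (cases "edge w")
  case True
  obtain r f p b where w: "w = ((r, f) # p, b)"
    using True by (cases w; cases "fst w") (auto simp: edge_def)
  show ?thesis
    using True by (auto simp: w edge_def cross_edge_def)
qed (simp add: cross_edge_def)

lemma rotate_0 [simp]: "rotate_edge 0 = id"
  by (auto simp: rotate_edge_def edge_def shift_0 fun_eq_iff)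

lemma rotate_rotate: "rotate_edge g (rotate_edge h w) = rotate_edge (g + h) w"
  using edge_rotate[of h w] by (cases "edge w") (simp_all add: rotate_edge_def shift_shift)

lemma cross_cross: "cross_edge e (cross_edge (flip_letter e) w) = w"
proof (cases "edge w")
  case True
  then have "edge (cross_edge (flip_letter e) w)"
    by simp
  obtain y p b where w: "w = (y # p, b)"
    using True by (cases w; cases "fst w") (auto simp: edge_def)
  obtain r f where y: "y = (r, f)"
    by (cases y) blast
  consider "y = (0, e)" "p = []" | z q where "y = (0, e)" "p = z # q" | "y \<noteq> (0, e)"
    by (cases p) auto
  then show ?thesis
  proof cases
    case 1
    then show ?thesis
      using True by (simp add: cross_edge_def w edge_def)
  next
    case 2
    then show ?thesis
      using True by (auto simp: cross_edge_def w edge_def)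
  next
    case 3
    then show ?thesis
      using True by (auto simp: cross_edge_def w edge_def y)
  qed
qed (simp add: cross_edge_def)

text \<open>The defining relation of the HNN extension: t_e conjugates
  \<open>x (flip_letter e)\<close> to \<open>x e\<close>.\<close>

lemma cross_rotate:
  "cross_edge e (rotate_edge (smul m (x (flip_letter e))) w) = rotate_edge (smul m (x e)) (cross_edge e w)"
proof (cases "edge w")
  case True
  then have E: "edge (rotate_edge (smul m (x (flip_letter e))) w)" "edge (cross_edge e w)"
    by simp_all
  obtain r f p b where w: "w = ((r, f) # p, b)"
    using True by (cases w; cases "fst w") (auto simp: edge_def)
  have N: "normal ((r, f) # p)"
    using True by (simp add: edge_def w)
  have quo: "smul (cquo e (smul m (x e))) (x (flip_letter e)) = smul m (x (flip_letter e))" for e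
    using x_flip_0[of e] by (cases "x e = 0") (simp_all add: cquo_smul)
  show ?thesis
  proof (cases "(r, f) = (0, flip_letter e)")
    case True
    then show ?thesis
      using E \<open>edge w\<close> quo[of "flip_letter e"]
      by (cases p) (auto simp: cross_edge_def rotate_edge_def w edge_def)
  next
    case False
    define q where "q = shift (smul m (x (flip_letter e))) ((r, f) # p)"
    have rot: "rotate_edge (smul m (x (flip_letter e))) w = (q, b)"
      using \<open>edge w\<close> by (simp add: rotate_edge_def q_def w)
    have "\<not> starts q (flip_letter e)"
      using starts_shift[OF N, of m "flip_letter e"] False unfolding q_def by simp
    then have "cross_edge e (q, b) = ((0, e) # q, b)"
      using E(1) unfolding rot by (auto simp: cross_edge_def)
    moreover have "cross_edge e w = ((0, e) # (r, f) # p, b)"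
      using False \<open>edge w\<close> by (auto simp: cross_edge_def w)
    moreover from this have "rotate_edge (smul m (x e)) (cross_edge e w) = ((0, e) # q, b)"
      using E(2) quo[of e] by (simp add: rotate_edge_def q_def)
    ultimately show ?thesis
      unfolding rot by simp
  qed
qed (simp add: cross_edge_def rotate_edge_def)

definition outward :: "(((int \<times> int) \<times> 'k \<times> bool) list \<times> bool) set" where
  "outward = {w. snd w}"

lemma rotate_in_commensurator: "rotate_edge g \<in> carrier (commensurator outward)"
proof -
  have "bij (rotate_edge g)"
    by (rule o_bij[of "rotate_edge (- g)"]) (simp_all add: fun_eq_iff rotate_rotate)
  moreover have "(rotate_edge g w \<in> outward) = (w \<in> outward)" for w
    by (simp add: rotate_edge_def outward_def)
  ultimately show ?thesis
    by simp
qed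

lemma cross_in_commensurator: "cross_edge e \<in> carrier (commensurator outward)"
proof -
  have "bij (cross_edge e)"
    using cross_cross[of e] cross_cross[of "flip_letter e"]
    by (intro o_bij[of "cross_edge (flip_letter e)"]) (simp_all add: fun_eq_iff)
  moreover have "{w. (cross_edge e w \<in> outward) \<noteq> (w \<in> outward)} \<subseteq> {[(0, flip_letter e)]} \<times> UNIV"
    by (auto simp: cross_edge_def outward_def split: if_splits)
  then have "finite {w. (cross_edge e w \<in> outward) \<noteq> (w \<in> outward)}"
    by (rule finite_subset) simp
  ultimately show ?thesis
    by simp
qed

section \<open>Hyperbolic elements and their axes\<close>

fun travel :: "((int \<times> int) \<times> 'k \<times> bool) list \<Rightarrow> ((int \<times> int) \<times> 'k \<times> bool) list \<times> bool
    \<Rightarrow> ((int \<times> int) \<times> 'k \<times> bool) list \<times> bool" where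
  "travel [] w = w"
| "travel ((a, e) # l) w = rotate_edge a (cross_edge e (travel l w))"

fun travel_back :: "((int \<times> int) \<times> 'k \<times> bool) list \<Rightarrow> ((int \<times> int) \<times> 'k \<times> bool) list \<times> bool
    \<Rightarrow> ((int \<times> int) \<times> 'k \<times> bool) list \<times> bool" where
  "travel_back [] w = w"
| "travel_back ((a, e) # l) w = travel_back l (cross_edge (flip_letter e) (rotate_edge (- a) w))"

lemma travel_travel_back: "travel l (travel_back l w) = w"
  by (induction l w rule: travel_back.induct) (simp_all add: cross_cross rotate_rotate)

lemma travel_append: "travel (l @ l') w = travel l (travel l' w)"
  by (induction l w rule: travel.induct) auto

lemma edge_travel [simp]: "edge (travel l w) \<longleftrightarrow> edge w"
  by (induction l w rule: travel.induct) auto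

text \<open>Britton's condition: no subword t_e a t_e^-1 in which a lies in the edge group, that is,
  is a multiple of \<open>x (flip_letter e)\<close>.\<close>

definition no_backtrack :: "(int \<times> int) \<times> 'k \<times> bool \<Rightarrow> (int \<times> int) \<times> 'k \<times> bool \<Rightarrow> bool" where
  "no_backtrack y z \<longleftrightarrow> \<not> (snd z = flip_letter (snd y) \<and> crep (snd z) (fst z) = 0)"

text \<open>The last letter e of l turns over the edge named by t_e^-1, which changes the
  orientation bit; every further letter only lengthens the path, since a cancellation would be a
  backtrack.\<close>

lemma travel_reduced:
  assumes "successively no_backtrack l" "l \<noteq> []"
  shows "\<exists>p. travel l ([(0, flip_letter (snd (last l)))], b)
      = ((crep (snd (hd l)) (fst (hd l)), snd (hd l)) # p, \<not> b) \<and> Suc (length p) = length l"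
  using assms
proof (induction l)
  case (Cons y l)
  obtain a e where y: "y = (a, e)"
    by (cases y) blast
  show ?case
  proof (cases "l = []")
    case True
    then show ?thesis
      by (simp add: y cross_edge_def rotate_edge_def edge_def)
  next
    case False
    then obtain p where p: "travel l ([(0, flip_letter (snd (last l)))], b)
        = ((crep (snd (hd l)) (fst (hd l)), snd (hd l)) # p, \<not> b)" "Suc (length p) = length l"
      using Cons by (auto simp: successively_Cons)
    let ?z = "(crep (snd (hd l)) (fst (hd l)), snd (hd l))"
    have "edge (travel l ([(0, flip_letter (snd (last l)))], b))"
      unfolding edge_travel by (simp add: edge_def)
    then have E: "edge (?z # p, \<not> b)"
      by (simp only: p(1))
    have "?z \<noteq> (0, flip_letter e)"
      using Cons.prems False by (auto simp: successively_Cons no_backtrack_def y)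
    then have "cross_edge e (?z # p, \<not> b) = ((0, e) # ?z # p, \<not> b)"
      using E by (auto simp: cross_edge_def)
    moreover from this have "edge ((0, e) # ?z # p, \<not> b)"
      using E edge_cross by metis
    ultimately show ?thesis
      using p False by (simp add: y rotate_edge_def)
  qed
qed simp

text \<open>In the backward direction the path grows from the beginning, and no edge is turned over.
  The extra first entry y only records the letter with which the path starts.\<close>

lemma travel_back_reduced:
  assumes "successively no_backtrack (y # l)" "edge ((0, flip_letter (snd y)) # p, b)"
  shows "\<exists>p'. travel_back l ((0, flip_letter (snd y)) # p, b)
      = ((0, flip_letter (snd (last (y # l)))) # p', b) \<and> length p' = length p + length l"
  using assms
proof (induction l arbitrary: y p)
  case (Cons z l)
  obtain a e where z: "z = (a, e)"
    by (cases z) blast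
  let ?f = "flip_letter (snd y)"
  define q where "q = shift (smul (cquo ?f (- a)) (x (flip_letter ?f))) p"
  have rot: "rotate_edge (- a) ((0, ?f) # p, b) = ((crep ?f (- a), ?f) # q, b)"
    using Cons.prems(2) by (simp add: rotate_edge_def q_def)
  then have E: "edge ((crep ?f (- a), ?f) # q, b)"
    using edge_rotate Cons.prems(2) by metis
  have "(crep ?f (- a), ?f) \<noteq> (0, e)"
    using Cons.prems(1) by (auto simp: z no_backtrack_def crep_uminus_eq_0)
  then have cross: "cross_edge (flip_letter e) ((crep ?f (- a), ?f) # q, b)
      = ((0, flip_letter e) # (crep ?f (- a), ?f) # q, b)"
    using E by (auto simp: cross_edge_def)
  then have "edge ((0, flip_letter (snd z)) # (crep ?f (- a), ?f) # q, b)"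
    using E edge_cross z by (metis snd_conv)
  then obtain p' where "travel_back l ((0, flip_letter (snd z)) # (crep ?f (- a), ?f) # q, b)
      = ((0, flip_letter (snd (last (z # l)))) # p', b)"
    "length p' = length ((crep ?f (- a), ?f) # q) + length l"
    using Cons.IH[of z "(crep ?f (- a), ?f) # q"] Cons.prems(1) by auto
  then show ?case
    using rot cross by (simp add: z q_def)
qed simp

lemma successively_concat_replicate:
  assumes "successively P (l @ l)"
  shows "successively P (concat (replicate n l))"
proof (induction n)
  case (Suc n)
  then show ?case
    using assms by (cases n) (auto simp: successively_append_iff)
qed simp

text \<open>The orbit of an edge on the axis of a hyperbolic element. The edge is the one that the
  last letter turns over, oriented inward: its images under positive powers point outward, those
  under the other powers inward, and the growing path lengths keep them distinct.\<close>

lemma fixfree_travel: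
  assumes l: "l \<noteq> []" "successively no_backtrack (l @ l)"
  shows "fixfree outward (travel l)"
proof -
  define y where "y = ([(0::int \<times> int, flip_letter (snd (last l)))], False)"
  define L where "L = (\<lambda>n. concat (replicate n l))"
  define F where "F = (\<lambda>n. travel (L (Suc n)) y)"
  define B where "B = (\<lambda>n. travel_back (L n) y)"
  have len: "length (L n) = n * length l" for n
    by (induction n) (simp_all add: L_def)
  have last: "last (L (Suc n)) = last l" for n
    using l(1) by (induction n) (simp_all add: L_def)
  have F: "length (fst (F n)) = Suc n * length l \<and> F n \<in> outward" for n
  proof -
    have "L (Suc n) \<noteq> []" "successively no_backtrack (L (Suc n))"
      using l successively_concat_replicate[OF l(2), of "Suc n"] unfolding L_def by simp_all
    from travel_reduced[OF this(2,1), of False] obtain p where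
      "F n = ((crep (snd (hd (L (Suc n)))) (fst (hd (L (Suc n)))), snd (hd (L (Suc n)))) # p, True)"
      "Suc (length p) = length (L (Suc n))"
      by (auto simp: F_def y_def last)
    then show ?thesis
      by (simp only: len outward_def) simp
  qed
  have B: "length (fst (B n)) = Suc (n * length l) \<and> B n \<notin> outward" for n
  proof -
    have "successively no_backtrack (last l # L n)"
      using l successively_concat_replicate[OF l(2), of n]
      by (cases n) (auto simp: successively_Cons successively_append_iff L_def)
    moreover have "edge ([(0, flip_letter (snd (last l)))], False)"
      by (simp add: edge_def)
    ultimately obtain p where "B n = ((0, flip_letter (snd (last (last l # L n)))) # p, False)"
      "length p = length (L n)"
      using travel_back_reduced[of "last l" "L n" "[]" False] by (auto simp: B_def y_def)
    then show ?thesis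
      by (simp add: len outward_def)
  qed
  have "inj F"
  proof (rule injI)
    fix m n assume "F m = F n"
    then have "Suc m * length l = Suc n * length l"
      using conjunct1[OF F[of m]] conjunct1[OF F[of n]] by (simp only:)
    then have "Suc m = Suc n"
      using l(1) unfolding mult_cancel2 by simp
    then show "m = n"
      by simp
  qed
  moreover have "inj B"
  proof (rule injI)
    fix m n assume "B m = B n"
    then have "Suc (m * length l) = Suc (n * length l)"
      using conjunct1[OF B[of m]] conjunct1[OF B[of n]] by (simp only:)
    then show "m = n"
      using l(1) by simp
  qed
  ultimately have inf: "infinite (range F)" "infinite (range B)"
    by (simp_all add: range_inj_infinite)
  show ?thesis
  proof (rule fixfreeI[of "range F \<union> range B"])
    show "infinite ((range F \<union> range B) \<inter> outward)"
      by (rule infinite_super[OF _ inf(1)]) (use F in auto)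
    show "infinite ((range F \<union> range B) - outward)"
      by (rule infinite_super[OF _ inf(2)]) (use B in auto)
    fix h :: "_ \<Rightarrow> real" and u v
    assume h: "h \<circ> travel l = h" and uv: "u \<in> range F \<union> range B" "v \<in> range F \<union> range B"
    have h1: "h (travel l w) = h w" for w
      using fun_cong[OF h, of w] by simp
    have hF: "h (travel (L n) w) = h w" for n w
      by (induction n) (simp_all add: L_def travel_append h1)
    have hB: "h (travel_back (L n) w) = h w" for n w
      using hF[of n "travel_back (L n) w"] by (simp add: travel_travel_back)
    have "h w = h y" if "w \<in> range F \<union> range B" for w
      using that by (elim UnE rangeE) (simp_all only: F_def B_def hF hB)
    then show "h u = h v"
      using uv by simp
  qed
qed

text \<open>At a letter s with trivial edge group every element is its own representative, so g can
  be read off from the image of the edge s.\<close>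

lemma rotate_faithful:
  assumes "x s = 0" "rotate_edge g = rotate_edge h"
  shows "g = h"
proof -
  have "rotate_edge g ([(0, s)], True) = ([(g, s)], True)" for g
    using assms(1) by (simp add: rotate_edge_def edge_def crep_trivial)
  then show ?thesis
    using assms(2) by (metis Pair_inject list.inject)
qed

text \<open>A ping-pong argument: t_e v t_e^-1 takes every edge (r, s) at the base vertex into the
  branch behind e, whereas u permutes the edges (r, s) and moves that branch off itself, because u
  is not in the edge group.\<close>

lemma rotate_cross_not_commute:
  assumes s: "x s = 0" "fst s \<noteq> fst e"
    and u: "crep e u \<noteq> 0" and v: "crep (flip_letter e) v \<noteq> 0"
  shows "rotate_edge u \<circ> (cross_edge e \<circ> rotate_edge v \<circ> cross_edge (flip_letter e))
    \<noteq> (cross_edge e \<circ> rotate_edge v \<circ> cross_edge (flip_letter e)) \<circ> rotate_edge u"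
proof
  let ?f = "flip_letter e"
  assume eq: "rotate_edge u \<circ> (cross_edge e \<circ> rotate_edge v \<circ> cross_edge ?f)
    = (cross_edge e \<circ> rotate_edge v \<circ> cross_edge ?f) \<circ> rotate_edge u"
  have s_ne: "s \<noteq> e" "s \<noteq> ?f" "e \<noteq> s" "?f \<noteq> s"
    using s(2) by auto
  have conj: "\<exists>p. (cross_edge e \<circ> rotate_edge v \<circ> cross_edge ?f) ([(r, s)], True) = ((0, e) # p, True)
      \<and> p \<noteq> [] \<and> edge ((0, e) # p, True)" for r
  proof -
    have "edge ([(r, s)], True)"
      using s by (simp add: edge_def crep_trivial)
    then have 1: "cross_edge ?f ([(r, s)], True) = ([(0, ?f), (r, s)], True)"
      using s_ne by (simp add: cross_edge_def)
    moreover have E: "edge ([(0, ?f), (r, s)], True)"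
      using s s_ne by (simp add: edge_def crep_trivial)
    ultimately obtain q where q: "rotate_edge v (cross_edge ?f ([(r, s)], True)) = ((crep ?f v, ?f) # q, True)"
      by (simp add: rotate_edge_def)
    have E': "edge ((crep ?f v, ?f) # q, True)"
      using q 1 E edge_rotate by metis
    have 2: "cross_edge e ((crep ?f v, ?f) # q, True) = ((0, e) # (crep ?f v, ?f) # q, True)"
      using E' v by (auto simp: cross_edge_def)
    then have "edge ((0, e) # (crep ?f v, ?f) # q, True)"
      using E' edge_cross by metis
    then show ?thesis
      using q 2 by simp
  qed
  obtain p where p: "(cross_edge e \<circ> rotate_edge v \<circ> cross_edge ?f) ([(0, s)], True) = ((0, e) # p, True)"
      "edge ((0, e) # p, True)"
    using conj by blast
  have "rotate_edge u ([(0, s)], True) = ([(u, s)], True)"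
    using s(1) by (simp add: rotate_edge_def edge_def crep_trivial)
  moreover obtain p' where "(cross_edge e \<circ> rotate_edge v \<circ> cross_edge ?f) ([(u, s)], True) = ((0, e) # p', True)"
    using conj by blast
  ultimately have "rotate_edge u ((0, e) # p, True) = ((0, e) # p', True)"
    using fun_cong[OF eq, of "([(0, s)], True)"] p by simp
  then show False
    using p(2) u by (simp add: rotate_edge_def)
qed

end

section \<open>Tubular groups in coordinates\<close>

definition edge_rel :: "('v, 'e) pre_digraph \<Rightarrow> 'e set \<Rightarrow> ('v \<times> 'v) set" where
  "edge_rel \<Gamma> S = (\<Union>e\<in>S. {(tail \<Gamma> e, head \<Gamma> e), (head \<Gamma> e, tail \<Gamma> e)})"

lemma connected_iff_edge_rel:
  assumes "wf_digraph \<Gamma>" "S \<subseteq> arcs \<Gamma>"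
  shows "Digraph_Component.connected (\<Gamma>\<lparr>arcs := S\<rparr>) \<longleftrightarrow>
    verts \<Gamma> \<noteq> {} \<and> (\<forall>u\<in>verts \<Gamma>. \<forall>v\<in>verts \<Gamma>. (u, v) \<in> (edge_rel \<Gamma> S)\<^sup>*)"
proof -
  have in_verts: "v \<in> verts \<Gamma>" if "(u, v) \<in> edge_rel \<Gamma> S" for u v
    using that assms by (auto simp: edge_rel_def wf_digraph_def)
  have R: "(u, v) \<in> rtrancl_on (verts \<Gamma>) (edge_rel \<Gamma> S)" if "u \<in> verts \<Gamma>" "(u, v) \<in> (edge_rel \<Gamma> S)\<^sup>*" for u v
    using that(2)
  proof induction
    case base
    then show ?case using that(1) by simp
  next
    case (step y z)
    then show ?case
      by (auto intro: rtrancl_on_into_rtrancl_on in_verts)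
  qed
  have "(u, v) \<in> rtrancl_on (verts \<Gamma>) (edge_rel \<Gamma> S) \<longleftrightarrow> (u, v) \<in> (edge_rel \<Gamma> S)\<^sup>*"
    if "u \<in> verts \<Gamma>" for u v
    using R[OF that] rtrancl_on_rtranclI[of u v "verts \<Gamma>" "edge_rel \<Gamma> S"] by blast
  moreover have "(\<Union>e\<in>S. {(tail (\<Gamma>\<lparr>arcs := S\<rparr>) e, head (\<Gamma>\<lparr>arcs := S\<rparr>) e),
      (head (\<Gamma>\<lparr>arcs := S\<rparr>) e, tail (\<Gamma>\<lparr>arcs := S\<rparr>) e)}) = edge_rel \<Gamma> S"
    by (simp add: edge_rel_def)
  ultimately show ?thesis
    by (simp add: Digraph_Component.connected_def strongly_connected_def mk_symmetric_def reachable_def)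
qed

text \<open>The equations are solved one tree edge at a time. A new edge e joins two different
  components, by the minimality of T, so multiplying \<beta> from the left by a constant on the
  component C of its head repairs the equation at e and preserves the earlier ones.\<close>

lemma spanning_tree_gauge:
  assumes wf: "wf_digraph \<Gamma>" and tree: "spanning_tree_arcs \<Gamma> T" and fin: "finite T"
    and K: "group K" and t: "\<And>e. e \<in> T \<Longrightarrow> t e \<in> carrier K"
  shows "\<exists>\<beta>. (\<forall>v. \<beta> v \<in> carrier K) \<and> (\<forall>e\<in>T. \<beta> (tail \<Gamma> e) \<otimes>\<^bsub>K\<^esub> t e = \<beta> (head \<Gamma> e))"
proof -
  interpret K: group K by fact
  have T: "T \<subseteq> arcs \<Gamma>" and conn: "Digraph_Component.connected (\<Gamma>\<lparr>arcs := T\<rparr>)"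
    and min: "\<And>e. e \<in> T \<Longrightarrow> \<not> Digraph_Component.connected (\<Gamma>\<lparr>arcs := T - {e}\<rparr>)"
    using tree by (auto simp: spanning_tree_arcs_def)
  have "finite S \<Longrightarrow> S \<subseteq> T \<Longrightarrow>
    \<exists>\<beta>. (\<forall>v. \<beta> v \<in> carrier K) \<and> (\<forall>e\<in>S. \<beta> (tail \<Gamma> e) \<otimes>\<^bsub>K\<^esub> t e = \<beta> (head \<Gamma> e))" for S
  proof (induction S rule: finite_induct)
    case empty
    then show ?case
      by (intro exI[of _ "\<lambda>_. \<one>\<^bsub>K\<^esub>"]) simp
  next
    case (insert e S)
    then obtain \<beta> where \<beta>: "\<And>v. \<beta> v \<in> carrier K"
      "\<And>f. f \<in> S \<Longrightarrow> \<beta> (tail \<Gamma> f) \<otimes>\<^bsub>K\<^esub> t f = \<beta> (head \<Gamma> f)"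
      by auto
    define C where "C = {v. (head \<Gamma> e, v) \<in> (edge_rel \<Gamma> S)\<^sup>*}"
    \<comment> \<open>Otherwise the ends of e would stay connected without e, and e could be removed
      from T.\<close>
    have "tail \<Gamma> e \<notin> C"
    proof
      assume "tail \<Gamma> e \<in> C"
      have sym: "sym ((edge_rel \<Gamma> (T - {e}))\<^sup>*)"
        by (intro sym_rtrancl) (auto simp: sym_def edge_rel_def)
      have "(edge_rel \<Gamma> S)\<^sup>* \<subseteq> (edge_rel \<Gamma> (T - {e}))\<^sup>*"
        using insert by (intro rtrancl_mono) (auto simp: edge_rel_def)
      then have he: "(head \<Gamma> e, tail \<Gamma> e) \<in> (edge_rel \<Gamma> (T - {e}))\<^sup>*"
        using \<open>tail \<Gamma> e \<in> C\<close> by (auto simp: C_def)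
      then have te: "(tail \<Gamma> e, head \<Gamma> e) \<in> (edge_rel \<Gamma> (T - {e}))\<^sup>*"
        using symD[OF sym] by blast
      have "edge_rel \<Gamma> T \<subseteq> (edge_rel \<Gamma> (T - {e}))\<^sup>*"
      proof
        fix z assume "z \<in> edge_rel \<Gamma> T"
        then obtain f where f: "f \<in> T" "z = (tail \<Gamma> f, head \<Gamma> f) \<or> z = (head \<Gamma> f, tail \<Gamma> f)"
          by (auto simp: edge_rel_def)
        show "z \<in> (edge_rel \<Gamma> (T - {e}))\<^sup>*"
        proof (cases "f = e")
          case True
          then show ?thesis using f he te by blast
        next
          case False
          then have "z \<in> edge_rel \<Gamma> (T - {e})"
            using f by (auto simp: edge_rel_def)
          then show ?thesis by blast
        qed
      qed
      then have "(edge_rel \<Gamma> T)\<^sup>* \<subseteq> (edge_rel \<Gamma> (T - {e}))\<^sup>*"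
        by (rule rtrancl_subset_rtrancl)
      moreover have "T - {e} \<subseteq> arcs \<Gamma>"
        using T by blast
      ultimately show False
        using min[of e] conn insert.prems connected_iff_edge_rel[OF wf T]
          connected_iff_edge_rel[OF wf \<open>T - {e} \<subseteq> arcs \<Gamma>\<close>] by blast
    qed
    define \<gamma> where "\<gamma> = \<beta> (tail \<Gamma> e) \<otimes>\<^bsub>K\<^esub> t e \<otimes>\<^bsub>K\<^esub> inv\<^bsub>K\<^esub> \<beta> (head \<Gamma> e)"
    have te: "t e \<in> carrier K"
      using t insert.prems by simp
    then have \<gamma>: "\<gamma> \<in> carrier K"
      using \<beta>(1) by (simp add: \<gamma>_def)
    define \<beta>' where "\<beta>' = (\<lambda>v. if v \<in> C then \<gamma> \<otimes>\<^bsub>K\<^esub> \<beta> v else \<beta> v)"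
    have closed: "\<beta>' v \<in> carrier K" for v
      using \<beta>(1) \<gamma> by (simp add: \<beta>'_def)
    have head: "head \<Gamma> e \<in> C"
      by (simp add: C_def)
    have "\<beta>' (tail \<Gamma> f) \<otimes>\<^bsub>K\<^esub> t f = \<beta>' (head \<Gamma> f)" if "f \<in> insert e S" for f
    proof (cases "f = e")
      case True
      then show ?thesis
        using head \<open>tail \<Gamma> e \<notin> C\<close> \<beta>(1) te by (simp add: \<beta>'_def \<gamma>_def K.m_assoc)
    next
      case False
      then have f: "f \<in> S"
        using that by simp
      then have "(tail \<Gamma> f, head \<Gamma> f) \<in> edge_rel \<Gamma> S" "(head \<Gamma> f, tail \<Gamma> f) \<in> edge_rel \<Gamma> S"
        by (auto simp: edge_rel_def)
      then have "tail \<Gamma> f \<in> C \<longleftrightarrow> head \<Gamma> f \<in> C"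
        unfolding C_def by (auto intro: rtrancl.rtrancl_into_rtrancl)
      moreover have "t f \<in> carrier K"
        using f t insert.prems by blast
      ultimately show ?thesis
        using \<beta> f \<gamma> by (auto simp: \<beta>'_def K.m_assoc)
    qed
    then show ?case
      using closed by blast
  qed
  from this[OF fin order_refl] show ?thesis .
qed

locale tubular_coordinates =
  fixes \<G> :: "('v, 'e, 'a, 'b) graph_of_groups" and T :: "'e set"
    and \<psi> :: "'v \<Rightarrow> 'a \<Rightarrow> int \<times> int" and c :: "'e \<Rightarrow> 'b"
  assumes tub: "tubular \<G>" and tree: "spanning_tree_arcs (base \<G>) T"
    and \<psi>: "v \<in> verts (base \<G>) \<Longrightarrow> \<psi> v \<in> iso (vgroup \<G> v) Z2"
    and c_closed: "e \<in> arcs (base \<G>) \<Longrightarrow> c e \<in> carrier (egroup \<G> e)"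
    and c: "e \<in> arcs (base \<G>) \<Longrightarrow> (\<lambda>m::int. c e [^]\<^bsub>egroup \<G> e\<^esub> m) \<in> iso integer_group (egroup \<G> e)"

lemma tubular_coordinates_exist:
  assumes "tubular \<G>" "spanning_tree_arcs (base \<G>) T"
  shows "\<exists>\<psi> c. tubular_coordinates \<G> T \<psi> c"
proof -
  have "\<exists>\<psi>. \<psi> \<in> iso (vgroup \<G> v) Z2" if "v \<in> verts (base \<G>)" for v
    using assms(1) that by (auto simp: tubular_def is_iso_def)
  then obtain \<psi> where "\<And>v. v \<in> verts (base \<G>) \<Longrightarrow> \<psi> v \<in> iso (vgroup \<G> v) Z2"
    by metis
  moreover have "\<exists>c. c \<in> carrier (egroup \<G> e) \<and> (\<lambda>m::int. c [^]\<^bsub>egroup \<G> e\<^esub> m) \<in> iso integer_group (egroup \<G> e)"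
    if e: "e \<in> arcs (base \<G>)" for e
  proof -
    have E: "group (egroup \<G> e)" and "egroup \<G> e \<cong> integer_group"
      using assms(1) e by (auto simp: tubular_def is_graph_of_groups_def)
    then obtain f where f: "f \<in> iso integer_group (egroup \<G> e)"
      using group.iso_sym is_iso_def by blast
    interpret f: group_hom integer_group "egroup \<G> e" f
      using f E by (simp add: group_hom_def group_hom_axioms_def iso_def)
    have "f m = f 1 [^]\<^bsub>egroup \<G> e\<^esub> m" for m
      using f.hom_int_pow[of 1 m] by simp
    then have "f = (\<lambda>m::int. f 1 [^]\<^bsub>egroup \<G> e\<^esub> m)"
      by (rule ext)
    then show ?thesis
      using f f.hom_closed[of 1] by (intro exI[of _ "f 1"]) simp
  qed
  then obtain c where "\<And>e. e \<in> arcs (base \<G>) \<Longrightarrow> c e \<in> carrier (egroup \<G> e) \<and>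
      (\<lambda>m::int. c e [^]\<^bsub>egroup \<G> e\<^esub> m) \<in> iso integer_group (egroup \<G> e)"
    by metis
  ultimately show ?thesis
    using assms by (intro exI[of _ \<psi>] exI[of _ c]) (unfold_locales, blast+)
qed

context tubular_coordinates
begin

abbreviation "\<Gamma> \<equiv> base \<G>"
abbreviation "P \<equiv> fundamental_group \<G> T"

abbreviation Pmult (infixl \<open>\<cdot>\<close> 70) where "g \<cdot> h \<equiv> g \<otimes>\<^bsub>P\<^esub> h"

definition \<psi>inv :: "'v \<Rightarrow> int \<times> int \<Rightarrow> 'a" where
  "\<psi>inv v = inv_into (carrier (vgroup \<G> v)) (\<psi> v)"

definition xt :: "'e \<Rightarrow> int \<times> int" where
  "xt e = \<psi> (tail \<Gamma> e) (tail_map \<G> e (c e))"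

definition xh :: "'e \<Rightarrow> int \<times> int" where
  "xh e = \<psi> (head \<Gamma> e) (head_map \<G> e (c e))"

definition vx :: "'v \<Rightarrow> int \<times> int \<Rightarrow> ('v, 'a, 'e) gog_gen word set" where
  "vx v a = word_class (gog_gens \<G>) (gog_relators \<G> T) [(Vertex_Elt v (\<psi>inv v a), True)]"

definition st :: "'e \<Rightarrow> ('v, 'a, 'e) gog_gen word set" where
  "st e = word_class (gog_gens \<G>) (gog_relators \<G> T) [(Stable_Letter e, True)]"

lemma wf: "wf_digraph \<Gamma>" and fin_arcs: "finite (arcs \<Gamma>)" and fin_verts: "finite (verts \<Gamma>)"
  and verts_ne: "verts \<Gamma> \<noteq> {}"
  using tub unfolding tubular_def is_graph_of_groups_def fin_digraph_def fin_digraph_axioms_def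
    Digraph_Component.connected_def strongly_connected_def mk_symmetric_def by auto

lemma tail_head_in_verts [simp]:
  "e \<in> arcs \<Gamma> \<Longrightarrow> tail \<Gamma> e \<in> verts \<Gamma>" "e \<in> arcs \<Gamma> \<Longrightarrow> head \<Gamma> e \<in> verts \<Gamma>"
  using wf by (auto simp: wf_digraph_def)

lemma T_arcs: "T \<subseteq> arcs \<Gamma>" and fin_T: "finite T"
  using tree fin_arcs finite_subset by (auto simp: spanning_tree_arcs_def)

lemma vgroup: "v \<in> verts \<Gamma> \<Longrightarrow> group (vgroup \<G> v)"
  using tub by (simp add: tubular_def is_graph_of_groups_def)

lemma group_P: "group P"
  unfolding fundamental_group_def by (rule group_presented_group)

sublocale P: group P
  by (rule group_P)

lemma \<psi>_props:
  assumes "v \<in> verts \<Gamma>"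
  shows "\<psi>inv v a \<in> carrier (vgroup \<G> v)" "\<psi> v (\<psi>inv v a) = a"
    "g \<in> carrier (vgroup \<G> v) \<Longrightarrow> \<psi>inv v (\<psi> v g) = g"
    "g \<in> carrier (vgroup \<G> v) \<Longrightarrow> h \<in> carrier (vgroup \<G> v) \<Longrightarrow>
      \<psi> v (g \<otimes>\<^bsub>vgroup \<G> v\<^esub> h) = \<psi> v g + \<psi> v h"
    "\<psi>inv v (a + b) = \<psi>inv v a \<otimes>\<^bsub>vgroup \<G> v\<^esub> \<psi>inv v b"
proof -
  have bij: "bij_betw (\<psi> v) (carrier (vgroup \<G> v)) UNIV" and hom: "\<psi> v \<in> hom (vgroup \<G> v) Z2"
    using \<psi>[OF assms] by (auto simp: iso_def Z2_def DirProd_def)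
  show 1: "\<psi>inv v a \<in> carrier (vgroup \<G> v)" for a
    using bij unfolding \<psi>inv_def by (metis UNIV_I bij_betw_def inv_into_into)
  show 2: "\<psi> v (\<psi>inv v a) = a" for a
    using bij unfolding \<psi>inv_def by (metis UNIV_I bij_betw_inv_into_right)
  show 3: "\<psi>inv v (\<psi> v g) = g" if "g \<in> carrier (vgroup \<G> v)" for g
    using bij that unfolding \<psi>inv_def by (metis bij_betw_inv_into_left)
  show 4: "\<psi> v (g \<otimes>\<^bsub>vgroup \<G> v\<^esub> h) = \<psi> v g + \<psi> v h"
    if "g \<in> carrier (vgroup \<G> v)" "h \<in> carrier (vgroup \<G> v)" for g h
    using hom_mult[OF hom that] by (cases "\<psi> v g"; cases "\<psi> v h") (simp add: Z2_def)
  interpret group "vgroup \<G> v" by (rule vgroup[OF assms])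
  show "\<psi>inv v (a + b) = \<psi>inv v a \<otimes>\<^bsub>vgroup \<G> v\<^esub> \<psi>inv v b"
    using 3[of "\<psi>inv v a \<otimes>\<^bsub>vgroup \<G> v\<^esub> \<psi>inv v b"] 4[of "\<psi>inv v a" "\<psi>inv v b"] 1 2 by simp
qed

lemma \<psi>_pow:
  assumes v: "v \<in> verts \<Gamma>" and g: "g \<in> carrier (vgroup \<G> v)"
  shows "\<psi> v (g [^]\<^bsub>vgroup \<G> v\<^esub> (m::int)) = smul m (\<psi> v g)"
proof -
  have "\<psi>inv v (smul m (\<psi> v g)) = \<psi>inv v (\<psi> v g) [^]\<^bsub>vgroup \<G> v\<^esub> m"
    using group.additive_smul(3)[OF vgroup[OF v], of "\<psi>inv v"] \<psi>_props(1,5)[OF v] by blast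
  from arg_cong[OF this, of "\<psi> v"] show ?thesis
    using \<psi>_props(2,3)[OF v] g by simp
qed

lemma edge_maps:
  assumes e: "e \<in> arcs \<Gamma>"
  shows "group (egroup \<G> e)"
    "d \<in> carrier (egroup \<G> e) \<Longrightarrow> tail_map \<G> e d \<in> carrier (vgroup \<G> (tail \<Gamma> e))"
    "d \<in> carrier (egroup \<G> e) \<Longrightarrow> head_map \<G> e d \<in> carrier (vgroup \<G> (head \<Gamma> e))"
    "c e [^]\<^bsub>egroup \<G> e\<^esub> (m::int) \<in> carrier (egroup \<G> e)"
    "c e \<in> carrier (egroup \<G> e)"
    "d \<in> carrier (egroup \<G> e) \<Longrightarrow> \<exists>m::int. d = c e [^]\<^bsub>egroup \<G> e\<^esub> m"
    "\<psi> (tail \<Gamma> e) (tail_map \<G> e (c e [^]\<^bsub>egroup \<G> e\<^esub> (m::int))) = smul m (xt e)"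
    "\<psi> (head \<Gamma> e) (head_map \<G> e (c e [^]\<^bsub>egroup \<G> e\<^esub> (m::int))) = smul m (xh e)"
    "xt e \<noteq> 0" "xh e \<noteq> 0"
proof -
  show E: "group (egroup \<G> e)"
    using tub e by (simp add: tubular_def is_graph_of_groups_def)
  interpret E: group "egroup \<G> e" by (rule E)
  let ?\<tau> = "tail_map \<G> e" and ?h = "head_map \<G> e"
  let ?V = "vgroup \<G> (tail \<Gamma> e)" and ?W = "vgroup \<G> (head \<Gamma> e)"
  have \<tau>: "?\<tau> \<in> hom (egroup \<G> e) ?V" "inj_on ?\<tau> (carrier (egroup \<G> e))"
    and h: "?h \<in> hom (egroup \<G> e) ?W" "inj_on ?h (carrier (egroup \<G> e))"
    using tub e by (simp_all add: tubular_def is_graph_of_groups_def)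
  interpret \<tau>: group_hom "egroup \<G> e" ?V ?\<tau>
    using \<tau> E vgroup e by (simp add: group_hom_def group_hom_axioms_def)
  interpret h: group_hom "egroup \<G> e" ?W ?h
    using h E vgroup e by (simp add: group_hom_def group_hom_axioms_def)
  have bij: "bij_betw (\<lambda>m::int. c e [^]\<^bsub>egroup \<G> e\<^esub> m) UNIV (carrier (egroup \<G> e))"
    using c[OF e] by (simp add: iso_def)
  show cm: "c e [^]\<^bsub>egroup \<G> e\<^esub> (m::int) \<in> carrier (egroup \<G> e)" for m
    using bij by (metis UNIV_I bij_betwE)
  show ex: "\<exists>m::int. d = c e [^]\<^bsub>egroup \<G> e\<^esub> m" if "d \<in> carrier (egroup \<G> e)"
    using bij that by (metis bij_betw_imp_surj_on imageE)
  show ce: "c e \<in> carrier (egroup \<G> e)"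
    by (rule c_closed[OF e])
  show "d \<in> carrier (egroup \<G> e) \<Longrightarrow> ?\<tau> d \<in> carrier ?V" "d \<in> carrier (egroup \<G> e) \<Longrightarrow> ?h d \<in> carrier ?W"
    by simp_all
  show x: "\<psi> (tail \<Gamma> e) (?\<tau> (c e [^]\<^bsub>egroup \<G> e\<^esub> (m::int))) = smul m (xt e)"
    "\<psi> (head \<Gamma> e) (?h (c e [^]\<^bsub>egroup \<G> e\<^esub> (m::int))) = smul m (xh e)" for m
    using e ce by (simp_all add: \<tau>.hom_int_pow h.hom_int_pow \<psi>_pow xt_def xh_def)
  have ne: "c e [^]\<^bsub>egroup \<G> e\<^esub> (1::int) \<noteq> c e [^]\<^bsub>egroup \<G> e\<^esub> (0::int)"
    using bij unfolding bij_betw_def inj_on_def by (metis UNIV_I zero_neq_one)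
  have inj\<psi>: "g = g'" if "v \<in> verts \<Gamma>" "g \<in> carrier (vgroup \<G> v)" "g' \<in> carrier (vgroup \<G> v)" "\<psi> v g = \<psi> v g'" for v g g'
    using \<psi>_props(3)[OF that(1)] that by metis
  show "xt e \<noteq> 0"
  proof
    assume "xt e = 0"
    then have "?\<tau> (c e [^]\<^bsub>egroup \<G> e\<^esub> (1::int)) = ?\<tau> (c e [^]\<^bsub>egroup \<G> e\<^esub> (0::int))"
      using x(1)[of 1] x(1)[of 0] e cm by (intro inj\<psi>[of "tail \<Gamma> e"]) simp_all
    then show False
      using \<tau>(2) ne cm by (meson inj_onD)
  qed
  show "xh e \<noteq> 0"
  proof
    assume "xh e = 0"
    then have "?h (c e [^]\<^bsub>egroup \<G> e\<^esub> (1::int)) = ?h (c e [^]\<^bsub>egroup \<G> e\<^esub> (0::int))"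
      using x(2)[of 1] x(2)[of 0] e cm by (intro inj\<psi>[of "head \<Gamma> e"]) simp_all
    then show False
      using h(2) ne cm by (meson inj_onD)
  qed
qed

lemma words_gens:
  "v \<in> verts \<Gamma> \<Longrightarrow> g \<in> carrier (vgroup \<G> v) \<Longrightarrow> Vertex_Elt v g \<in> gog_gens \<G>"
  "e \<in> arcs \<Gamma> \<Longrightarrow> Stable_Letter e \<in> gog_gens \<G>"
  by (auto simp: gog_gens_def)

abbreviation cl :: "('v, 'a, 'e) gog_gen word \<Rightarrow> ('v, 'a, 'e) gog_gen word set" where
  "cl \<equiv> word_class (gog_gens \<G>) (gog_relators \<G> T)"

lemma cl_mult: "u \<in> words (gog_gens \<G>) \<Longrightarrow> w \<in> words (gog_gens \<G>) \<Longrightarrow> cl u \<cdot> cl w = cl (u @ w)"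
  unfolding fundamental_group_def by (rule mult_presented_group)

lemma cl_closed: "w \<in> words (gog_gens \<G>) \<Longrightarrow> cl w \<in> carrier P"
  unfolding fundamental_group_def by (auto simp: carrier_presented_group)

lemma one_P: "\<one>\<^bsub>P\<^esub> = cl []"
  unfolding fundamental_group_def by (rule one_presented_group)

lemma cl_inv:
  assumes "y \<in> gog_gens \<G>"
  shows "cl [(y, False)] = inv\<^bsub>P\<^esub> cl [(y, True)]"
proof -
  have "word_eq (gog_gens \<G>) (gog_relators \<G> T) ([] @ [(y, False), (y, \<not> False)] @ []) ([] @ [])"
    using assms by (intro word_eq.cancel) simp_all
  then have "cl [(y, False)] \<cdot> cl [(y, True)] = \<one>\<^bsub>P\<^esub>"
    using assms by (simp add: cl_mult one_P word_class_eq_iff)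
  then show ?thesis
    using P.inv_equality assms by (metis cl_closed fst_conv words_simps(1,3))
qed

lemma cl_relator:
  assumes "r \<in> gog_relators \<G> T" "r \<in> words (gog_gens \<G>)"
  shows "cl r = \<one>\<^bsub>P\<^esub>"
  using word_eq.relator[of "[]" "gog_gens \<G>" "[]" r "gog_relators \<G> T"] assms
  by (simp add: one_P word_class_eq_iff)

lemma vx_closed [simp]: "v \<in> verts \<Gamma> \<Longrightarrow> vx v a \<in> carrier P"
  unfolding vx_def by (rule cl_closed) (simp add: words_gens \<psi>_props)

lemma st_closed [simp]: "e \<in> arcs \<Gamma> \<Longrightarrow> st e \<in> carrier P"
  unfolding st_def by (rule cl_closed) (simp add: words_gens)

lemma vx_add:
  assumes v: "v \<in> verts \<Gamma>"
  shows "vx v (a + b) = vx v a \<cdot> vx v b"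
proof -
  let ?x = "\<lambda>a. Vertex_Elt v (\<psi>inv v a)"
  have x: "?x a \<in> gog_gens \<G>" for a
    using v by (simp add: words_gens \<psi>_props)
  have "[(?x a, True), (?x b, True), (?x (a + b), False)] \<in> gog_relators \<G> T"
    unfolding gog_relators_def \<psi>_props(5)[OF v] using \<psi>_props(1)[OF v] v by blast
  then have "cl [(?x a, True), (?x b, True), (?x (a + b), False)] = \<one>\<^bsub>P\<^esub>"
    using x by (intro cl_relator) simp_all
  then have "vx v a \<cdot> (vx v b \<cdot> inv\<^bsub>P\<^esub> vx v (a + b)) = \<one>\<^bsub>P\<^esub>"
    using x unfolding vx_def by (simp add: cl_mult flip: cl_inv)
  then have "(vx v a \<cdot> vx v b) \<cdot> inv\<^bsub>P\<^esub> vx v (a + b) = \<one>\<^bsub>P\<^esub>"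
    using v by (simp add: P.m_assoc)
  then show ?thesis
    using v P.inv_solve_right[of "vx v (a + b)" "\<one>\<^bsub>P\<^esub>" "vx v a \<cdot> vx v b"]
    by (metis P.inv_solve_right' P.l_one P.m_closed P.one_closed vx_closed)
qed

lemma
  assumes "v \<in> verts \<Gamma>"
  shows vx_0 [simp]: "vx v 0 = \<one>\<^bsub>P\<^esub>"
    and vx_uminus: "vx v (- a) = inv\<^bsub>P\<^esub> vx v a"
    and vx_smul: "vx v (smul m a) = vx v a [^]\<^bsub>P\<^esub> m"
  using P.additive_smul[of "vx v", OF vx_closed vx_add, OF assms assms] by blast+

lemma st_T: "e \<in> T \<Longrightarrow> st e = \<one>\<^bsub>P\<^esub>"
  unfolding st_def using T_arcs by (intro cl_relator) (auto simp: gog_relators_def words_gens)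

lemma st_vx:
  assumes e: "e \<in> arcs \<Gamma>"
  shows "st e \<cdot> vx (head \<Gamma> e) (smul m (xh e)) = vx (tail \<Gamma> e) (smul m (xt e)) \<cdot> st e"
proof -
  let ?d = "c e [^]\<^bsub>egroup \<G> e\<^esub> m"
  let ?s = "Stable_Letter e" and ?t = "Vertex_Elt (tail \<Gamma> e) (tail_map \<G> e ?d)"
    and ?h = "Vertex_Elt (head \<Gamma> e) (head_map \<G> e ?d)"
  note E = edge_maps[OF e]
  have gens: "?s \<in> gog_gens \<G>" "?t \<in> gog_gens \<G>" "?h \<in> gog_gens \<G>"
    using e E by (simp_all add: words_gens)
  have eq: "vx (tail \<Gamma> e) (smul m (xt e)) = cl [(?t, True)]"
    "vx (head \<Gamma> e) (smul m (xh e)) = cl [(?h, True)]"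
    using e E by (simp_all add: vx_def \<psi>_props flip: E(7,8))
  have "[(?s, True), (?h, True), (?s, False), (?t, False)] \<in> gog_relators \<G> T"
    unfolding gog_relators_def using e E(4) by blast
  then have "cl [(?s, True), (?h, True), (?s, False), (?t, False)] = \<one>\<^bsub>P\<^esub>"
    using gens by (intro cl_relator) simp_all
  then have "st e \<cdot> (cl [(?h, True)] \<cdot> (inv\<^bsub>P\<^esub> st e \<cdot> inv\<^bsub>P\<^esub> cl [(?t, True)])) = \<one>\<^bsub>P\<^esub>"
    using gens unfolding st_def by (simp add: cl_mult flip: cl_inv)
  then have one: "(st e \<cdot> cl [(?h, True)]) \<cdot> inv\<^bsub>P\<^esub> (cl [(?t, True)] \<cdot> st e) = \<one>\<^bsub>P\<^esub>"
    using gens e by (simp add: P.m_assoc P.inv_mult_group cl_closed)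
  have "st e \<cdot> cl [(?h, True)] = cl [(?t, True)] \<cdot> st e"
    using P.inv_equality[OF one] gens e by (simp add: cl_closed)
  then show ?thesis
    by (simp only: eq)
qed

lemma generators_induct [consumes 1, case_names one vx st inv_st]:
  assumes "g \<in> carrier P" and one: "Q \<one>\<^bsub>P\<^esub>"
    and vx: "\<And>v a h. v \<in> verts \<Gamma> \<Longrightarrow> h \<in> carrier P \<Longrightarrow> Q h \<Longrightarrow> Q (vx v a \<cdot> h)"
    and st: "\<And>e h. e \<in> arcs \<Gamma> \<Longrightarrow> h \<in> carrier P \<Longrightarrow> Q h \<Longrightarrow> Q (st e \<cdot> h)"
    and inv_st: "\<And>e h. e \<in> arcs \<Gamma> \<Longrightarrow> h \<in> carrier P \<Longrightarrow> Q h \<Longrightarrow> Q (inv\<^bsub>P\<^esub> st e \<cdot> h)"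
  shows "Q g"
proof -
  have "w \<in> words (gog_gens \<G>) \<Longrightarrow> Q (cl w)" for w
  proof (induction w)
    case Nil
    then show ?case using one by (simp add: one_P)
  next
    case (Cons y w)
    obtain z b where y: "y = (z, b)"
      by (cases y) blast
    have z: "z \<in> gog_gens \<G>" and w: "w \<in> words (gog_gens \<G>)" and Q: "Q (cl w)" and cw: "cl w \<in> carrier P"
      using Cons cl_closed by (auto simp: y)
    have "cl (y # w) = cl [(z, b)] \<cdot> cl w"
      using z w by (simp add: y cl_mult)
    also have "cl [(z, b)] = (if b then cl [(z, True)] else inv\<^bsub>P\<^esub> cl [(z, True)])"
      using cl_inv[OF z] by simp
    finally have eq: "cl (y # w) = (if b then cl [(z, True)] else inv\<^bsub>P\<^esub> cl [(z, True)]) \<cdot> cl w" .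
    show ?case
    proof (cases z)
      case (Vertex_Elt v g)
      then have v: "v \<in> verts \<Gamma>" "g \<in> carrier (vgroup \<G> v)"
        using z by (auto simp: gog_gens_def)
      then have "cl [(z, True)] = vx v (\<psi> v g)"
        by (simp add: vx_def Vertex_Elt \<psi>_props)
      then have "cl (y # w) = vx v (if b then \<psi> v g else - \<psi> v g) \<cdot> cl w"
        using eq v by (simp add: vx_uminus)
      then show ?thesis
        using vx[OF v(1) cw Q] by simp
    next
      case (Stable_Letter e)
      then have "e \<in> arcs \<Gamma>" "cl [(z, True)] = st e"
        using z by (auto simp: gog_gens_def st_def)
      then show ?thesis
        using eq st inv_st cw Q by simp
    qed
  qed
  then show ?thesis
    using assms(1) unfolding fundamental_group_def by (auto simp: carrier_presented_group)
qed

text \<open>Conjugating the data at each vertex by the gauge \<beta> makes the letters of the tree T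
  act trivially. Hence homomorphisms can be built as if every edge had its own stable letter, and
  they are known up to conjugation on each vertex group.\<close>

lemma P_hom_exists:
  fixes K :: "('k, 'm) monoid_scheme"
  assumes K: "group K" and A: "\<And>v a. v \<in> verts \<Gamma> \<Longrightarrow> A v a \<in> carrier K"
    and A_add: "\<And>v a b. v \<in> verts \<Gamma> \<Longrightarrow> A v (a + b) = A v a \<otimes>\<^bsub>K\<^esub> A v b"
    and t: "\<And>e. e \<in> arcs \<Gamma> \<Longrightarrow> t e \<in> carrier K"
    and tA: "\<And>e. e \<in> arcs \<Gamma> \<Longrightarrow> t e \<otimes>\<^bsub>K\<^esub> A (head \<Gamma> e) (xh e) = A (tail \<Gamma> e) (xt e) \<otimes>\<^bsub>K\<^esub> t e"
  shows "\<exists>\<rho>\<in>hom P K. \<exists>\<beta>. (\<forall>v. \<beta> v \<in> carrier K) \<and>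
    (\<forall>v\<in>verts \<Gamma>. \<forall>a. \<rho> (vx v a) = \<beta> v \<otimes>\<^bsub>K\<^esub> A v a \<otimes>\<^bsub>K\<^esub> inv\<^bsub>K\<^esub> \<beta> v) \<and>
    (\<forall>e\<in>arcs \<Gamma>. \<rho> (st e) = \<beta> (tail \<Gamma> e) \<otimes>\<^bsub>K\<^esub> t e \<otimes>\<^bsub>K\<^esub> inv\<^bsub>K\<^esub> \<beta> (head \<Gamma> e))"
proof -
  interpret K: group K by fact
  have "\<exists>\<beta>. (\<forall>v. \<beta> v \<in> carrier K) \<and> (\<forall>e\<in>T. \<beta> (tail \<Gamma> e) \<otimes>\<^bsub>K\<^esub> t e = \<beta> (head \<Gamma> e))"
    using T_arcs t by (intro spanning_tree_gauge[OF wf tree fin_T K]) blast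
  then obtain \<beta> where \<beta>: "\<And>v. \<beta> v \<in> carrier K"
    "\<And>e. e \<in> T \<Longrightarrow> \<beta> (tail \<Gamma> e) \<otimes>\<^bsub>K\<^esub> t e = \<beta> (head \<Gamma> e)"
    by blast
  define f where "f = (\<lambda>y. case y of
      Vertex_Elt v g \<Rightarrow> \<beta> v \<otimes>\<^bsub>K\<^esub> A v (\<psi> v g) \<otimes>\<^bsub>K\<^esub> inv\<^bsub>K\<^esub> \<beta> v
    | Stable_Letter e \<Rightarrow> \<beta> (tail \<Gamma> e) \<otimes>\<^bsub>K\<^esub> t e \<otimes>\<^bsub>K\<^esub> inv\<^bsub>K\<^esub> \<beta> (head \<Gamma> e))"
  have f_closed: "f \<in> gog_gens \<G> \<rightarrow> carrier K"
  proof
    fix y assume y: "y \<in> gog_gens \<G>"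
    show "f y \<in> carrier K"
    proof (cases y)
      case (Vertex_Elt v g)
      then have "v \<in> verts \<Gamma>"
        using y by (auto simp: gog_gens_def)
      from A[OF this] show ?thesis
        using \<beta>(1) by (simp add: f_def Vertex_Elt)
    next
      case (Stable_Letter e)
      then have "e \<in> arcs \<Gamma>"
        using y by (auto simp: gog_gens_def)
      from t[OF this] show ?thesis
        using \<beta>(1) by (simp add: f_def Stable_Letter)
    qed
  qed
  have A_smul: "A v (smul m a) = A v a [^]\<^bsub>K\<^esub> m" if "v \<in> verts \<Gamma>" for v m a
    by (rule K.additive_smul(3)[of "A v", OF A[OF that] A_add[OF that]])
  have relators: "eval_word K f r = \<one>\<^bsub>K\<^esub>" if r: "r \<in> gog_relators \<G> T" for r
  proof -
    consider (vertex) v g h where "v \<in> verts \<Gamma>" "g \<in> carrier (vgroup \<G> v)" "h \<in> carrier (vgroup \<G> v)"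
        "r = [(Vertex_Elt v g, True), (Vertex_Elt v h, True), (Vertex_Elt v (g \<otimes>\<^bsub>vgroup \<G> v\<^esub> h), False)]"
      | (edge) e d where "e \<in> arcs \<Gamma>" "d \<in> carrier (egroup \<G> e)"
        "r = [(Stable_Letter e, True), (Vertex_Elt (head \<Gamma> e) (head_map \<G> e d), True),
              (Stable_Letter e, False), (Vertex_Elt (tail \<Gamma> e) (tail_map \<G> e d), False)]"
      | (tree) e where "e \<in> T" "r = [(Stable_Letter e, True)]"
      using r unfolding gog_relators_def by blast
    then show ?thesis
    proof cases
      case vertex
      define a b k where "a = A v (\<psi> v g)" "b = A v (\<psi> v h)" "k = \<beta> v"
      have abk: "a \<in> carrier K" "b \<in> carrier K" "k \<in> carrier K"
        using A \<beta>(1) vertex(1) by (simp_all add: a_b_k_def)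
      have "f (Vertex_Elt v (g \<otimes>\<^bsub>vgroup \<G> v\<^esub> h)) = k \<otimes>\<^bsub>K\<^esub> (a \<otimes>\<^bsub>K\<^esub> b) \<otimes>\<^bsub>K\<^esub> inv\<^bsub>K\<^esub> k"
        using vertex by (simp add: f_def a_b_k_def \<psi>_props A_add)
      also have "\<dots> = k \<otimes>\<^bsub>K\<^esub> a \<otimes>\<^bsub>K\<^esub> (inv\<^bsub>K\<^esub> k \<otimes>\<^bsub>K\<^esub> k) \<otimes>\<^bsub>K\<^esub> b \<otimes>\<^bsub>K\<^esub> inv\<^bsub>K\<^esub> k"
        using abk by (simp add: K.m_assoc)
      also have "\<dots> = f (Vertex_Elt v g) \<otimes>\<^bsub>K\<^esub> f (Vertex_Elt v h)"
        using abk by (simp only: f_def gog_gen.case a_b_k_def[symmetric] K.m_assoc K.m_closed K.inv_closed)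
      finally have "f (Vertex_Elt v (g \<otimes>\<^bsub>vgroup \<G> v\<^esub> h)) = f (Vertex_Elt v g) \<otimes>\<^bsub>K\<^esub> f (Vertex_Elt v h)" .
      moreover have "f (Vertex_Elt v g) \<in> carrier K" "f (Vertex_Elt v h) \<in> carrier K"
        using f_closed vertex words_gens by blast+
      ultimately show ?thesis
        by (simp add: vertex K.m_assoc[symmetric])
    next
      case edge
      \<comment> \<open>The relation is assumed for the generator \<open>c e\<close>; for its powers
        it follows because conjugation commutes with powers.\<close>
      obtain m :: int where d: "d = c e [^]\<^bsub>egroup \<G> e\<^esub> m"
        using edge_maps(6)[OF edge(1,2)] by blast
      define a b k l s where "a = A (tail \<Gamma> e) (xt e)" "b = A (head \<Gamma> e) (xh e)"
        "k = \<beta> (tail \<Gamma> e)" "l = \<beta> (head \<Gamma> e)" "s = t e"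
      note defs = a_b_k_l_s_def
      have cl: "a \<in> carrier K" "b \<in> carrier K" "k \<in> carrier K" "l \<in> carrier K" "s \<in> carrier K"
        using A \<beta>(1) t edge(1) by (simp_all add: defs)
      have fs: "f (Stable_Letter e) = k \<otimes>\<^bsub>K\<^esub> s \<otimes>\<^bsub>K\<^esub> inv\<^bsub>K\<^esub> l"
        by (simp add: f_def defs)
      have fh: "f (Vertex_Elt (head \<Gamma> e) (head_map \<G> e d)) = l \<otimes>\<^bsub>K\<^esub> b [^]\<^bsub>K\<^esub> m \<otimes>\<^bsub>K\<^esub> inv\<^bsub>K\<^esub> l"
        using edge(1) edge_maps(8)[OF edge(1), of m] by (simp add: f_def d defs A_smul)
      have ft: "f (Vertex_Elt (tail \<Gamma> e) (tail_map \<G> e d)) = k \<otimes>\<^bsub>K\<^esub> a [^]\<^bsub>K\<^esub> m \<otimes>\<^bsub>K\<^esub> inv\<^bsub>K\<^esub> k"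
        using edge(1) edge_maps(7)[OF edge(1), of m] by (simp add: f_def d defs A_smul)
      have "a = s \<otimes>\<^bsub>K\<^esub> b \<otimes>\<^bsub>K\<^esub> inv\<^bsub>K\<^esub> s"
        using tA[OF edge(1)] cl by (simp add: defs K.inv_solve_right)
      then have am: "a [^]\<^bsub>K\<^esub> m = s \<otimes>\<^bsub>K\<^esub> b [^]\<^bsub>K\<^esub> m \<otimes>\<^bsub>K\<^esub> inv\<^bsub>K\<^esub> s"
        using K.pow_conj(2)[OF cl(5,2)] by simp
      define B where "B = b [^]\<^bsub>K\<^esub> m"
      have B: "B \<in> carrier K"
        using cl by (simp add: B_def)
      let ?u = "k \<otimes>\<^bsub>K\<^esub> s \<otimes>\<^bsub>K\<^esub> inv\<^bsub>K\<^esub> l" and ?w = "l \<otimes>\<^bsub>K\<^esub> B \<otimes>\<^bsub>K\<^esub> inv\<^bsub>K\<^esub> l"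
      have "?u \<otimes>\<^bsub>K\<^esub> ?w \<otimes>\<^bsub>K\<^esub> inv\<^bsub>K\<^esub> ?u
          = k \<otimes>\<^bsub>K\<^esub> s \<otimes>\<^bsub>K\<^esub> (inv\<^bsub>K\<^esub> l \<otimes>\<^bsub>K\<^esub> l) \<otimes>\<^bsub>K\<^esub> B \<otimes>\<^bsub>K\<^esub> (inv\<^bsub>K\<^esub> l \<otimes>\<^bsub>K\<^esub> l) \<otimes>\<^bsub>K\<^esub> inv\<^bsub>K\<^esub> s \<otimes>\<^bsub>K\<^esub> inv\<^bsub>K\<^esub> k"
        using cl B by (simp only: K.inv_mult_group K.inv_inv K.m_assoc K.m_closed K.inv_closed)
      also have "\<dots> = k \<otimes>\<^bsub>K\<^esub> (s \<otimes>\<^bsub>K\<^esub> B \<otimes>\<^bsub>K\<^esub> inv\<^bsub>K\<^esub> s) \<otimes>\<^bsub>K\<^esub> inv\<^bsub>K\<^esub> k"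
        using cl B by (simp add: K.m_assoc)
      finally have conj: "?u \<otimes>\<^bsub>K\<^esub> ?w \<otimes>\<^bsub>K\<^esub> inv\<^bsub>K\<^esub> ?u = f (Vertex_Elt (tail \<Gamma> e) (tail_map \<G> e d))"
        by (simp only: ft am B_def)
      define u w z where "u = ?u" "w = ?w" "z = f (Vertex_Elt (tail \<Gamma> e) (tail_map \<G> e d))"
      have cu: "u \<in> carrier K" "w \<in> carrier K"
        using cl B by (simp_all add: u_w_z_def)
      have z: "u \<otimes>\<^bsub>K\<^esub> w \<otimes>\<^bsub>K\<^esub> inv\<^bsub>K\<^esub> u = z"
        unfolding u_w_z_def by (rule conj)
      then have cz: "z \<in> carrier K"
        using cu by auto
      have "eval_word K f r = u \<otimes>\<^bsub>K\<^esub> (w \<otimes>\<^bsub>K\<^esub> (inv\<^bsub>K\<^esub> u \<otimes>\<^bsub>K\<^esub> (inv\<^bsub>K\<^esub> z \<otimes>\<^bsub>K\<^esub> \<one>\<^bsub>K\<^esub>)))"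
        by (simp only: edge eval_word.simps fst_conv snd_conv if_True if_False fs fh B_def[symmetric] u_w_z_def)
      also have "\<dots> = z \<otimes>\<^bsub>K\<^esub> inv\<^bsub>K\<^esub> z"
        using cu cz unfolding z[symmetric] by (simp only: K.m_assoc K.m_closed K.inv_closed K.r_one)
      finally show ?thesis
        using cz by simp
    next
      case tree
      have "t e \<in> carrier K"
        using tree T_arcs t by blast
      then show ?thesis
        using \<beta>(1) \<beta>(2)[OF tree(1)] by (simp add: tree f_def)
    qed
  qed
  obtain \<rho> where \<rho>: "\<rho> \<in> hom P K" "\<And>w. w \<in> words (gog_gens \<G>) \<Longrightarrow> \<rho> (cl w) = eval_word K f w"
    using K.presented_group_hom[OF f_closed relators] unfolding fundamental_group_def by blast
  have "\<rho> (vx v a) = \<beta> v \<otimes>\<^bsub>K\<^esub> A v a \<otimes>\<^bsub>K\<^esub> inv\<^bsub>K\<^esub> \<beta> v" if v: "v \<in> verts \<Gamma>" for v a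
    using v \<rho>(2)[of "[(Vertex_Elt v (\<psi>inv v a), True)]"] A[OF v] \<beta>(1)
    by (simp add: vx_def words_gens \<psi>_props f_def)
  moreover have "\<rho> (st e) = \<beta> (tail \<Gamma> e) \<otimes>\<^bsub>K\<^esub> t e \<otimes>\<^bsub>K\<^esub> inv\<^bsub>K\<^esub> \<beta> (head \<Gamma> e)" if e: "e \<in> arcs \<Gamma>" for e
    using e \<rho>(2)[of "[(Stable_Letter e, True)]"] t[OF e] \<beta>(1)
    by (simp add: st_def words_gens f_def)
  ultimately show ?thesis
    using \<rho>(1) \<beta>(1) by blast
qed

section \<open>Paths and conjugacy classes\<close>

definition src :: "'e \<times> bool \<Rightarrow> 'v" where
  "src y = (if snd y then tail \<Gamma> (fst y) else head \<Gamma> (fst y))"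

definition stl :: "'e \<times> bool \<Rightarrow> ('v, 'a, 'e) gog_gen word set" where
  "stl y = (if snd y then st (fst y) else inv\<^bsub>P\<^esub> st (fst y))"

definition xx :: "'e \<times> bool \<Rightarrow> int \<times> int" where
  "xx y = (if snd y then xt (fst y) else xh (fst y))"

lemma src_in_verts [simp]: "fst y \<in> arcs \<Gamma> \<Longrightarrow> src y \<in> verts \<Gamma>"
  by (simp add: src_def)

lemma stl_closed [simp]: "fst y \<in> arcs \<Gamma> \<Longrightarrow> stl y \<in> carrier P"
  by (simp add: stl_def)

lemma xx_nonzero: "fst y \<in> arcs \<Gamma> \<Longrightarrow> xx y \<noteq> 0"
  by (simp add: xx_def edge_maps)

lemma stl_flip: "fst y \<in> arcs \<Gamma> \<Longrightarrow> stl (flip_letter y) = inv\<^bsub>P\<^esub> stl y"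
  by (simp add: stl_def flip_letter_def)

lemma stl_vx:
  assumes y: "fst y \<in> arcs \<Gamma>"
  shows "stl y \<cdot> vx (src (flip_letter y)) (smul m (xx (flip_letter y)))
    = vx (src y) (smul m (xx y)) \<cdot> stl y"
proof (cases "snd y")
  case True
  then show ?thesis
    using st_vx[OF y] by (simp add: stl_def src_def xx_def flip_letter_def)
next
  case False
  define s h t where "s = st (fst y)" "h = vx (head \<Gamma> (fst y)) (smul m (xh (fst y)))"
    "t = vx (tail \<Gamma> (fst y)) (smul m (xt (fst y)))"
  have c: "s \<in> carrier P" "h \<in> carrier P" "t \<in> carrier P" "s \<cdot> h = t \<cdot> s"
    using y st_vx[OF y] by (simp_all add: s_h_t_def)
  have "inv\<^bsub>P\<^esub> s \<cdot> t = inv\<^bsub>P\<^esub> s \<cdot> (t \<cdot> s) \<cdot> inv\<^bsub>P\<^esub> s"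
    using c(1-3) by (simp add: P.m_assoc)
  also have "\<dots> = (inv\<^bsub>P\<^esub> s \<cdot> s) \<cdot> h \<cdot> inv\<^bsub>P\<^esub> s"
    using c(1-3) by (simp only: c(4)[symmetric] P.m_assoc P.m_closed P.inv_closed)
  also have "\<dots> = h \<cdot> inv\<^bsub>P\<^esub> s"
    using c by simp
  finally show ?thesis
    using False by (simp add: stl_def src_def xx_def flip_letter_def s_h_t_def)
qed

fun path :: "'v \<Rightarrow> ((int \<times> int) \<times> 'e \<times> bool) list \<Rightarrow> 'v \<Rightarrow> bool" where
  "path v [] w \<longleftrightarrow> v = w \<and> v \<in> verts \<Gamma>"
| "path v ((a, y) # l) w \<longleftrightarrow> fst y \<in> arcs \<Gamma> \<and> src y = v \<and> path (src (flip_letter y)) l w"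

fun pval :: "((int \<times> int) \<times> 'e \<times> bool) list \<Rightarrow> ('v, 'a, 'e) gog_gen word set" where
  "pval [] = \<one>\<^bsub>P\<^esub>"
| "pval ((a, y) # l) = vx (src y) a \<cdot> (stl y \<cdot> pval l)"

lemma path_verts: "path v l w \<Longrightarrow> v \<in> verts \<Gamma> \<and> w \<in> verts \<Gamma>"
  by (induction v l w rule: path.induct) auto

lemma path_arcs: "path v l w \<Longrightarrow> z \<in> set l \<Longrightarrow> fst (snd z) \<in> arcs \<Gamma>"
  by (induction v l w rule: path.induct) auto

lemma path_append: "path v (l @ l') w \<longleftrightarrow> (\<exists>u. path v l u \<and> path u l' w)"
  by (induction l arbitrary: v) (auto dest: path_verts)

lemma pval_closed [simp]: "path v l w \<Longrightarrow> pval l \<in> carrier P"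
  by (induction v l w rule: path.induct) auto

lemma pval_append: "path v l u \<Longrightarrow> path u l' w \<Longrightarrow> pval (l @ l') = pval l \<cdot> pval l'"
  by (induction v l u rule: path.induct) (auto simp: P.m_assoc)

lemma vx_pval:
  assumes "path v ((b, y) # l) w"
  shows "vx v a \<cdot> pval ((b, y) # l) = pval ((a + b, y) # l)"
  using assms by (auto simp: vx_add P.m_assoc)

definition reps :: "'v \<Rightarrow> 'v \<Rightarrow> ('v, 'a, 'e) gog_gen word set \<Rightarrow> bool" where
  "reps v w g \<longleftrightarrow> (\<exists>l a. path v l w \<and> g = pval l \<cdot> vx w a)"

lemma reps_vx: "v \<in> verts \<Gamma> \<Longrightarrow> reps v v (vx v a)"
  unfolding reps_def by (intro exI[of _ "[]"] exI[of _ a]) simp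

lemma reps_stl:
  assumes "fst y \<in> arcs \<Gamma>"
  shows "reps (src y) (src (flip_letter y)) (stl y)"
  unfolding reps_def using assms by (intro exI[of _ "[(0, y)]"] exI[of _ 0]) simp

lemma reps_mult:
  assumes "reps u v g" "reps v w h"
  shows "reps u w (g \<cdot> h)"
proof -
  obtain l a where g: "path u l v" "g = pval l \<cdot> vx v a"
    using assms(1) by (auto simp: reps_def)
  obtain l' b where h: "path v l' w" "h = pval l' \<cdot> vx w b"
    using assms(2) by (auto simp: reps_def)
  have vw: "v \<in> verts \<Gamma>" "w \<in> verts \<Gamma>"
    using path_verts[OF h(1)] by simp_all
  show ?thesis
  proof (cases l')
    case Nil
    then have "g \<cdot> h = pval l \<cdot> vx w (a + b)"
      using g h vw by (simp add: vx_add P.m_assoc)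
    moreover have "path u l w"
      using g(1) h(1) Nil by simp
    ultimately show ?thesis
      unfolding reps_def by blast
  next
    case (Cons z r)
    obtain d y where z: "z = (d, y)"
      by (cases z) blast
    let ?l = "(a + d, y) # r"
    have p: "path v ?l w"
      using h(1) by (simp add: Cons z)
    have "g \<cdot> h = pval l \<cdot> (vx v a \<cdot> pval l') \<cdot> vx w b"
      using g h vw by (simp add: P.m_assoc)
    also have "vx v a \<cdot> pval l' = pval ?l"
      using vx_pval[of v d y r w a] h(1) by (simp add: Cons z)
    also have "pval l \<cdot> pval ?l = pval (l @ ?l)"
      using pval_append[OF g(1) p] by simp
    finally have "g \<cdot> h = pval (l @ ?l) \<cdot> vx w b" .
    moreover have "path u (l @ ?l) w"
      using g(1) p path_append by blast
    ultimately show ?thesis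
      unfolding reps_def by blast
  qed
qed

text \<open>A path in the spanning tree with trivial vertex elements has value 1; such paths connect
  any two vertices without changing the element.\<close>

lemma reps_one:
  assumes "v \<in> verts \<Gamma>" "w \<in> verts \<Gamma>"
  shows "reps v w \<one>\<^bsub>P\<^esub>"
proof -
  have "(v, w) \<in> (edge_rel \<Gamma> T)\<^sup>*"
    using tree connected_iff_edge_rel[OF wf T_arcs] assms by (auto simp: spanning_tree_arcs_def)
  then show ?thesis
  proof (induction rule: rtrancl_induct)
    case base
    then show ?case
      using reps_vx[OF assms(1), of 0] assms by simp
  next
    case (step u w)
    then obtain e where e: "e \<in> T" "(u = tail \<Gamma> e \<and> w = head \<Gamma> e) \<or> (u = head \<Gamma> e \<and> w = tail \<Gamma> e)"
      by (auto simp: edge_rel_def)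
    define b where "b \<longleftrightarrow> u = tail \<Gamma> e \<and> w = head \<Gamma> e"
    have "u = src (e, b)" "w = src (flip_letter (e, b))"
      using e(2) by (auto simp: b_def src_def flip_letter_def)
    then have "reps u w \<one>\<^bsub>P\<^esub>"
      using reps_stl[of "(e, b)"] T_arcs e(1) st_T[OF e(1)] by (cases b) (auto simp: stl_def)
    then show ?case
      using reps_mult[OF step.IH, of w "\<one>\<^bsub>P\<^esub>"] by simp
  qed
qed

text \<open>Each generator is the value of a path with fixed ends, and detours through the spanning
  tree close it up to a loop at v.\<close>

lemma reps_all:
  assumes v: "v \<in> verts \<Gamma>" and g: "g \<in> carrier P"
  shows "reps v v g"
proof -
  have insert: "reps v v (k \<cdot> h)"
    if "reps u w k" "u \<in> verts \<Gamma>" "w \<in> verts \<Gamma>" "k \<in> carrier P" "h \<in> carrier P" "reps v v h" for u w k h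
    using reps_mult[OF reps_mult[OF reps_one[OF v that(2)] that(1)] reps_mult[OF reps_one[OF that(3) v] that(6)]]
      that(4,5) by simp
  show ?thesis
    using g
  proof (induction rule: generators_induct)
    case one
    then show ?case by (rule reps_one[OF v v])
  next
    case (vx u a h)
    then show ?case by (intro insert[OF reps_vx]) auto
  next
    case (st e h)
    then show ?case
      using insert[OF reps_stl[of "(e, True)"], of h] by (simp add: stl_def)
  next
    case (inv_st e h)
    then show ?case
      using insert[OF reps_stl[of "(e, False)"], of h] by (simp add: stl_def)
  qed
qed

text \<open>The same condition as \<open>R.no_backtrack\<close> below, before the edges are renamed
  as letters of a rose.\<close>

definition no_turn :: "(int \<times> int) \<times> 'e \<times> bool \<Rightarrow> (int \<times> int) \<times> 'e \<times> bool \<Rightarrow> bool" where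
  "no_turn y z \<longleftrightarrow> \<not> (snd z = flip_letter (snd y) \<and> (\<exists>m. fst z = smul m (xx (snd z))))"

text \<open>The violating pair may straddle the seam between the two copies of l. Rotating l, which
  conjugates the corresponding loop, moves it to the front. Reflexivity of Q excludes lists of
  length 1, where a letter would follow itself.\<close>

lemma not_successively_rotate:
  assumes "\<not> successively Q (l @ l)" "l \<noteq> []" "\<And>y. Q y y"
  shows "\<exists>p q y z r. l = p @ q \<and> q @ p = y # z # r \<and> \<not> Q y z"
proof -
  let ?n = "length l"
  obtain i where i: "Suc i < length (l @ l)" "\<not> Q ((l @ l) ! i) ((l @ l) ! Suc i)"
    using assms(1) unfolding successively_conv_nth by blast
  define j where "j = i mod ?n"
  have n: "?n > 0"
    using assms(2) by simp
  have nth: "(l @ l) ! k = l ! (k mod ?n)" if "k < length (l @ l)" for k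
    using that le_mod_geq[of ?n k] by (simp add: nth_append)
  have "?n \<noteq> 1"
  proof
    assume "?n = 1"
    then have "(l @ l) ! i = (l @ l) ! Suc i"
      using i(1) nth[of i] nth[of "Suc i"] by simp
    then show False
      using i(2) assms(3) by simp
  qed
  then have len: "2 \<le> ?n"
    using n by linarith
  have rot: "rotate j l ! 0 = l ! j" "rotate j l ! 1 = l ! (Suc i mod ?n)"
    using len n by (simp_all add: nth_rotate j_def mod_simps)
  have "Suc (Suc 0) \<le> length (rotate j l)"
    using len by simp
  then obtain y z r where yz: "rotate j l = y # z # r"
    unfolding Suc_le_length_iff by blast
  moreover have "rotate j l = drop j l @ take j l"
    using n by (simp add: rotate_drop_take j_def)
  moreover have "(l @ l) ! i = y" "(l @ l) ! Suc i = z"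
    using i(1) nth[of i] nth[of "Suc i"] rot yz by (simp_all add: j_def)
  ultimately show ?thesis
    using i(2) by (intro exI[of _ "take j l"] exI[of _ "drop j l"] exI[of _ y] exI[of _ z] exI[of _ r]) simp
qed

definition conj_reduced :: "('v, 'a, 'e) gog_gen word set \<Rightarrow> bool" where
  "conj_reduced g \<longleftrightarrow> (\<exists>k\<in>carrier P. \<exists>v\<in>verts \<Gamma>.
     (\<exists>a. g = k \<cdot> vx v a \<cdot> inv\<^bsub>P\<^esub> k) \<or>
     (\<exists>l. l \<noteq> [] \<and> path v l v \<and> successively no_turn (l @ l) \<and>
        g = k \<cdot> pval l \<cdot> inv\<^bsub>P\<^esub> k))"

lemma conj_reduced_conj:
  assumes "conj_reduced g" "h \<in> carrier P"
  shows "conj_reduced (h \<cdot> g \<cdot> inv\<^bsub>P\<^esub> h)"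
proof -
  have eq: "h \<cdot> (k \<cdot> x \<cdot> inv\<^bsub>P\<^esub> k) \<cdot> inv\<^bsub>P\<^esub> h
      = (h \<cdot> k) \<cdot> x \<cdot> inv\<^bsub>P\<^esub> (h \<cdot> k)"
    if "k \<in> carrier P" "x \<in> carrier P" for k x
    using that assms(2) by (simp add: P.m_assoc P.inv_mult_group)
  from assms(1) obtain k v where kv: "k \<in> carrier P" "v \<in> verts \<Gamma>" and
    cases: "(\<exists>a. g = k \<cdot> vx v a \<cdot> inv\<^bsub>P\<^esub> k) \<or>
      (\<exists>l. l \<noteq> [] \<and> path v l v \<and> successively no_turn (l @ l) \<and> g = k \<cdot> pval l \<cdot> inv\<^bsub>P\<^esub> k)"
    unfolding conj_reduced_def by blast
  have hk: "h \<cdot> k \<in> carrier P"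
    using kv assms(2) by simp
  from cases show ?thesis
  proof
    assume "\<exists>a. g = k \<cdot> vx v a \<cdot> inv\<^bsub>P\<^esub> k"
    then obtain a where "h \<cdot> g \<cdot> inv\<^bsub>P\<^esub> h = (h \<cdot> k) \<cdot> vx v a \<cdot> inv\<^bsub>P\<^esub> (h \<cdot> k)"
      using eq[OF kv(1) vx_closed[OF kv(2)]] by blast
    then show ?thesis
      using hk kv(2) unfolding conj_reduced_def by blast
  next
    assume "\<exists>l. l \<noteq> [] \<and> path v l v \<and> successively no_turn (l @ l) \<and> g = k \<cdot> pval l \<cdot> inv\<^bsub>P\<^esub> k"
    then obtain l where l: "l \<noteq> []" "path v l v" "successively no_turn (l @ l)"
      "h \<cdot> g \<cdot> inv\<^bsub>P\<^esub> h = (h \<cdot> k) \<cdot> pval l \<cdot> inv\<^bsub>P\<^esub> (h \<cdot> k)"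
      using eq[OF kv(1) pval_closed] by blast
    then show ?thesis
      using hk kv(2) unfolding conj_reduced_def by blast
  qed
qed

lemma conj_reduced_vx: "v \<in> verts \<Gamma> \<Longrightarrow> conj_reduced (vx v a)"
  unfolding conj_reduced_def by (intro bexI[of _ "\<one>\<^bsub>P\<^esub>"] bexI[of _ v] disjI1 exI[of _ a]) simp_all

text \<open>A turn that has been rotated to the front equals an element of the vertex group, which
  merges into the next vertex element; the loop gets shorter by two letters.\<close>

lemma conj_reduced_pval:
  assumes "path v l v"
  shows "conj_reduced (pval l)"
  using assms
proof (induction "length l" arbitrary: v l rule: less_induct)
  case less
  show ?case
  proof (cases "l = []")
    case True
    then show ?thesis
      using less.prems conj_reduced_vx[of v 0] by simp
  next
    case ne: False
    show ?thesis
    proof (cases "successively no_turn (l @ l)")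
      case True
      then show ?thesis
        using ne less.prems path_verts[OF less.prems] unfolding conj_reduced_def
        by (intro bexI[of _ "\<one>\<^bsub>P\<^esub>"] bexI[of _ v] disjI2 exI[of _ l]) simp_all
    next
      case False
      have "\<exists>p q y z r. l = p @ q \<and> q @ p = y # z # r \<and> \<not> no_turn y z"
        using ne by (intro not_successively_rotate[OF False]) (auto simp: no_turn_def)
      then obtain p q y z r where l: "l = p @ q" "q @ p = y # z # r" "\<not> no_turn y z"
        by blast
      obtain a e where y: "y = (a, e)"
        by (cases y) blast
      obtain m where z: "z = (smul m (xx (flip_letter e)), flip_letter e)"
        using l(3) y by (cases z) (auto simp: no_turn_def)
      obtain u where u: "path v p u" "path u q v"
        using less.prems unfolding l(1) path_append by blast
      have "path u (q @ p) u"
        using u path_append by blast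
      then have e: "fst e \<in> arcs \<Gamma>" "src e = u" and r: "path u r u"
        by (auto simp: l(2) y z)
      let ?s = "stl e" and ?b = "a + smul m (xx e)"
      have "pval (q @ p) = vx u a \<cdot> ((?s \<cdot> vx (src (flip_letter e)) (smul m (xx (flip_letter e))))
          \<cdot> (inv\<^bsub>P\<^esub> ?s \<cdot> pval r))"
        using e r by (simp add: l(2) y z stl_flip P.m_assoc)
      also have "\<dots> = vx u ?b \<cdot> pval r"
        using e r path_verts[OF r] by (simp add: stl_vx vx_add P.m_assoc)
          (simp add: P.m_assoc[symmetric])
      finally have eq: "pval (q @ p) = vx u ?b \<cdot> pval r" .
      have qp: "conj_reduced (pval (q @ p))"
      proof (cases r)
        case Nil
        then show ?thesis
          using eq conj_reduced_vx[of u ?b] path_verts[OF r] by simp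
      next
        case (Cons w r')
        obtain d f where w: "w = (d, f)"
          by (cases w) blast
        have "pval (q @ p) = pval ((?b + d, f) # r')"
          using eq vx_pval[of u d f r' u ?b] r by (simp add: Cons w)
        moreover have "length ((?b + d, f) # r') < length l"
          using arg_cong[OF l(2), of length] by (simp add: l(1) Cons)
        moreover have "path u ((?b + d, f) # r') u"
          using r by (simp add: Cons w)
        ultimately show ?thesis
          using less.hyps by metis
      qed
      have "pval l = pval p \<cdot> pval (q @ p) \<cdot> inv\<^bsub>P\<^esub> pval p"
        unfolding l(1) pval_append[OF u] pval_append[OF u(2,1)]
        using pval_closed[OF u(1)] pval_closed[OF u(2)] by (simp add: P.m_assoc)
      then show ?thesis
        using conj_reduced_conj[OF qp pval_closed[OF u(1)]] by simp
    qed
  qed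
qed

lemma conj_reduced_all:
  assumes "g \<in> carrier P"
  shows "conj_reduced g"
proof -
  obtain v where v: "v \<in> verts \<Gamma>"
    using verts_ne by blast
  obtain l a where l: "path v l v" "g = pval l \<cdot> vx v a"
    using reps_all[OF v assms] by (auto simp: reps_def)
  show ?thesis
  proof (cases l)
    case Nil
    then show ?thesis
      using l conj_reduced_vx[OF v] v by simp
  next
    case (Cons z r)
    obtain b y where z: "z = (b, y)"
      by (cases z) blast
    \<comment> \<open>The trailing vertex element a is brought to the front of the loop by a
      conjugation.\<close>
    have p: "path v ((a + b, y) # r) v"
      using l(1) by (simp add: Cons z)
    have "inv\<^bsub>P\<^esub> vx v a \<cdot> pval ((a + b, y) # r) \<cdot> inv\<^bsub>P\<^esub> (inv\<^bsub>P\<^esub> vx v a)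
        = inv\<^bsub>P\<^esub> vx v a \<cdot> (vx v a \<cdot> pval l) \<cdot> vx v a"
      using vx_pval[of v b y r v a] l(1) v by (simp add: Cons z)
    also have "\<dots> = g"
      using l v pval_closed[OF l(1)] by (simp add: P.m_assoc[symmetric])
    finally show ?thesis
      using conj_reduced_conj[OF conj_reduced_pval[OF p], of "inv\<^bsub>P\<^esub> vx v a"] v by simp
  qed
qed

end

section \<open>The kernel of a free by cyclic group\<close>

text \<open>The projection is the second coordinate. On its kernel the first coordinate is an
  injective homomorphism to the free group, since only the zeroth power of \<alpha> enters the
  product there, and \<open>cyclic_roots\<close> is pulled back along it.\<close>

lemma free_by_Z_projection:
  fixes G :: "'g monoid"
  assumes G: "group G" and fbz: "free_by_Z G"
  shows "\<exists>\<pi> :: 'g \<Rightarrow> int.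
    (\<forall>g\<in>carrier G. \<forall>h\<in>carrier G. \<pi> (g \<otimes>\<^bsub>G\<^esub> h) = \<pi> g + \<pi> h) \<and>
    (\<forall>x\<in>carrier G. \<pi> x = 0 \<longrightarrow> x \<noteq> \<one>\<^bsub>G\<^esub> \<longrightarrow> cyclic_roots (G\<lparr>carrier := {g \<in> carrier G. \<pi> g = 0}\<rparr>) x)"
proof -
  interpret G: group G by fact
  obtain n :: nat and \<alpha> \<Phi> where \<alpha>: "\<alpha> \<in> auto (free_group {..<n})"
    and \<Phi>: "\<Phi> \<in> iso G (semidirect_Z (free_group {..<n}) \<alpha>)"
    using fbz by (auto simp: free_by_Z_def is_iso_def)
  let ?F = "free_group {..<n}" and ?H = "semidirect_Z (free_group {..<n}) \<alpha>"
  interpret F: group ?F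
    unfolding free_group_def by (rule group_presented_group)
  interpret H: group ?H
    by (rule group_semidirect_Z[OF F.group_axioms \<alpha>])
  interpret \<Phi>: group_hom G ?H \<Phi>
    using \<Phi> G H.group_axioms by (simp add: group_hom_def group_hom_axioms_def iso_def)
  have bij: "bij_betw \<Phi> (carrier G) (carrier ?H)"
    using \<Phi> by (simp add: iso_def)
  define \<pi> where "\<pi> = (\<lambda>g. snd (\<Phi> g))"
  define \<kappa> where "\<kappa> = (\<lambda>g. fst (\<Phi> g))"
  have add: "\<pi> (g \<otimes>\<^bsub>G\<^esub> h) = \<pi> g + \<pi> h" if "g \<in> carrier G" "h \<in> carrier G" for g h
    using \<Phi>.hom_mult[OF that] by (simp add: \<pi>_def semidirect_Z_def split: prod.splits)
  define N where "N = {g \<in> carrier G. \<pi> g = 0}"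
  have one: "\<pi> \<one>\<^bsub>G\<^esub> = 0"
    using add[of "\<one>\<^bsub>G\<^esub>" "\<one>\<^bsub>G\<^esub>"] by simp
  have sub: "subgroup N G"
  proof
    fix g assume g: "g \<in> N"
    then show "inv\<^bsub>G\<^esub> g \<in> N"
      using add[of g "inv\<^bsub>G\<^esub> g"] one by (simp add: N_def)
  qed (simp_all add: N_def add one subset_eq)
  interpret N: group "G\<lparr>carrier := N\<rparr>"
    by (rule subgroup.subgroup_is_group[OF sub G])
  have \<kappa>_closed: "\<kappa> g \<in> carrier ?F" if "g \<in> carrier G" for g
    using \<Phi>.hom_closed[OF that] by (auto simp: \<kappa>_def semidirect_Z_def)
  have \<kappa>_mult: "\<kappa> (g \<otimes>\<^bsub>G\<^esub> h) = \<kappa> g \<otimes>\<^bsub>?F\<^esub> \<kappa> h" if "g \<in> N" "h \<in> N" for g h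
  proof -
    have "\<Phi> g = (\<kappa> g, 0)" "\<Phi> h = (\<kappa> h, 0)"
      using that by (auto simp: N_def \<pi>_def \<kappa>_def prod_eq_iff)
    moreover have "(\<alpha> [^]\<^bsub>AutoGroup ?F\<^esub> (0::int)) (\<kappa> h) = \<kappa> h"
      using \<kappa>_closed[of h] that by (simp add: AutoGroup_def BijGroup_def N_def)
    ultimately have "\<Phi> (g \<otimes>\<^bsub>G\<^esub> h) = (\<kappa> g \<otimes>\<^bsub>?F\<^esub> \<kappa> h, 0)"
      using \<Phi>.hom_mult[of g h] that by (simp add: N_def semidirect_Z_def del: int_pow_0)
    then show ?thesis
      by (simp add: \<kappa>_def)
  qed
  have \<kappa>: "group_hom (G\<lparr>carrier := N\<rparr>) ?F \<kappa>"
  proof -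
    have "\<kappa> \<in> hom (G\<lparr>carrier := N\<rparr>) ?F"
    proof (rule homI)
      fix g assume "g \<in> carrier (G\<lparr>carrier := N\<rparr>)"
      then have "g \<in> carrier G"
        by (simp add: N_def)
      then show "\<kappa> g \<in> carrier ?F"
        by (rule \<kappa>_closed)
    next
      fix g h assume "g \<in> carrier (G\<lparr>carrier := N\<rparr>)" "h \<in> carrier (G\<lparr>carrier := N\<rparr>)"
      then show "\<kappa> (g \<otimes>\<^bsub>G\<lparr>carrier := N\<rparr>\<^esub> h) = \<kappa> g \<otimes>\<^bsub>?F\<^esub> \<kappa> h"
        using \<kappa>_mult[of g h] by simp
    qed
    then show ?thesis
      using N.group_axioms F.group_axioms by (simp add: group_hom_def group_hom_axioms_def)
  qed
  interpret \<kappa>: group_hom "G\<lparr>carrier := N\<rparr>" ?F \<kappa> by (rule \<kappa>)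
  have inj: "g = h" if "g \<in> N" "h \<in> N" "\<kappa> g = \<kappa> h" for g h
  proof -
    have "\<Phi> g = \<Phi> h"
      using that by (auto simp: N_def \<pi>_def \<kappa>_def prod_eq_iff)
    then show ?thesis
      using bij that by (auto simp: N_def bij_betw_def inj_on_def)
  qed
  have "cyclic_roots (G\<lparr>carrier := N\<rparr>) x" if x: "x \<in> carrier G" "\<pi> x = 0" "x \<noteq> \<one>\<^bsub>G\<^esub>" for x
  proof -
    have xN: "x \<in> N"
      using x by (simp add: N_def)
    have "\<kappa> x \<noteq> \<one>\<^bsub>?F\<^esub>"
      using inj[OF xN subgroup.one_closed[OF sub]] x(3) \<kappa>.hom_one by auto
    then have "cyclic_roots ?F (\<kappa> x)"
      using \<kappa>_closed[OF x(1)] by (intro free_group_cyclic_roots)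
    then obtain m :: nat where m: "0 < m" and all: "\<forall>f\<in>carrier ?F. f \<otimes>\<^bsub>?F\<^esub> \<kappa> x = \<kappa> x \<otimes>\<^bsub>?F\<^esub> f \<longrightarrow>
        (\<exists>k::int. f [^]\<^bsub>?F\<^esub> m = \<kappa> x [^]\<^bsub>?F\<^esub> k) \<and>
        (\<forall>g\<in>carrier ?F. g \<otimes>\<^bsub>?F\<^esub> \<kappa> x = \<kappa> x \<otimes>\<^bsub>?F\<^esub> g \<longrightarrow> g [^]\<^bsub>?F\<^esub> m = f [^]\<^bsub>?F\<^esub> m \<longrightarrow> g = f)"
      unfolding cyclic_roots_def by (elim exE conjE)
    note root = mp[OF bspec[OF all]]
    let ?N = "G\<lparr>carrier := N\<rparr>"
    have comm: "\<kappa> f \<in> carrier ?F" "\<kappa> f \<otimes>\<^bsub>?F\<^esub> \<kappa> x = \<kappa> x \<otimes>\<^bsub>?F\<^esub> \<kappa> f"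
      if "f \<in> N" "f \<otimes>\<^bsub>?N\<^esub> x = x \<otimes>\<^bsub>?N\<^esub> f" for f
      using that xN \<kappa>_closed[of f] \<kappa>_mult[of f x] \<kappa>_mult[of x f] by (simp_all add: N_def)
    have pow: "\<kappa> (f [^]\<^bsub>?N\<^esub> m) = \<kappa> f [^]\<^bsub>?F\<^esub> m" "f [^]\<^bsub>?N\<^esub> m \<in> N" if "f \<in> N" for f
      using that \<kappa>.hom_nat_pow[of f m] N.nat_pow_closed[of f m] by simp_all
    have ipow: "\<kappa> (x [^]\<^bsub>?N\<^esub> k) = \<kappa> x [^]\<^bsub>?F\<^esub> k" "x [^]\<^bsub>?N\<^esub> k \<in> N" for k :: int
      using xN \<kappa>.hom_int_pow[of x k] N.int_pow_closed[of x k] by simp_all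
    show ?thesis
      unfolding cyclic_roots_def
    proof (intro exI[of _ m] conjI ballI impI m)
      fix f assume "f \<in> carrier ?N" and f: "f \<otimes>\<^bsub>?N\<^esub> x = x \<otimes>\<^bsub>?N\<^esub> f"
      then have fN: "f \<in> N"
        by simp
      obtain k :: int where "\<kappa> f [^]\<^bsub>?F\<^esub> m = \<kappa> x [^]\<^bsub>?F\<^esub> k"
        using conjunct1[OF root[OF comm[OF fN f]]] ..
      then have "f [^]\<^bsub>?N\<^esub> m = x [^]\<^bsub>?N\<^esub> k"
        using pow[OF fN] ipow by (intro inj) simp_all
      then show "\<exists>k::int. f [^]\<^bsub>?N\<^esub> m = x [^]\<^bsub>?N\<^esub> k" ..
      fix g assume "g \<in> carrier ?N" and g: "g \<otimes>\<^bsub>?N\<^esub> x = x \<otimes>\<^bsub>?N\<^esub> g" "g [^]\<^bsub>?N\<^esub> m = f [^]\<^bsub>?N\<^esub> m"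
      then have gN: "g \<in> N"
        by simp
      have "\<kappa> g [^]\<^bsub>?F\<^esub> m = \<kappa> f [^]\<^bsub>?F\<^esub> m"
        using g(2) pow(1)[OF fN] pow(1)[OF gN] by simp
      then have "\<kappa> g = \<kappa> f"
        using conjunct2[OF root[OF comm[OF fN f]]] comm[OF gN g(1)] by simp
      then show "g = f"
        using inj fN gN by blast
    qed
  qed
  then show ?thesis
    using add unfolding N_def by blast
qed

lemma (in group) conj_cancel:
  assumes "k \<in> carrier G" "f \<in> carrier G" "g \<in> carrier G"
    and eq: "k \<otimes> f \<otimes> inv k = k \<otimes> g \<otimes> inv k"
  shows "f = g"
proof -
  have id: "inv k \<otimes> (k \<otimes> x \<otimes> inv k) \<otimes> k = x" if "x \<in> carrier G" for x
  proof -
    have "inv k \<otimes> (k \<otimes> x \<otimes> inv k) \<otimes> k = (inv k \<otimes> k) \<otimes> x \<otimes> (inv k \<otimes> k)"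
      using that assms(1) by (simp only: m_assoc m_closed inv_closed)
    also have "\<dots> = x"
      using that assms(1) by simp
    finally show ?thesis .
  qed
  have "inv k \<otimes> (k \<otimes> f \<otimes> inv k) \<otimes> k = inv k \<otimes> (k \<otimes> g \<otimes> inv k) \<otimes> k"
    by (simp only: eq)
  then show ?thesis
    unfolding id[OF assms(2)] id[OF assms(3)] .
qed

context tubular_coordinates
begin

section \<open>The action on the Bass--Serre tree\<close>

text \<open>Numbering the edges makes the type of the tree countable, whatever \<open>'e\<close> is,
  so that the index set can later be embedded by \<open>to_nat\<close>.\<close>

definition code :: "'e \<Rightarrow> nat" where
  "code = (SOME f. inj_on f (arcs \<Gamma>))"

lemma inj_code: "inj_on code (arcs \<Gamma>)"
proof -
  have "\<exists>f :: 'e \<Rightarrow> nat. inj_on f (arcs \<Gamma>)"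
    using finite_imp_inj_to_nat_seg[OF fin_arcs] by blast
  then show ?thesis
    unfolding code_def by (rule someI_ex)
qed

text \<open>\<open>Suc\<close> keeps the number 0 free for the additional letter.\<close>

definition lt :: "'e \<times> bool \<Rightarrow> nat \<times> bool" where
  "lt y = (Suc (code (fst y)), snd y)"

text \<open>The letter \<open>(0, True)\<close> is an additional free factor. It makes the action of the vertex groups
  on the tree faithful.\<close>

definition rx :: "nat \<times> bool \<Rightarrow> int \<times> int" where
  "rx z = (if \<exists>e\<in>arcs \<Gamma>. fst z = Suc (code e)
     then xx (the_inv_into (arcs \<Gamma>) code (fst z - 1), snd z) else 0)"

lemma rx_lt:
  assumes y: "fst y \<in> arcs \<Gamma>"
  shows "rx (lt y) = xx y"
proof -
  have fst: "fst (lt y) = Suc (code (fst y))" and snd: "snd (lt y) = snd y"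
    by (simp_all add: lt_def)
  have ex: "\<exists>e\<in>arcs \<Gamma>. fst (lt y) = Suc (code e)"
    by (rule bexI[of _ "fst y"]) (rule fst, rule y)
  have "the_inv_into (arcs \<Gamma>) code (fst (lt y) - 1) = fst y"
    using the_inv_into_f_f[OF inj_code y] by (simp add: fst)
  then show ?thesis
    unfolding rx_def if_P[OF ex] snd by (simp only: prod.collapse)
qed

lemma rx_0: "rx (0, b) = 0"
  by (simp add: rx_def)

lemma lt_flip: "lt (flip_letter y) = flip_letter (lt y)"
  by (simp add: lt_def flip_letter_def)

sublocale R: rose rx
proof
  fix z
  show "rx (flip_letter z) = 0 \<longleftrightarrow> rx z = 0"
  proof (cases "\<exists>e\<in>arcs \<Gamma>. fst z = Suc (code e)")
    case True
    then obtain e where e: "e \<in> arcs \<Gamma>" "fst z = Suc (code e)"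
      by blast
    define b where "b = snd z"
    have z: "z = lt (e, b)"
      using e(2) by (simp add: lt_def prod_eq_iff b_def)
    have "rx z = xx (e, b)" "rx (flip_letter z) = xx (flip_letter (e, b))"
      using rx_lt[of "(e, b)"] rx_lt[of "flip_letter (e, b)"] e(1) by (simp_all add: z lt_flip)
    then show ?thesis
      using xx_nonzero[of "(e, b)"] xx_nonzero[of "flip_letter (e, b)"] e(1) by simp
  qed (simp add: rx_def)
qed

abbreviation "K1 \<equiv> commensurator R.outward"

abbreviation K1mult (infixl \<open>\<star>\<close> 70) where "f \<star> g \<equiv> f \<otimes>\<^bsub>K1\<^esub> g"

text \<open>All vertex groups act by the same \<open>R.rotate_edge\<close>, up to conjugation by
  \<beta>. In effect the vertices of the graph are identified to form a rose, and the tree is that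
  of a multiple HNN extension of a single Z^2.\<close>

definition tree_action :: "(('v, 'a, 'e) gog_gen word set \<Rightarrow>
    ((int \<times> int) \<times> nat \<times> bool) list \<times> bool \<Rightarrow> ((int \<times> int) \<times> nat \<times> bool) list \<times> bool) \<Rightarrow>
    ('v \<Rightarrow> ((int \<times> int) \<times> nat \<times> bool) list \<times> bool \<Rightarrow> ((int \<times> int) \<times> nat \<times> bool) list \<times> bool) \<Rightarrow>
    bool" where
  "tree_action \<rho> \<beta> \<longleftrightarrow> \<rho> \<in> hom P K1 \<and> (\<forall>v. \<beta> v \<in> carrier K1) \<and>
    (\<forall>v\<in>verts \<Gamma>. \<forall>a. \<rho> (vx v a) = \<beta> v \<star> R.rotate_edge a \<star> inv\<^bsub>K1\<^esub> \<beta> v) \<and>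
    (\<forall>e\<in>arcs \<Gamma>. \<rho> (st e) = \<beta> (tail \<Gamma> e) \<star> R.cross_edge (lt (e, True)) \<star> inv\<^bsub>K1\<^esub> \<beta> (head \<Gamma> e))"

lemma tree_action_exists: "\<exists>\<rho> \<beta>. tree_action \<rho> \<beta>"
proof -
  have "\<exists>\<rho>\<in>hom P K1. \<exists>\<beta>. (\<forall>v. \<beta> v \<in> carrier K1) \<and>
    (\<forall>v\<in>verts \<Gamma>. \<forall>a. \<rho> (vx v a) = \<beta> v \<star> R.rotate_edge a \<star> inv\<^bsub>K1\<^esub> \<beta> v) \<and>
    (\<forall>e\<in>arcs \<Gamma>. \<rho> (st e) = \<beta> (tail \<Gamma> e) \<star> R.cross_edge (lt (e, True)) \<star> inv\<^bsub>K1\<^esub> \<beta> (head \<Gamma> e))"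
  proof (rule P_hom_exists[OF group_commensurator])
    fix e assume e: "e \<in> arcs \<Gamma>"
    have x: "rx (lt (e, True)) = xt e" "rx (flip_letter (lt (e, True))) = xh e"
      using rx_lt[of "(e, True)"] rx_lt[of "(e, False)"] lt_flip[of "(e, True)"] e
      by (simp_all add: xx_def flip_letter_def)
    show "R.cross_edge (lt (e, True)) \<star> R.rotate_edge (xh e)
        = R.rotate_edge (xt e) \<star> R.cross_edge (lt (e, True))"
      using R.cross_rotate[of "lt (e, True)" 1] by (simp add: x fun_eq_iff)
  next
    fix a b show "R.rotate_edge (a + b) = R.rotate_edge a \<star> R.rotate_edge b"
      by (simp add: R.rotate_rotate fun_eq_iff)
  qed (rule R.rotate_in_commensurator R.cross_in_commensurator)+
  then show ?thesis
    unfolding tree_action_def by blast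
qed

lemma tree_actionD:
  assumes "tree_action \<rho> \<beta>"
  shows "\<rho> \<in> hom P K1" "\<beta> v \<in> carrier K1"
    "v \<in> verts \<Gamma> \<Longrightarrow> \<rho> (vx v a) = \<beta> v \<star> R.rotate_edge a \<star> inv\<^bsub>K1\<^esub> \<beta> v"
    "e \<in> arcs \<Gamma> \<Longrightarrow> \<rho> (st e)
      = \<beta> (tail \<Gamma> e) \<star> R.cross_edge (lt (e, True)) \<star> inv\<^bsub>K1\<^esub> \<beta> (head \<Gamma> e)"
  using assms unfolding tree_action_def by blast+

lemma tree_action_stl:
  assumes act: "tree_action \<rho> \<beta>" and y: "fst y \<in> arcs \<Gamma>"
  shows "\<rho> (stl y) = \<beta> (src y) \<star> R.cross_edge (lt y) \<star> inv\<^bsub>K1\<^esub> \<beta> (src (flip_letter y))"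
proof -
  interpret K: group K1 by (rule group_commensurator)
  note \<rho> = tree_actionD(1)[OF act] and \<beta> = tree_actionD(2)[OF act] and st = tree_actionD(4)[OF act]
  interpret \<rho>: group_hom P K1 \<rho>
    using \<rho> K.group_axioms P.group_axioms by (simp add: group_hom_def group_hom_axioms_def)
  show ?thesis
  proof (cases "snd y")
    case True
    then have "y = (fst y, True)"
      by (simp add: prod_eq_iff)
    then show ?thesis
      using st[OF y] True by (simp add: stl_def src_def flip_letter_def)
  next
    case False
    define k l s where "k = \<beta> (tail \<Gamma> (fst y))" "l = \<beta> (head \<Gamma> (fst y))" "s = R.cross_edge (lt (fst y, True))"
    have cl: "k \<in> carrier K1" "l \<in> carrier K1" "s \<in> carrier K1"
      using \<beta> R.cross_in_commensurator unfolding k_l_s_def by blast+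
    have y_eq: "lt y = flip_letter (lt (fst y, True))"
      using False by (simp add: lt_def flip_letter_def)
    have "R.cross_edge (lt y) \<star> s = \<one>\<^bsub>K1\<^esub>"
      using R.cross_cross[of "lt y"] by (simp add: k_l_s_def y_eq fun_eq_iff)
    then have "inv\<^bsub>K1\<^esub> s = R.cross_edge (lt y)"
      using cl(3) R.cross_in_commensurator by (rule K.inv_equality)
    moreover have "\<rho> (stl y) = inv\<^bsub>K1\<^esub> (k \<star> s \<star> inv\<^bsub>K1\<^esub> l)"
      using \<rho>.hom_inv[OF st_closed[OF y]] st[OF y] False by (simp add: stl_def k_l_s_def)
    moreover have "inv\<^bsub>K1\<^esub> (k \<star> s \<star> inv\<^bsub>K1\<^esub> l) = l \<star> inv\<^bsub>K1\<^esub> s \<star> inv\<^bsub>K1\<^esub> k"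
      using cl by (simp only: K.inv_mult_group K.inv_inv K.m_assoc K.m_closed K.inv_closed)
    ultimately show ?thesis
      using False by (simp only: src_def flip_letter_def k_l_s_def fst_conv snd_conv if_False if_True not_False_eq_True)
  qed
qed

text \<open>The vertex groups embed because, thanks to the additional letter, already their action
  on the tree is faithful.\<close>

lemma vx_inj:
  assumes "v \<in> verts \<Gamma>" "vx v a = vx v b"
  shows "a = b"
proof -
  interpret K: group K1 by (rule group_commensurator)
  obtain \<rho> \<beta> where act: "tree_action \<rho> \<beta>"
    using tree_action_exists by blast
  note \<beta> = tree_actionD(2,3)[OF act]
  have "\<beta> v \<star> R.rotate_edge a \<star> inv\<^bsub>K1\<^esub> \<beta> v = \<beta> v \<star> R.rotate_edge b \<star> inv\<^bsub>K1\<^esub> \<beta> v"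
    using arg_cong[OF assms(2), of \<rho>] unfolding \<beta>(2)[OF assms(1)] .
  then have "R.rotate_edge a = R.rotate_edge b"
    by (rule K.conj_cancel[OF \<beta>(1) R.rotate_in_commensurator R.rotate_in_commensurator])
  then show ?thesis
    using R.rotate_faithful[OF rx_0] by blast
qed

text \<open>In an amalgam, elements of different factors that lie outside the amalgamated subgroup
  do not commute; here this is seen on the tree through
  \<open>R.rotate_cross_not_commute\<close>.\<close>

lemma vx_st_not_commute:
  assumes e: "e \<in> arcs \<Gamma>" and u: "\<And>m. u \<noteq> smul m (xt e)" and w: "\<And>m. w \<noteq> smul m (xh e)"
  shows "vx (tail \<Gamma> e) u \<cdot> (st e \<cdot> vx (head \<Gamma> e) w \<cdot> inv\<^bsub>P\<^esub> st e)
    \<noteq> (st e \<cdot> vx (head \<Gamma> e) w \<cdot> inv\<^bsub>P\<^esub> st e) \<cdot> vx (tail \<Gamma> e) u"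
proof
  assume eq: "vx (tail \<Gamma> e) u \<cdot> (st e \<cdot> vx (head \<Gamma> e) w \<cdot> inv\<^bsub>P\<^esub> st e)
    = (st e \<cdot> vx (head \<Gamma> e) w \<cdot> inv\<^bsub>P\<^esub> st e) \<cdot> vx (tail \<Gamma> e) u"
  interpret K: group K1 by (rule group_commensurator)
  obtain \<rho> \<beta> where act: "tree_action \<rho> \<beta>"
    using tree_action_exists by blast
  note \<rho> = tree_actionD(1)[OF act] and \<beta> = tree_actionD(2)[OF act] and vx = tree_actionD(3)[OF act]
    and stl = tree_action_stl[OF act]
  interpret \<rho>: group_hom P K1 \<rho>
    using \<rho> K.group_axioms P.group_axioms by (simp add: group_hom_def group_hom_axioms_def)
  define k l s s' r q where "k = \<beta> (tail \<Gamma> e)" "l = \<beta> (head \<Gamma> e)" "s = R.cross_edge (lt (e, True))"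
    "s' = R.cross_edge (flip_letter (lt (e, True)))" "r = R.rotate_edge w" "q = R.rotate_edge u"
  note defs = k_l_s_s'_r_q_def
  have cl: "k \<in> carrier K1" "l \<in> carrier K1" "s \<in> carrier K1" "s' \<in> carrier K1" "r \<in> carrier K1" "q \<in> carrier K1"
    using \<beta> R.rotate_in_commensurator R.cross_in_commensurator unfolding defs by blast+
  have "\<rho> (stl (e, True)) = k \<star> s \<star> inv\<^bsub>K1\<^esub> l"
    using stl[of "(e, True)"] e unfolding defs by (simp add: src_def flip_letter_def)
  moreover have "\<rho> (stl (e, False)) = l \<star> s' \<star> inv\<^bsub>K1\<^esub> k"
    using stl[of "(e, False)"] e lt_flip[of "(e, True)"] unfolding defs by (simp add: src_def flip_letter_def)
  ultimately have st: "\<rho> (st e) = k \<star> s \<star> inv\<^bsub>K1\<^esub> l"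
    "\<rho> (inv\<^bsub>P\<^esub> st e) = l \<star> s' \<star> inv\<^bsub>K1\<^esub> k"
    by (simp_all add: stl_def)
  have vw: "\<rho> (vx (tail \<Gamma> e) u) = k \<star> q \<star> inv\<^bsub>K1\<^esub> k"
    "\<rho> (vx (head \<Gamma> e) w) = l \<star> r \<star> inv\<^bsub>K1\<^esub> l"
    using vx e unfolding defs by simp_all
  define z where "z = s \<star> r \<star> s'"
  have cz: "z \<in> carrier K1"
    using cl(3-5) unfolding z_def by (intro K.m_closed)
  have conj_mult: "(k \<star> f \<star> inv\<^bsub>K1\<^esub> l') \<star> (l' \<star> g \<star> inv\<^bsub>K1\<^esub> m)
      = k \<star> (f \<star> g) \<star> inv\<^bsub>K1\<^esub> m"
    if "k \<in> carrier K1" "l' \<in> carrier K1" "m \<in> carrier K1" "f \<in> carrier K1" "g \<in> carrier K1" for k l' m f g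
  proof -
    have "(k \<star> f \<star> inv\<^bsub>K1\<^esub> l') \<star> (l' \<star> g \<star> inv\<^bsub>K1\<^esub> m)
      = k \<star> f \<star> (inv\<^bsub>K1\<^esub> l' \<star> l') \<star> g \<star> inv\<^bsub>K1\<^esub> m"
      using that by (simp only: K.m_assoc K.m_closed K.inv_closed)
    then show ?thesis
      using that by (simp only: K.l_inv K.r_one K.m_assoc K.m_closed K.inv_closed)
  qed
  have sw: "\<rho> (st e \<cdot> vx (head \<Gamma> e) w \<cdot> inv\<^bsub>P\<^esub> st e) = k \<star> z \<star> inv\<^bsub>K1\<^esub> k"
  proof -
    have "\<rho> (st e \<cdot> vx (head \<Gamma> e) w \<cdot> inv\<^bsub>P\<^esub> st e)
        = \<rho> (st e) \<star> \<rho> (vx (head \<Gamma> e) w) \<star> \<rho> (inv\<^bsub>P\<^esub> st e)"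
      using e by (simp only: \<rho>.hom_mult P.m_closed P.inv_closed st_closed vx_closed tail_head_in_verts)
    also have "\<dots> = k \<star> z \<star> inv\<^bsub>K1\<^esub> k"
      unfolding st vw z_def using cl K.m_closed by (simp only: conj_mult)
    finally show ?thesis .
  qed
  have "k \<star> (q \<star> z) \<star> inv\<^bsub>K1\<^esub> k
      = \<rho> (vx (tail \<Gamma> e) u \<cdot> (st e \<cdot> vx (head \<Gamma> e) w \<cdot> inv\<^bsub>P\<^esub> st e))"
    using e cl cz by (simp only: \<rho>.hom_mult P.m_closed P.inv_closed st_closed vx_closed tail_head_in_verts sw vw conj_mult)
  also have "\<dots> = k \<star> (z \<star> q) \<star> inv\<^bsub>K1\<^esub> k"
    unfolding eq
    using e cl cz by (simp only: \<rho>.hom_mult P.m_closed P.inv_closed st_closed vx_closed tail_head_in_verts sw vw conj_mult)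
  finally have "q \<star> z = z \<star> q"
    by (rule K.conj_cancel[OF cl(1) K.m_closed[OF cl(6) cz] K.m_closed[OF cz cl(6)]])
  moreover have "R.crep (lt (e, True)) u \<noteq> 0"
    using u rx_lt[of "(e, True)"] e by (simp add: R.crep_eq_0_iff xx_def)
  moreover have "R.crep (flip_letter (lt (e, True))) w \<noteq> 0"
    using w rx_lt[of "(e, False)"] lt_flip[of "(e, True)"] e
    by (simp add: R.crep_eq_0_iff xx_def flip_letter_def)
  ultimately show False
    using R.rotate_cross_not_commute[OF rx_0[of True], of "lt (e, True)" u w]
    by (simp add: z_def defs lt_def)
qed

lemma fixfree_conj_P:
  assumes \<rho>: "\<rho> \<in> hom P (commensurator A)" and k: "k \<in> carrier P" and g: "g \<in> carrier P"
    and "fixfree A (\<rho> g)"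
  shows "fixfree A (\<rho> (k \<cdot> g \<cdot> inv\<^bsub>P\<^esub> k))"
proof -
  interpret \<rho>: group_hom P "commensurator A" \<rho>
    using \<rho> group_commensurator P.group_axioms by (simp add: group_hom_def group_hom_axioms_def)
  have "\<rho> k \<in> carrier (commensurator A)"
    using k by (rule \<rho>.hom_closed)
  then have "inv\<^bsub>commensurator A\<^esub> \<rho> k = inv_into UNIV (\<rho> k)"
    by (rule inv_commensurator)
  then have "\<rho> (k \<cdot> g \<cdot> inv\<^bsub>P\<^esub> k) = \<rho> k \<circ> \<rho> g \<circ> inv_into UNIV (\<rho> k)"
    using k g by simp
  then show ?thesis
    using fixfree_conj[OF assms(4) \<open>\<rho> k \<in> carrier (commensurator A)\<close>] by simp
qed

text \<open>Along a path the gauge factors telescope, so a loop acts as a conjugate of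
  \<open>R.travel\<close> on the renamed letters; \<open>no_turn\<close> becomes
  \<open>R.no_backtrack\<close> because \<open>code\<close> is injective on the edges.\<close>

lemma fixfree_cyclically_reduced:
  assumes act: "tree_action \<rho> \<beta>"
    and l: "l \<noteq> []" "path v l v" "successively no_turn (l @ l)"
  shows "fixfree R.outward (\<rho> (pval l))"
proof -
  interpret K: group K1 by (rule group_commensurator)
  note \<rho> = tree_actionD(1)[OF act] and \<beta> = tree_actionD(2)[OF act] and vx = tree_actionD(3)[OF act]
    and stl = tree_action_stl[OF act]
  interpret \<rho>: group_hom P K1 \<rho>
    using \<rho> K.group_axioms P.group_axioms by (simp add: group_hom_def group_hom_axioms_def)
  let ?m = "map (map_prod id lt)"
  have "R.travel (?m l) \<in> carrier K1 \<and>
      \<rho> (pval l) = \<beta> v \<star> R.travel (?m l) \<star> inv\<^bsub>K1\<^esub> \<beta> w" if "path v l w" for v l w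
    using that
  proof (induction v l w rule: path.induct)
    case (1 v w)
    have "R.travel [] = \<one>\<^bsub>K1\<^esub>"
      by (simp add: fun_eq_iff)
    then show ?case
      using 1 \<beta>[of v] by (simp only: pval.simps list.map \<rho>.hom_one K.r_one K.r_inv K.one_closed path.simps)
  next
    case (2 v a y l w)
    let ?f = "R.rotate_edge a" and ?s = "R.cross_edge (lt y)" and ?t = "R.travel (?m l)"
    have y: "fst y \<in> arcs \<Gamma>" "src y = v" and p: "path (src (flip_letter y)) l w"
      using 2 by simp_all
    have cl: "?f \<in> carrier K1" "?s \<in> carrier K1" "?t \<in> carrier K1" "\<beta> v \<in> carrier K1" "\<beta> w \<in> carrier K1"
      "\<beta> (src (flip_letter y)) \<in> carrier K1"
      using R.rotate_in_commensurator R.cross_in_commensurator 2 p \<beta> by blast+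
    have t: "R.travel (?m ((a, y) # l)) = ?f \<star> ?s \<star> ?t"
      by (simp add: fun_eq_iff)
    have canc: "inv\<^bsub>K1\<^esub> b \<star> (b \<star> f) = f" if "b \<in> carrier K1" "f \<in> carrier K1" for b f
      using that by (simp only: K.m_assoc[symmetric] K.inv_closed K.l_inv K.l_one)
    have "\<rho> (pval ((a, y) # l)) = \<rho> (vx v a) \<star> (\<rho> (stl y) \<star> \<rho> (pval l))"
      using y path_verts[OF "2.prems"] pval_closed[OF p]
      by (simp only: pval.simps \<rho>.hom_mult vx_closed stl_closed P.m_closed)
    also have "\<dots> = (\<beta> v \<star> ?f \<star> inv\<^bsub>K1\<^esub> \<beta> v) \<star>
        ((\<beta> v \<star> ?s \<star> inv\<^bsub>K1\<^esub> \<beta> (src (flip_letter y))) \<star> (\<beta> (src (flip_letter y)) \<star> ?t \<star> inv\<^bsub>K1\<^esub> \<beta> w))"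
      unfolding vx[OF conjunct1[OF path_verts[OF "2.prems"]]] stl[OF y(1)] y(2)
        conjunct2[OF 2(1)[OF p]] by (rule HOL.refl)
    also have "\<dots> = \<beta> v \<star> (?f \<star> ?s \<star> ?t) \<star> inv\<^bsub>K1\<^esub> \<beta> w"
      using cl by (simp only: K.m_assoc canc K.m_closed K.inv_closed)
    finally show ?case
      unfolding t using K.m_closed[OF K.m_closed[OF cl(1,2)] cl(3)] by (intro conjI)
  qed
  from this[OF l(2)] have eq: "\<rho> (pval l) = \<beta> v \<circ> R.travel (?m l) \<circ> inv_into UNIV (\<beta> v)"
    using inv_commensurator[OF \<beta>[of v]] by simp
  have nt: "R.no_backtrack (map_prod id lt y) (map_prod id lt z)"
    if "y \<in> set (l @ l)" "z \<in> set (l @ l)" "no_turn y z" for y z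
  proof -
    have arcs: "fst (snd y) \<in> arcs \<Gamma>" "fst (snd z) \<in> arcs \<Gamma>"
      using that path_arcs[OF l(2)] by auto
    show ?thesis
    proof (cases "lt (snd z) = flip_letter (lt (snd y))")
      case True
      then have "lt (snd z) = lt (flip_letter (snd y))"
        by (simp add: lt_flip)
      then have "snd z = flip_letter (snd y)"
        using arcs inj_onD[OF inj_code, of "fst (snd z)" "fst (snd y)"] by (simp add: lt_def prod_eq_iff)
      then have "\<forall>m. fst z \<noteq> smul m (xx (snd z))"
        using that(3) by (simp add: no_turn_def)
      then show ?thesis
        using arcs(2) by (simp add: R.no_backtrack_def R.crep_eq_0_iff rx_lt)
    qed (simp add: R.no_backtrack_def)
  qed
  have "successively R.no_backtrack (?m l @ ?m l)"
    unfolding map_append[symmetric] successively_map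
    using l(3) by (rule successively_mono) (rule nt)
  then have "fixfree R.outward (R.travel (?m l))"
    using l(1) by (intro R.fixfree_travel) simp_all
  then show ?thesis
    unfolding eq using \<beta> by (rule fixfree_conj)
qed

end

section \<open>The height function does not vanish on the edge groups\<close>

lemma det2_smul: "det2 (smul m a) b = m * det2 a b" "det2 a (smul m b) = m * det2 a b"
  by (simp_all add: det2_def smul_def algebra_simps)

lemma det2_self [simp]: "det2 a a = 0"
  by (simp add: det2_def)

lemma det2_perp:
  assumes "a \<noteq> 0"
  shows "det2 a (- snd a, fst a) \<noteq> 0"
proof -
  have "det2 a (- snd a, fst a) = fst a * fst a + snd a * snd a"
    by (simp add: det2_def)
  then show ?thesis
    using assms by (simp add: sum_squares_eq_zero_iff prod_eq_iff)
qed

locale tubular_free_by_Z = tubular_coordinates \<G> T \<psi> c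
  for \<G> :: "('v, 'e, 'a, 'b) graph_of_groups" and T \<psi> c +
  fixes \<pi> :: "('v, 'a, 'e) gog_gen word set \<Rightarrow> int"
  assumes \<pi>_mult: "g \<in> carrier P \<Longrightarrow> h \<in> carrier P \<Longrightarrow> \<pi> (g \<cdot> h) = \<pi> g + \<pi> h"
    and \<pi>_roots: "g \<in> carrier P \<Longrightarrow> \<pi> g = 0 \<Longrightarrow> g \<noteq> \<one>\<^bsub>P\<^esub> \<Longrightarrow>
      cyclic_roots (P\<lparr>carrier := {g \<in> carrier P. \<pi> g = 0}\<rparr>) g"
begin

lemma \<pi>_one [simp]: "\<pi> \<one>\<^bsub>P\<^esub> = 0"
  using \<pi>_mult[of "\<one>\<^bsub>P\<^esub>" "\<one>\<^bsub>P\<^esub>"] by simp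

lemma \<pi>_inv: "g \<in> carrier P \<Longrightarrow> \<pi> (inv\<^bsub>P\<^esub> g) = - \<pi> g"
  using \<pi>_mult[of g "inv\<^bsub>P\<^esub> g"] by simp

lemma \<pi>_smul:
  assumes v: "v \<in> verts \<Gamma>"
  shows "\<pi> (vx v (smul m a)) = m * \<pi> (vx v a)"
proof -
  have "\<pi> (vx v (smul m a)) = \<pi> (vx v a) [^]\<^bsub>integer_group\<^esub> m"
    using v by (intro group.additive_smul(3)[of _ "\<lambda>a. \<pi> (vx v a)"]) (simp_all add: vx_add \<pi>_mult)
  then show ?thesis
    by simp
qed

lemma \<pi>_linear:
  assumes v: "v \<in> verts \<Gamma>"
  shows "\<pi> (vx v a) = fst a * \<pi> (vx v (1, 0)) + snd a * \<pi> (vx v (0, 1))"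
proof -
  have "a = smul (fst a) (1, 0) + smul (snd a) (0, 1)"
    by (simp add: smul_def)
  then have "\<pi> (vx v a) = \<pi> (vx v (smul (fst a) (1, 0) + smul (snd a) (0, 1)))"
    by (rule arg_cong)
  also have "\<dots> = \<pi> (vx v (smul (fst a) (1, 0))) + \<pi> (vx v (smul (snd a) (0, 1)))"
    using v by (simp only: vx_add \<pi>_mult vx_closed)
  finally show ?thesis
    using \<pi>_smul[OF v] by simp
qed

lemma kernel_pow:
  fixes n :: nat and k :: int
  assumes "g \<in> carrier P" "\<pi> g = 0"
  shows "g [^]\<^bsub>P\<lparr>carrier := {g \<in> carrier P. \<pi> g = 0}\<rparr>\<^esub> n = g [^]\<^bsub>P\<^esub> n"
    "g [^]\<^bsub>P\<lparr>carrier := {g \<in> carrier P. \<pi> g = 0}\<rparr>\<^esub> k = g [^]\<^bsub>P\<^esub> k"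
proof -
  let ?N = "{g \<in> carrier P. \<pi> g = 0}"
  have sub: "subgroup ?N P"
    by unfold_locales (auto simp: \<pi>_mult \<pi>_inv)
  show nat: "g [^]\<^bsub>P\<lparr>carrier := ?N\<rparr>\<^esub> n = g [^]\<^bsub>P\<^esub> n"
    using P.nat_pow_consistent by simp
  show "g [^]\<^bsub>P\<lparr>carrier := ?N\<rparr>\<^esub> k = g [^]\<^bsub>P\<^esub> k"
    using P.int_pow_consistent[OF sub, of g k] assms by simp
qed

lemma height_edge:
  assumes e: "e \<in> arcs \<Gamma>"
  shows "\<pi> (vx (head \<Gamma> e) (xh e)) = \<pi> (vx (tail \<Gamma> e) (xt e))"
proof -
  have "\<pi> (st e \<cdot> vx (head \<Gamma> e) (xh e)) = \<pi> (vx (tail \<Gamma> e) (xt e) \<cdot> st e)"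
    using st_vx[OF e, of 1] by simp
  then show ?thesis
    using e by (simp add: \<pi>_mult)
qed

text \<open>If an edge generator \<open>X\<close> lay in the kernel, then suitable powers \<open>U\<close> and \<open>W\<close> of elements of
  the two adjacent vertex groups would have the same height and both commute with \<open>X\<close>. The kernel
  is free, so \<open>U W\<^sup>-\<^sup>1\<close> has a power in common with \<open>X\<close> and \<open>U\<close> centralizes that power. Roots are
  unique, so \<open>U\<close> commutes with \<open>W\<close>, which is impossible in an amalgam.\<close>

lemma height_nonzero:
  assumes e: "e \<in> arcs \<Gamma>"
  shows "\<pi> (vx (tail \<Gamma> e) (xt e)) \<noteq> 0"
proof
  assume zero: "\<pi> (vx (tail \<Gamma> e) (xt e)) = 0"
  define X where "X = vx (tail \<Gamma> e) (xt e)"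
  define s where "s = st e"
  \<comment> \<open>Conjugation by the stable letter places the head vertex group next to the tail
    vertex group, so that X lies in both.\<close>
  define conj where "conj = (\<lambda>g. s \<cdot> g \<cdot> inv\<^bsub>P\<^esub> s)"
  have te: "tail \<Gamma> e \<in> verts \<Gamma>" and he: "head \<Gamma> e \<in> verts \<Gamma>"
    using e by simp_all
  have cX: "X \<in> carrier P" "\<pi> X = 0" and cs: "s \<in> carrier P"
    using e zero by (simp_all add: X_def s_def)
  have X1: "X \<noteq> \<one>\<^bsub>P\<^esub>"
    using vx_inj[OF te, of "xt e" 0] edge_maps(9)[OF e] te by (auto simp: X_def)
  obtain N :: nat where N: "0 < N" and roots:
    "\<And>f. f \<in> carrier P \<Longrightarrow> \<pi> f = 0 \<Longrightarrow> f \<cdot> X = X \<cdot> f \<Longrightarrow> \<exists>k::int. f [^]\<^bsub>P\<^esub> N = X [^]\<^bsub>P\<^esub> k"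
    "\<And>f g. f \<in> carrier P \<Longrightarrow> \<pi> f = 0 \<Longrightarrow> f \<cdot> X = X \<cdot> f \<Longrightarrow> g \<in> carrier P \<Longrightarrow> \<pi> g = 0
      \<Longrightarrow> g \<cdot> X = X \<cdot> g \<Longrightarrow> g [^]\<^bsub>P\<^esub> N = f [^]\<^bsub>P\<^esub> N \<Longrightarrow> g = f"
  proof -
    let ?K = "P\<lparr>carrier := {g \<in> carrier P. \<pi> g = 0}\<rparr>"
    obtain N :: nat where N: "0 < N" and all: "\<forall>f\<in>carrier ?K. f \<otimes>\<^bsub>?K\<^esub> X = X \<otimes>\<^bsub>?K\<^esub> f \<longrightarrow>
        (\<exists>k::int. f [^]\<^bsub>?K\<^esub> N = X [^]\<^bsub>?K\<^esub> k) \<and>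
        (\<forall>g\<in>carrier ?K. g \<otimes>\<^bsub>?K\<^esub> X = X \<otimes>\<^bsub>?K\<^esub> g \<longrightarrow> g [^]\<^bsub>?K\<^esub> N = f [^]\<^bsub>?K\<^esub> N \<longrightarrow> g = f)"
      using \<pi>_roots[OF cX X1] unfolding cyclic_roots_def by (elim exE conjE)
    have root: "(\<exists>k::int. f [^]\<^bsub>P\<^esub> N = X [^]\<^bsub>P\<^esub> k) \<and>
        (\<forall>g\<in>carrier ?K. g \<otimes>\<^bsub>?K\<^esub> X = X \<otimes>\<^bsub>?K\<^esub> g \<longrightarrow> g [^]\<^bsub>?K\<^esub> N = f [^]\<^bsub>P\<^esub> N \<longrightarrow> g = f)"
      if "f \<in> carrier P" "\<pi> f = 0" "f \<cdot> X = X \<cdot> f" for f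
      using mp[OF bspec[OF all, of f]] that unfolding kernel_pow[OF that(1,2)] kernel_pow[OF cX] by simp
    have "g = f" if "f \<in> carrier P" "\<pi> f = 0" "f \<cdot> X = X \<cdot> f"
      and g: "g \<in> carrier P" "\<pi> g = 0" "g \<cdot> X = X \<cdot> g" "g [^]\<^bsub>P\<^esub> N = f [^]\<^bsub>P\<^esub> N" for f g
      using bspec[OF conjunct2[OF root[OF that(1-3)]], of g] g unfolding kernel_pow[OF g(1,2)] by simp
    then show thesis
      using that[OF N] root by blast
  qed
  have conj_vx: "conj (vx (head \<Gamma> e) a) \<in> carrier P" for a
    using cs he by (simp add: conj_def)
  have conj_mult: "conj g \<cdot> conj h = conj (g \<cdot> h)" if "g \<in> carrier P" "h \<in> carrier P" for g h
  proof -
    have "conj g \<cdot> conj h = s \<cdot> g \<cdot> (inv\<^bsub>P\<^esub> s \<cdot> s) \<cdot> h \<cdot> inv\<^bsub>P\<^esub> s"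
      using cs that unfolding conj_def by (simp only: P.m_assoc P.m_closed P.inv_closed)
    then show ?thesis
      using cs that by (simp add: conj_def P.m_assoc)
  qed
  have X_conj: "X = conj (vx (head \<Gamma> e) (xh e))"
  proof -
    have "conj (vx (head \<Gamma> e) (xh e)) = X \<cdot> s \<cdot> inv\<^bsub>P\<^esub> s"
      using st_vx[OF e, of 1] by (simp add: conj_def X_def s_def)
    then show ?thesis
      using cX cs by (simp add: P.m_assoc)
  qed
  have \<pi>_conj: "\<pi> (conj g) = \<pi> g" if "g \<in> carrier P" for g
    using that cs by (simp add: conj_def \<pi>_mult \<pi>_inv)
  have commute_t: "vx (tail \<Gamma> e) a \<cdot> X = X \<cdot> vx (tail \<Gamma> e) a" for a
    using te vx_add[OF te, of a "xt e"] vx_add[OF te, of "xt e" a] by (simp add: X_def add.commute)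
  have commute_h: "conj (vx (head \<Gamma> e) a) \<cdot> X = X \<cdot> conj (vx (head \<Gamma> e) a)" for a
    using he vx_add[OF he, of a "xh e"] vx_add[OF he, of "xh e" a]
    by (simp add: X_conj conj_mult add.commute)
  \<comment> \<open>Perpendicular vectors, so that u and \<open>xt e\<close>, and likewise w and
    \<open>xh e\<close>, are linearly independent.\<close>
  define u w where "u = (- snd (xt e), fst (xt e))" "w = (- snd (xh e), fst (xh e))"
  have det: "det2 (xt e) u \<noteq> 0" "det2 (xh e) w \<noteq> 0"
    unfolding u_w_def using edge_maps(9,10)[OF e] by (simp_all only: det2_perp not_False_eq_True)
  have indep: "m = 0" if "smul m a = smul k x" "det2 x a \<noteq> 0" for m k a x
  proof -
    have "m * det2 x a = k * det2 x x"
      using that(1) by (metis det2_smul(2))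
    then show ?thesis
      using that(2) by simp
  qed
  define p where "p = \<pi> (vx (tail \<Gamma> e) u)"
  define q where "q = \<pi> (vx (head \<Gamma> e) w)"
  \<comment> \<open>If u had height 0, the roots property would make N u, with N > 0, a multiple of
    \<open>xt e\<close>.\<close>
  have p: "p \<noteq> 0"
  proof
    assume "p = 0"
    then obtain k :: int where "vx (tail \<Gamma> e) u [^]\<^bsub>P\<^esub> N = X [^]\<^bsub>P\<^esub> k"
      using roots(1)[OF vx_closed[OF te] _ commute_t, of u] by (auto simp: p_def)
    then have "vx (tail \<Gamma> e) (smul (int N) u) = vx (tail \<Gamma> e) (smul k (xt e))"
      using te by (simp add: vx_smul X_def int_pow_int)
    then have "smul (int N) u = smul k (xt e)"
      by (rule vx_inj[OF te])
    then show False
      using indep[OF _ det(1)] N by fastforce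
  qed
  have q: "q \<noteq> 0"
  proof
    assume "q = 0"
    then have "\<pi> (conj (vx (head \<Gamma> e) w)) = 0"
      using he by (simp add: \<pi>_conj q_def)
    then obtain k :: int where "conj (vx (head \<Gamma> e) w) [^]\<^bsub>P\<^esub> N = X [^]\<^bsub>P\<^esub> k"
      using roots(1)[OF conj_vx _ commute_h, of w] by auto
    then have "conj (vx (head \<Gamma> e) (smul (int N) w)) = conj (vx (head \<Gamma> e) (smul k (xh e)))"
      using he cs unfolding X_conj conj_def by (simp add: P.pow_conj vx_smul int_pow_int)
    then have "vx (head \<Gamma> e) (smul (int N) w) = vx (head \<Gamma> e) (smul k (xh e))"
      using P.conj_cancel[OF cs] he by (simp add: conj_def)
    then have "smul (int N) w = smul k (xh e)"
      by (rule vx_inj[OF he])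
    then show False
      using indep[OF _ det(2)] N by fastforce
  qed
  \<comment> \<open>The exponents q and p are exchanged so that both elements have height p
    q.\<close>
  define U where "U = vx (tail \<Gamma> e) (smul q u)"
  define W where "W = conj (vx (head \<Gamma> e) (smul p w))"
  have cU: "U \<in> carrier P" and cW: "W \<in> carrier P"
    using te conj_vx by (simp_all add: U_def W_def)
  have UX: "U \<cdot> X = X \<cdot> U" and WX: "W \<cdot> X = X \<cdot> W"
    unfolding U_def W_def by (rule commute_t commute_h)+
  have "\<pi> U = \<pi> W"
    using te he by (simp add: U_def W_def \<pi>_conj \<pi>_smul p_def q_def)
  define f where "f = U \<cdot> inv\<^bsub>P\<^esub> W"
  define g where "g = U \<cdot> f \<cdot> inv\<^bsub>P\<^esub> U"
  have cf: "f \<in> carrier P" "\<pi> f = 0"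
    using cU cW \<open>\<pi> U = \<pi> W\<close> by (simp_all add: f_def \<pi>_mult \<pi>_inv)
  have cg: "g \<in> carrier P" "\<pi> g = 0"
    using cU cf by (simp_all add: g_def \<pi>_mult \<pi>_inv)
  have inv_commute: "inv\<^bsub>P\<^esub> h \<cdot> X = X \<cdot> inv\<^bsub>P\<^esub> h" if "h \<in> carrier P" "h \<cdot> X = X \<cdot> h" for h
  proof -
    have "inv\<^bsub>P\<^esub> h \<cdot> X = inv\<^bsub>P\<^esub> h \<cdot> (X \<cdot> h) \<cdot> inv\<^bsub>P\<^esub> h"
      using that(1) cX by (simp add: P.m_assoc)
    also have "\<dots> = (inv\<^bsub>P\<^esub> h \<cdot> h) \<cdot> X \<cdot> inv\<^bsub>P\<^esub> h"
      using that(1) cX by (simp only: that(2)[symmetric] P.m_assoc P.m_closed P.inv_closed)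
    finally show ?thesis
      using that(1) cX by simp
  qed
  have mult_commute: "(h \<cdot> k) \<cdot> X = X \<cdot> (h \<cdot> k)"
    if "h \<in> carrier P" "k \<in> carrier P" "h \<cdot> X = X \<cdot> h" "k \<cdot> X = X \<cdot> k" for h k
  proof -
    have "(h \<cdot> k) \<cdot> X = h \<cdot> (X \<cdot> k)"
      using that(1,2) cX by (simp only: that(4)[symmetric] P.m_assoc)
    also have "\<dots> = (h \<cdot> X) \<cdot> k"
      using that(1,2) cX by (simp only: P.m_assoc)
    also have "\<dots> = X \<cdot> (h \<cdot> k)"
      using that(1,2) cX by (simp only: that(3) P.m_assoc)
    finally show ?thesis .
  qed
  have fX: "f \<cdot> X = X \<cdot> f"
    unfolding f_def using cU cW UX inv_commute[OF cW WX] by (intro mult_commute) simp_all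
  have gX: "g \<cdot> X = X \<cdot> g"
    unfolding g_def using cU cf(1) UX fX inv_commute[OF cU UX]
    by (intro mult_commute) simp_all
  obtain k :: int where k: "f [^]\<^bsub>P\<^esub> N = X [^]\<^bsub>P\<^esub> k"
    using roots(1)[OF cf fX] by blast
  have "U \<cdot> X \<cdot> inv\<^bsub>P\<^esub> U = X"
    using cU cX by (simp add: UX P.m_assoc)
  then have "U \<cdot> X [^]\<^bsub>P\<^esub> k \<cdot> inv\<^bsub>P\<^esub> U = X [^]\<^bsub>P\<^esub> k"
    using P.pow_conj(2)[OF cU cX(1), of k] by simp
  then have "g [^]\<^bsub>P\<^esub> N = f [^]\<^bsub>P\<^esub> N"
    unfolding g_def P.pow_conj(1)[OF cU cf(1)] k .
  then have "g = f"
    using roots(2)[OF cf fX cg gX] by simp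
  then have "U \<cdot> (U \<cdot> inv\<^bsub>P\<^esub> W \<cdot> inv\<^bsub>P\<^esub> U) = U \<cdot> inv\<^bsub>P\<^esub> W"
    using cU cW by (simp add: g_def f_def P.m_assoc)
  then have "U \<cdot> inv\<^bsub>P\<^esub> W \<cdot> inv\<^bsub>P\<^esub> U = inv\<^bsub>P\<^esub> W"
    using cU cW by simp
  then have "W \<cdot> (U \<cdot> inv\<^bsub>P\<^esub> W \<cdot> inv\<^bsub>P\<^esub> U) \<cdot> U \<cdot> W = W \<cdot> inv\<^bsub>P\<^esub> W \<cdot> U \<cdot> W"
    by simp
  then have "W \<cdot> U = U \<cdot> W"
    using cU cW by (simp add: P.m_assoc)
  moreover have "U \<cdot> W \<noteq> W \<cdot> U"
    unfolding U_def W_def conj_def s_def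
  proof (rule vx_st_not_commute[OF e])
    fix m
    show "smul q u \<noteq> smul m (xt e)"
      using indep[OF _ det(1), of q m] q by blast
    show "smul p w \<noteq> smul m (xh e)"
      using indep[OF _ det(2), of p m] p by blast
  qed
  ultimately show False
    by simp
qed

end

section \<open>Equitable sets\<close>

text \<open>With d the determinant, Cramer's rule puts d Z^2 into the subgroup, so the residues of
  the coordinates modulo |d| represent all cosets.\<close>

lemma finite_index_of_independent:
  assumes V: "group V" and \<psi>: "\<psi> \<in> iso V Z2" and st: "s \<in> carrier V" "t \<in> carrier V"
    and det: "det2 (\<psi> s) (\<psi> t) \<noteq> 0"
  shows "finite (rcosets\<^bsub>V\<^esub> (generate V {s, t}))"
proof -
  interpret V: group V by fact
  let ?H = "generate V {s, t}" and ?d = "\<bar>det2 (\<psi> s) (\<psi> t)\<bar>"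
  have hom: "\<psi> \<in> hom V Z2"
    using \<psi> by (simp add: iso_def)
  have bij: "bij_betw \<psi> (carrier V) UNIV"
    using \<psi> by (simp add: iso_def Z2_def DirProd_def)
  have inj: "g = h" if "g \<in> carrier V" "h \<in> carrier V" "\<psi> g = \<psi> h" for g h
    using bij that by (auto simp: bij_betw_def inj_on_def)
  have mult: "\<psi> (g \<otimes>\<^bsub>V\<^esub> h) = \<psi> g + \<psi> h" if "g \<in> carrier V" "h \<in> carrier V" for g h
    using hom_mult[OF hom that] by (cases "\<psi> g"; cases "\<psi> h") (simp add: Z2_def)
  define \<phi> where "\<phi> = inv_into (carrier V) \<psi>"
  have \<phi>: "\<phi> a \<in> carrier V" "\<psi> (\<phi> a) = a" for a
    using bij unfolding \<phi>_def bij_betw_def by (metis UNIV_I inv_into_into, metis UNIV_I f_inv_into_f)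
  have \<phi>_add: "\<phi> (a + b) = \<phi> a \<otimes>\<^bsub>V\<^esub> \<phi> b" for a b
    using \<phi> by (intro inj) (simp_all add: mult)
  note \<phi>_smul = V.additive_smul[of \<phi>, OF \<phi>(1) \<phi>_add]
  have H: "subgroup ?H V"
    using st by (intro V.generate_is_subgroup) simp
  have pow: "\<exists>h\<in>?H. \<psi> h = smul m (\<psi> g)" if g: "g \<in> ?H" "g \<in> carrier V" for g m
  proof -
    have "\<phi> (\<psi> g) = g"
      using inj \<phi> g(2) by blast
    then have "\<phi> (smul m (\<psi> g)) \<in> ?H"
      using V.subgroup_int_pow_closed[OF H g(1)] by (simp add: \<phi>_smul(3))
    then show ?thesis
      using \<phi>(2) by blast
  qed
  have gens: "s \<in> ?H" "t \<in> ?H"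
    by (auto intro: generate.incl)
  \<comment> \<open>Cramer's rule: \<open>det(s, t) a = det(a, t) s + det(s, a) t\<close>.\<close>
  have multiples: "g \<in> ?H" if g: "g \<in> carrier V" "\<psi> g = smul (det2 (\<psi> s) (\<psi> t)) a" for g a
  proof -
    obtain h where h: "h \<in> ?H" "\<psi> h = smul (det2 a (\<psi> t)) (\<psi> s)"
      using pow[OF gens(1) st(1)] by blast
    obtain k where k: "k \<in> ?H" "\<psi> k = smul (det2 (\<psi> s) a) (\<psi> t)"
      using pow[OF gens(2) st(2)] by blast
    have hk: "h \<in> carrier V" "k \<in> carrier V"
      using subgroup.mem_carrier[OF H] h(1) k(1) by blast+
    have "\<psi> g = \<psi> (h \<otimes>\<^bsub>V\<^esub> k)"
      unfolding g(2) mult[OF hk] h(2) k(2) by (simp add: smul_def det2_def algebra_simps)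
    then have "g = h \<otimes>\<^bsub>V\<^esub> k"
      using inj g(1) hk by blast
    then show ?thesis
      using subgroup.m_closed[OF H h(1) k(1)] by simp
  qed
  have "rcosets\<^bsub>V\<^esub> ?H \<subseteq> (\<lambda>r. ?H #>\<^bsub>V\<^esub> \<phi> r) ` ({0..<?d} \<times> {0..<?d})"
  proof
    fix C assume "C \<in> rcosets\<^bsub>V\<^esub> ?H"
    then obtain g where g: "g \<in> carrier V" "C = ?H #>\<^bsub>V\<^esub> g"
      by (auto simp: RCOSETS_def)
    define r where "r = (fst (\<psi> g) mod ?d, snd (\<psi> g) mod ?d)"
    define h where "h = \<phi> r"
    have h: "h \<in> carrier V" "\<psi> h = r"
      using \<phi> by (simp_all add: h_def)
    have inv_h: "\<psi> (inv\<^bsub>V\<^esub> h) = - r"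
      by (simp add: h_def \<phi>(2) flip: \<phi>_smul(2))
    have "?d dvd fst (\<psi> g) - fst r" "?d dvd snd (\<psi> g) - snd r"
      by (simp_all add: r_def minus_mod_eq_mult_div)
    then obtain i j where "fst (\<psi> g) - fst r = det2 (\<psi> s) (\<psi> t) * i" "snd (\<psi> g) - snd r = det2 (\<psi> s) (\<psi> t) * j"
      unfolding abs_dvd_iff by (elim dvdE)
    then have "\<psi> (g \<otimes>\<^bsub>V\<^esub> inv\<^bsub>V\<^esub> h) = smul (det2 (\<psi> s) (\<psi> t)) (i, j)"
      using g(1) h inv_h by (simp add: mult smul_def prod_eq_iff)
    then have "g \<otimes>\<^bsub>V\<^esub> inv\<^bsub>V\<^esub> h \<in> ?H"
      using g(1) h(1) by (intro multiples) simp_all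
    then have "g \<in> ?H #>\<^bsub>V\<^esub> h"
      using subgroup.rcos_module_imp[OF H V h(1)] g(1) subgroup.rcos_module[OF H V h(1) g(1)] by blast
    then have "C = ?H #>\<^bsub>V\<^esub> h"
      unfolding g(2) by (rule V.repr_independence[symmetric]) (use h H in simp_all)
    moreover have "r \<in> {0..<?d} \<times> {0..<?d}"
      using det by (simp add: r_def)
    ultimately show "C \<in> (\<lambda>r. ?H #>\<^bsub>V\<^esub> \<phi> r) ` ({0..<?d} \<times> {0..<?d})"
      unfolding h_def by blast
  qed
  then show ?thesis
    by (rule finite_subset) simp
qed

text \<open>Both y + t and y - t have the sign of y, so t cancels in the sum of their absolute
  values. This is how the second function drops out of the equitable condition.\<close>

lemma balanced_signs:
  fixes y t :: int
  assumes "\<bar>t\<bar> < \<bar>y\<bar>"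
  shows "0 < \<bar>y + t\<bar>" "0 < \<bar>y - t\<bar>" "\<bar>y + t\<bar> + \<bar>y - t\<bar> = 2 * \<bar>y\<bar>"
    "sgn y * \<bar>y + t\<bar> = y + t" "sgn y * \<bar>y - t\<bar> = y - t"
  using assms by (auto simp: sgn_if abs_if split: if_splits)

context tubular_free_by_Z
begin

text \<open>The coefficients of the height on the vertex group. The default (1, 0) keeps the vector
  non-zero if the height vanishes there, which by \<open>height_nonzero\<close> and
  \<open>height_edge\<close> cannot happen at a vertex with an incident edge.\<close>

definition PQ :: "'v \<Rightarrow> int \<times> int" where
  "PQ v = (let q = (\<pi> (vx v (1, 0)), \<pi> (vx v (0, 1))) in if q = 0 then (1, 0) else q)"

definition hgt :: "'v \<Rightarrow> int \<times> int \<Rightarrow> int" where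
  "hgt v a = fst (PQ v) * fst a + snd (PQ v) * snd a"

text \<open>The functional with the perpendicular coefficient vector, so that \<open>hgt\<close> and
  \<open>tilt\<close> together determine a. It takes the part of k in the overview, and
  \<open>slope\<close> that of M.\<close>

definition tilt :: "'v \<Rightarrow> int \<times> int \<Rightarrow> int" where
  "tilt v a = snd (PQ v) * fst a - fst (PQ v) * snd a"

text \<open>The factor makes the height dominate the tilt on every edge group.\<close>

definition slope :: int where
  "slope = 1 + (\<Sum>e\<in>arcs \<Gamma>. \<bar>tilt (tail \<Gamma> e) (xt e)\<bar> + \<bar>tilt (head \<Gamma> e) (xh e)\<bar>)"

definition phi :: "'v \<Rightarrow> bool \<Rightarrow> int \<times> int \<Rightarrow> int" where
  "phi v b a = slope * hgt v a + (if b then tilt v a else - tilt v a)"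

lemma PQ_nonzero: "PQ v \<noteq> 0"
  by (simp add: PQ_def Let_def prod_eq_iff)

lemma slope_pos: "0 < slope"
proof -
  have "0 \<le> (\<Sum>e\<in>arcs \<Gamma>. \<bar>tilt (tail \<Gamma> e) (xt e)\<bar> + \<bar>tilt (head \<Gamma> e) (xh e)\<bar>)"
    by (intro sum_nonneg) simp
  then show ?thesis
    by (simp add: slope_def)
qed

lemma tilt_less_slope:
  assumes "e \<in> arcs \<Gamma>"
  shows "\<bar>tilt (tail \<Gamma> e) (xt e)\<bar> < slope" "\<bar>tilt (head \<Gamma> e) (xh e)\<bar> < slope"
proof -
  let ?f = "\<lambda>e. \<bar>tilt (tail \<Gamma> e) (xt e)\<bar> + \<bar>tilt (head \<Gamma> e) (xh e)\<bar>"
  have "?f e \<le> sum ?f (arcs \<Gamma>)"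
    using assms fin_arcs by (intro member_le_sum) simp_all
  then show "\<bar>tilt (tail \<Gamma> e) (xt e)\<bar> < slope" "\<bar>tilt (head \<Gamma> e) (xh e)\<bar> < slope"
    by (simp_all add: slope_def)
qed

lemma hgt_eq:
  assumes "v \<in> verts \<Gamma>" "\<pi> (vx v a) \<noteq> 0"
  shows "hgt v a = \<pi> (vx v a)"
proof -
  have "(\<pi> (vx v (1, 0)), \<pi> (vx v (0, 1))) \<noteq> 0"
    using \<pi>_linear[OF assms(1), of a] assms(2) by (auto simp: prod_eq_iff)
  then have "PQ v = (\<pi> (vx v (1, 0)), \<pi> (vx v (0, 1)))"
    by (simp add: PQ_def Let_def)
  then show ?thesis
    using \<pi>_linear[OF assms(1), of a] by (simp add: hgt_def mult.commute)
qed

lemma hgt_edge: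
  assumes e: "e \<in> arcs \<Gamma>"
  shows "hgt (head \<Gamma> e) (xh e) = hgt (tail \<Gamma> e) (xt e)" "hgt (tail \<Gamma> e) (xt e) \<noteq> 0"
  using height_nonzero[OF e] height_edge[OF e] hgt_eq[of "tail \<Gamma> e" "xt e"]
    hgt_eq[of "head \<Gamma> e" "xh e"] e by simp_all

lemma tilt_dominated:
  assumes e: "e \<in> arcs \<Gamma>"
  shows "\<bar>tilt (tail \<Gamma> e) (xt e)\<bar> < \<bar>slope * hgt (tail \<Gamma> e) (xt e)\<bar>"
    "\<bar>tilt (head \<Gamma> e) (xh e)\<bar> < \<bar>slope * hgt (tail \<Gamma> e) (xt e)\<bar>"
proof -
  have "1 \<le> \<bar>hgt (tail \<Gamma> e) (xt e)\<bar>"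
    using hgt_edge(2)[OF e] by linarith
  then have "slope * 1 \<le> slope * \<bar>hgt (tail \<Gamma> e) (xt e)\<bar>"
    using slope_pos by (intro mult_left_mono) simp_all
  then have "slope \<le> \<bar>slope * hgt (tail \<Gamma> e) (xt e)\<bar>"
    using slope_pos by (simp add: abs_mult)
  then show "\<bar>tilt (tail \<Gamma> e) (xt e)\<bar> < \<bar>slope * hgt (tail \<Gamma> e) (xt e)\<bar>"
    "\<bar>tilt (head \<Gamma> e) (xh e)\<bar> < \<bar>slope * hgt (tail \<Gamma> e) (xt e)\<bar>"
    using tilt_less_slope[OF e] by linarith+
qed

text \<open>The number y is the same for both ends because the two images of the edge generator are
  conjugate and so have equal height.\<close>

lemma phi_edge:
  assumes e: "e \<in> arcs \<Gamma>"
  defines "y \<equiv> slope * hgt (tail \<Gamma> e) (xt e)"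
  shows "0 < \<bar>phi (tail \<Gamma> e) b (xt e)\<bar>" "0 < \<bar>phi (head \<Gamma> e) b (xh e)\<bar>"
    "\<bar>phi (tail \<Gamma> e) True (xt e)\<bar> + \<bar>phi (tail \<Gamma> e) False (xt e)\<bar> = 2 * \<bar>y\<bar>"
    "\<bar>phi (head \<Gamma> e) True (xh e)\<bar> + \<bar>phi (head \<Gamma> e) False (xh e)\<bar> = 2 * \<bar>y\<bar>"
    "sgn y * \<bar>phi (tail \<Gamma> e) b (xt e)\<bar> = phi (tail \<Gamma> e) b (xt e)"
    "sgn y * \<bar>phi (head \<Gamma> e) b (xh e)\<bar> = phi (head \<Gamma> e) b (xh e)"
proof -
  let ?t = "tilt (tail \<Gamma> e) (xt e)" and ?h = "tilt (head \<Gamma> e) (xh e)"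
  have t: "phi (tail \<Gamma> e) True (xt e) = y + ?t" "phi (tail \<Gamma> e) False (xt e) = y - ?t"
    and h: "phi (head \<Gamma> e) True (xh e) = y + ?h" "phi (head \<Gamma> e) False (xh e) = y - ?h"
    by (simp_all add: phi_def y_def hgt_edge(1)[OF e])
  note bt = balanced_signs[OF tilt_dominated(1)[OF e], folded y_def]
    and bh = balanced_signs[OF tilt_dominated(2)[OF e], folded y_def]
  show "0 < \<bar>phi (tail \<Gamma> e) b (xt e)\<bar>" "0 < \<bar>phi (head \<Gamma> e) b (xh e)\<bar>"
    by (cases b; simp only: t h bt(1,2) bh(1,2))+
  show "\<bar>phi (tail \<Gamma> e) True (xt e)\<bar> + \<bar>phi (tail \<Gamma> e) False (xt e)\<bar> = 2 * \<bar>y\<bar>"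
    unfolding t by (rule bt(3))
  show "\<bar>phi (head \<Gamma> e) True (xh e)\<bar> + \<bar>phi (head \<Gamma> e) False (xh e)\<bar> = 2 * \<bar>y\<bar>"
    unfolding h by (rule bh(3))
  show "sgn y * \<bar>phi (tail \<Gamma> e) b (xt e)\<bar> = phi (tail \<Gamma> e) b (xt e)"
    by (cases b) (simp_all only: t bt(4,5))
  show "sgn y * \<bar>phi (head \<Gamma> e) b (xh e)\<bar> = phi (head \<Gamma> e) b (xh e)"
    by (cases b) (simp_all only: h bh(4,5))
qed

lemma phi_smul: "phi v b (smul m a) = m * phi v b a"
  by (simp add: phi_def hgt_def tilt_def smul_def algebra_simps)

lemma phi_add: "phi v b (a + a') = phi v b a + phi v b a'"
  by (simp add: phi_def hgt_def tilt_def algebra_simps)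

lemma phi_nonzero:
  assumes "a \<noteq> 0"
  shows "\<exists>b. phi v b a \<noteq> 0"
proof (rule ccontr)
  assume "\<nexists>b. phi v b a \<noteq> 0"
  then have "phi v True a = 0" "phi v False a = 0"
    by blast+
  then have "slope * hgt v a = 0" "tilt v a = 0"
    by (simp_all add: phi_def)
  then have "hgt v a = 0" "tilt v a = 0"
    using slope_pos by simp_all
  \<comment> \<open>Solving for a: these combinations of height and tilt are the squared length of
    \<open>PQ v\<close> times the coordinates of a.\<close>
  then have "fst (PQ v) * hgt v a + snd (PQ v) * tilt v a = 0"
    "snd (PQ v) * hgt v a - fst (PQ v) * tilt v a = 0"
    by (simp_all only: mult_zero_right add_0_right diff_self)
  moreover have "fst (PQ v) * hgt v a + snd (PQ v) * tilt v a
      = (fst (PQ v) * fst (PQ v) + snd (PQ v) * snd (PQ v)) * fst a"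
    "snd (PQ v) * hgt v a - fst (PQ v) * tilt v a
      = (fst (PQ v) * fst (PQ v) + snd (PQ v) * snd (PQ v)) * snd a"
    by (simp_all add: hgt_def tilt_def algebra_simps)
  ultimately have "(fst (PQ v) * fst (PQ v) + snd (PQ v) * snd (PQ v)) * fst a = 0"
    "(fst (PQ v) * fst (PQ v) + snd (PQ v) * snd (PQ v)) * snd a = 0"
    by (simp_all only:)
  moreover have "fst (PQ v) * fst (PQ v) + snd (PQ v) * snd (PQ v) \<noteq> 0"
    using PQ_nonzero[of v] by (simp add: sum_squares_eq_zero_iff prod_eq_iff)
  ultimately have "fst a = 0" "snd a = 0"
    by (simp_all only: mult_eq_0_iff simp_thms)
  then show False
    using assms by (simp add: prod_eq_iff)
qed

text \<open>The vectors dual to \<open>phi\<close> under the determinant form, so that the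
  intersection numbers with them are the absolute values of \<open>phi\<close>.\<close>

definition slopes :: "'v \<Rightarrow> bool \<Rightarrow> int \<times> int" where
  "slopes v b = (if b then (- slope * snd (PQ v) + fst (PQ v), slope * fst (PQ v) + snd (PQ v))
     else (- slope * snd (PQ v) - fst (PQ v), slope * fst (PQ v) - snd (PQ v)))"

lemma det2_slopes: "det2 a (slopes v b) = phi v b a"
  by (simp add: det2_def slopes_def phi_def hgt_def tilt_def algebra_simps)

lemma slopes_independent: "det2 (slopes v True) (slopes v False) \<noteq> 0"
proof -
  have "det2 (slopes v True) (slopes v False)
      = 2 * slope * (fst (PQ v) * fst (PQ v) + snd (PQ v) * snd (PQ v))"
    by (simp add: det2_def slopes_def algebra_simps)
  then show ?thesis
    using PQ_nonzero[of v] slope_pos by (simp add: sum_squares_eq_zero_iff prod_eq_iff)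
qed

text \<open>For the m-th power of the chosen edge generator both sums equal 2 |m| |y|, with the y of
  \<open>phi_edge\<close>.\<close>

lemma equitable: "equitable_set \<G> (\<lambda>v. map (\<lambda>b. \<psi>inv v (slopes v b)) [True, False])"
  unfolding equitable_set_def
proof (intro conjI ballI impI)
  fix v assume v: "v \<in> verts \<Gamma>"
  show "set (map (\<lambda>b. \<psi>inv v (slopes v b)) [True, False]) \<subseteq> carrier (vgroup \<G> v)"
    using \<psi>_props(1)[OF v] by simp
  show "finite (rcosets\<^bsub>vgroup \<G> v\<^esub> (generate (vgroup \<G> v) (set (map (\<lambda>b. \<psi>inv v (slopes v b)) [True, False]))))"
    using finite_index_of_independent[OF vgroup[OF v] \<psi>[OF v] \<psi>_props(1)[OF v] \<psi>_props(1)[OF v],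
        of "slopes v True" "slopes v False"] slopes_independent[of v] by (simp add: \<psi>_props(2)[OF v])
next
  fix e d assume e: "e \<in> arcs \<Gamma>" and d: "d \<in> carrier (egroup \<G> e)"
  obtain m :: int where m: "d = c e [^]\<^bsub>egroup \<G> e\<^esub> m"
    using edge_maps(6)[OF e d] by blast
  have int: "intersection_number (vgroup \<G> v) g (\<psi>inv v (slopes v b)) = \<bar>phi v b (\<psi> v g)\<bar>"
    if "v \<in> verts \<Gamma>" "g \<in> carrier (vgroup \<G> v)" for v g b
    using intersection_number_eq[OF vgroup \<psi> _ \<psi>_props(1), of v g "slopes v b"] that
    by (simp add: \<psi>_props(2) det2_slopes)
  have "(\<Sum>s\<leftarrow>map (\<lambda>b. \<psi>inv (tail \<Gamma> e) (slopes (tail \<Gamma> e) b)) [True, False].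
        intersection_number (vgroup \<G> (tail \<Gamma> e)) (tail_map \<G> e d) s)
      = \<bar>m\<bar> * (\<bar>phi (tail \<Gamma> e) True (xt e)\<bar> + \<bar>phi (tail \<Gamma> e) False (xt e)\<bar>)"
    using e edge_maps(2)[OF e d] edge_maps(7)[OF e, of m]
    by (simp add: int m[symmetric] phi_smul abs_mult algebra_simps)
  moreover have "(\<Sum>s\<leftarrow>map (\<lambda>b. \<psi>inv (head \<Gamma> e) (slopes (head \<Gamma> e) b)) [True, False].
        intersection_number (vgroup \<G> (head \<Gamma> e)) (head_map \<G> e d) s)
      = \<bar>m\<bar> * (\<bar>phi (head \<Gamma> e) True (xh e)\<bar> + \<bar>phi (head \<Gamma> e) False (xh e)\<bar>)"
    using e edge_maps(3)[OF e d] edge_maps(8)[OF e, of m]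
    by (simp add: int m[symmetric] phi_smul abs_mult algebra_simps)
  ultimately show "let u = tail \<Gamma> e; w = head \<Gamma> e in
      (\<Sum>s\<leftarrow>map (\<lambda>b. \<psi>inv u (slopes u b)) [True, False]. intersection_number (vgroup \<G> u) (tail_map \<G> e d) s)
      = (\<Sum>t\<leftarrow>map (\<lambda>b. \<psi>inv w (slopes w b)) [True, False]. intersection_number (vgroup \<G> w) (head_map \<G> e d) t)"
    unfolding Let_def using phi_edge(3,4)[OF e] by simp
qed

end

section \<open>The wall action\<close>

text \<open>The two families of parallel lines cross an edge line in \<open>p\<close> and \<open>q\<close> points per period. They
  are enumerated together by the integers, \<open>p + q\<close> per period.\<close>

definition interleave :: "int \<Rightarrow> int \<Rightarrow> int \<times> bool \<Rightarrow> int" where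
  "interleave p q w = (if snd w then fst w div p * (p + q) + fst w mod p
     else fst w div q * (p + q) + (p + fst w mod q))"

definition uninterleave :: "int \<Rightarrow> int \<Rightarrow> int \<Rightarrow> int \<times> bool" where
  "uninterleave p q m = (if m mod (p + q) < p then (m div (p + q) * p + m mod (p + q), True)
     else (m div (p + q) * q + (m mod (p + q) - p), False))"

lemma div_mod_unique:
  fixes k r m :: int
  assumes "0 \<le> r" "r < m"
  shows "(k * m + r) div m = k" "(k * m + r) mod m = r"
  using assms by (simp_all add: div_pos_pos_trivial mod_pos_pos_trivial)

lemma interleave_uninterleave:
  assumes "0 < p" "0 < q"
  shows "interleave p q (uninterleave p q m) = m"
proof (cases "m mod (p + q) < p")
  case True
  have "0 \<le> m mod (p + q)"
    using assms by simp
  then have "interleave p q (uninterleave p q m) = m div (p + q) * (p + q) + m mod (p + q)"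
    using True div_mod_unique[of "m mod (p + q)" p "m div (p + q)"]
    by (simp only: interleave_def uninterleave_def if_True fst_conv snd_conv)
  then show ?thesis
    by (simp only: div_mult_mod_eq)
next
  case False
  have "m mod (p + q) - p < q"
    using assms pos_mod_bound[of "p + q" m] by linarith
  moreover have "0 \<le> m mod (p + q) - p"
    using False by simp
  ultimately have "interleave p q (uninterleave p q m)
      = m div (p + q) * (p + q) + (p + (m mod (p + q) - p))"
    using False div_mod_unique[of "m mod (p + q) - p" q "m div (p + q)"]
    by (simp only: interleave_def uninterleave_def if_False fst_conv snd_conv)
  then show ?thesis
    by (simp only: add_diff_cancel_left' add_diff_eq div_mult_mod_eq)
qed

lemma uninterleave_interleave:
  assumes "0 < p" "0 < q"
  shows "uninterleave p q (interleave p q w) = w"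
proof -
  obtain n b where w: "w = (n, b)"
    by (cases w) blast
  show ?thesis
  proof (cases b)
    case True
    have "0 \<le> n mod p" "n mod p < p" "n mod p < p + q"
      using assms pos_mod_bound[of p n] pos_mod_sign[of p n] by linarith+
    then show ?thesis
      using True div_mod_unique[of "n mod p" "p + q" "n div p"]
      by (simp add: interleave_def uninterleave_def w)
  next
    case False
    have "0 \<le> p + n mod q" "p + n mod q < p + q" "\<not> p + n mod q < p"
      using assms pos_mod_bound[of q n] pos_mod_sign[of q n] by linarith+
    then show ?thesis
      using False div_mod_unique[of "p + n mod q" "p + q" "n div q"]
      by (simp add: interleave_def uninterleave_def w)
  qed
qed

text \<open>One period in either family, p or q of its own steps, is the same translation by p + q
  of the common numbering.\<close>

lemma interleave_shift:
  assumes "0 < p" "0 < q"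
  shows "interleave p q (n + s * (if b then p else q), b) = interleave p q (n, b) + s * (p + q)"
  using assms by (simp add: interleave_def algebra_simps)

text \<open>The numbering respects the position of 0 in both families, so that the relabelling of
  walls at an edge preserves \<open>upper\<close> exactly.\<close>

lemma interleave_nonneg:
  assumes "0 < p" "0 < q"
  shows "0 \<le> interleave p q (n, b) \<longleftrightarrow> 0 \<le> n"
proof -
  define r where "r = (if b then p else q)"
  define t where "t = (if b then n mod r else p + n mod r)"
  have r: "0 < r"
    using assms by (simp add: r_def)
  have eq: "interleave p q (n, b) = n div r * (p + q) + t"
    by (simp add: interleave_def r_def t_def)
  have t: "0 \<le> t" "t < p + q"
  proof -
    have "t \<le> p + n mod r" "n mod r \<le> t" "b \<Longrightarrow> t = n mod r" "b \<Longrightarrow> r = p" "\<not> b \<Longrightarrow> r = q"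
      using assms by (simp_all add: t_def r_def)
    then show "0 \<le> t" "t < p + q"
      using assms pos_mod_bound[OF r, of n] pos_mod_sign[OF r, of n] by (cases b; linarith)+
  qed
  show ?thesis
  proof (cases "0 \<le> n")
    case True
    then have "0 \<le> n div r"
      using r by (simp add: pos_imp_zdiv_nonneg_iff)
    then have "0 \<le> n div r * (p + q)"
      using assms by simp
    then show ?thesis
      using True t eq by simp
  next
    case False
    then have "n div r < 0"
      using r by (simp add: pos_imp_zdiv_neg_iff)
    then have "n div r * (p + q) \<le> (- 1) * (p + q)"
      using assms by (intro mult_right_mono) simp_all
    then show ?thesis
      using False t eq by simp
  qed
qed

definition upper :: "(int \<times> bool) set" where
  "upper = {w. 0 \<le> fst w}"

context tubular_free_by_Z
begin

definition glide :: "'v \<Rightarrow> int \<times> int \<Rightarrow> int \<times> bool \<Rightarrow> int \<times> bool" where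
  "glide v a w = (fst w + phi v (snd w) a, snd w)"

lemma glide_add: "glide v (a + a') = glide v a \<circ> glide v a'"
  by (simp add: fun_eq_iff glide_def phi_add algebra_simps)

lemma glide_0: "glide v 0 = id"
  using phi_add[of v _ 0 0] by (simp add: fun_eq_iff glide_def)

lemma glide_in_commensurator: "glide v a \<in> carrier (commensurator upper)"
proof -
  have "bij (glide v a)"
    using glide_add[of v a "- a"] glide_add[of v "- a" a]
    by (intro o_bij[of "glide v (- a)"]) (simp_all add: glide_0)
  moreover have "{w. (glide v a w \<in> upper) \<noteq> (w \<in> upper)} \<subseteq>
      {- \<bar>phi v True a\<bar> - \<bar>phi v False a\<bar>..\<bar>phi v True a\<bar> + \<bar>phi v False a\<bar>} \<times> UNIV"
  proof
    fix w assume w: "w \<in> {w. (glide v a w \<in> upper) \<noteq> (w \<in> upper)}"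
    obtain n b where "w = (n, b)"
      by (cases w) blast
    then show "w \<in> {- \<bar>phi v True a\<bar> - \<bar>phi v False a\<bar>..\<bar>phi v True a\<bar> + \<bar>phi v False a\<bar>} \<times> UNIV"
      using w by (cases b) (auto simp: glide_def upper_def)
  qed
  then have "finite {w. (glide v a w \<in> upper) \<noteq> (w \<in> upper)}"
    by (rule finite_subset) simp
  ultimately show ?thesis
    by simp
qed

text \<open>Some family is translated by a non-zero amount p; the multiples of p in it form an orbit
  that is unbounded in both directions.\<close>

lemma fixfree_glide:
  assumes "a \<noteq> 0"
  shows "fixfree upper (glide v a)"
proof -
  obtain b where b: "phi v b a \<noteq> 0"
    using phi_nonzero[OF assms] by blast
  define p where "p = phi v b a"
  define Y where "Y = range (\<lambda>m. (m * p, b))"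
  have pos: "(int n * \<bar>p\<bar>, b) \<in> Y \<inter> upper" for n
  proof -
    have "int n * \<bar>p\<bar> = int n * sgn p * p"
      by (simp add: abs_sgn mult.assoc mult.commute)
    then show ?thesis
      unfolding Y_def upper_def by auto
  qed
  \<comment> \<open>\<open>Suc\<close> skips the point 0, which belongs to
    \<open>upper\<close>.\<close>
  have neg: "(- int (Suc n) * \<bar>p\<bar>, b) \<in> Y - upper" for n
  proof -
    have "- int (Suc n) * \<bar>p\<bar> = - int (Suc n) * sgn p * p"
      by (simp add: abs_sgn mult.assoc mult.commute)
    moreover have "- int (Suc n) * \<bar>p\<bar> < 0"
      using b by (simp add: p_def mult_less_0_iff)
    ultimately show ?thesis
      unfolding Y_def upper_def by auto
  qed
  have "inj (\<lambda>n. (int n * \<bar>p\<bar>, b))" "inj (\<lambda>n. (- int (Suc n) * \<bar>p\<bar>, b))"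
    using b by (auto simp: inj_def p_def)
  then have inf: "infinite (range (\<lambda>n. (int n * \<bar>p\<bar>, b)))" "infinite (range (\<lambda>n. (- int (Suc n) * \<bar>p\<bar>, b)))"
    by (simp_all only: range_inj_infinite not_False_eq_True)
  show ?thesis
  proof (rule fixfreeI[of Y])
    show "infinite (Y \<inter> upper)"
      by (rule infinite_super[OF _ inf(1)]) (use pos in blast)
    show "infinite (Y - upper)"
      by (rule infinite_super[OF _ inf(2)]) (use neg in blast)
    fix h :: "_ \<Rightarrow> real" and y z
    assume h: "h \<circ> glide v a = h" and "y \<in> Y" "z \<in> Y"
    have step: "h (n + p, b) = h (n, b)" for n
      using fun_cong[OF h, of "(n, b)"] by (simp add: glide_def p_def)
    have "h (m * p, b) = h (0, b)" for m
    proof (induction m rule: int_induct[of _ 0])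
      case (step1 i)
      then show ?case using step[of "i * p"] by (simp add: algebra_simps)
    next
      case (step2 i)
      then show ?case using step[of "(i - 1) * p"] by (simp add: algebra_simps)
    qed simp
    then have "h w = h (0, b)" if "w \<in> Y" for w
      using that unfolding Y_def by (elim rangeE) (simp only:)
    from this[OF \<open>y \<in> Y\<close>] this[OF \<open>z \<in> Y\<close>] show "h y = h z"
      by simp
  qed
qed

text \<open>The individual families at head and tail may have different periods, but the total
  number of walls per period is 2 |y| at both ends, so the two common numberings can be matched by
  the identity of the integers.\<close>

definition join_walls :: "'e \<Rightarrow> int \<times> bool \<Rightarrow> int \<times> bool" where
  "join_walls e w =
     uninterleave \<bar>phi (tail \<Gamma> e) True (xt e)\<bar> \<bar>phi (tail \<Gamma> e) False (xt e)\<bar>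
       (interleave \<bar>phi (head \<Gamma> e) True (xh e)\<bar> \<bar>phi (head \<Gamma> e) False (xh e)\<bar> w)"

lemma join_walls_in_commensurator:
  assumes e: "e \<in> arcs \<Gamma>"
  shows "join_walls e \<in> carrier (commensurator upper)"
proof -
  let ?p = "\<lambda>b. \<bar>phi (tail \<Gamma> e) b (xt e)\<bar>" and ?q = "\<lambda>b. \<bar>phi (head \<Gamma> e) b (xh e)\<bar>"
  note pos = phi_edge(1)[OF e, of True] phi_edge(1)[OF e, of False]
    phi_edge(2)[OF e, of True] phi_edge(2)[OF e, of False]
  define k where "k = (\<lambda>w. uninterleave (?q True) (?q False) (interleave (?p True) (?p False) w))"
  have "k \<circ> join_walls e = id" "join_walls e \<circ> k = id"
    by (simp_all only: fun_eq_iff comp_apply k_def join_walls_def id_apply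
        interleave_uninterleave[OF pos(1,2)] uninterleave_interleave[OF pos(3,4)]
        interleave_uninterleave[OF pos(3,4)] uninterleave_interleave[OF pos(1,2)] simp_thms)
  then have "bij (join_walls e)"
    by (rule o_bij)
  moreover have "(join_walls e w \<in> upper) = (w \<in> upper)" for w
    using interleave_nonneg[OF pos(1,2), of "fst (join_walls e w)" "snd (join_walls e w)"]
      interleave_nonneg[OF pos(3,4), of "fst w" "snd w"]
    by (simp add: upper_def join_walls_def interleave_uninterleave[OF pos(1,2)])
  ultimately show ?thesis
    by simp
qed

text \<open>At either end the edge generator translates both families by exactly one period in the
  direction \<open>sgn y\<close>, hence both common numberings by the same amount.\<close>

lemma join_walls_glide:
  assumes e: "e \<in> arcs \<Gamma>"
  shows "join_walls e (glide (head \<Gamma> e) (xh e) w) = glide (tail \<Gamma> e) (xt e) (join_walls e w)"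
proof -
  let ?p = "\<lambda>b. \<bar>phi (tail \<Gamma> e) b (xt e)\<bar>" and ?q = "\<lambda>b. \<bar>phi (head \<Gamma> e) b (xh e)\<bar>"
  note pos = phi_edge(1)[OF e, of True] phi_edge(1)[OF e, of False]
    phi_edge(2)[OF e, of True] phi_edge(2)[OF e, of False]
  define s where "s = sgn (slope * hgt (tail \<Gamma> e) (xt e))"
  have shift: "interleave (?q True) (?q False) (glide (head \<Gamma> e) (xh e) w)
      = interleave (?q True) (?q False) w + s * (?q True + ?q False)" for w
  proof -
    have "glide (head \<Gamma> e) (xh e) w = (fst w + s * (if snd w then ?q True else ?q False), snd w)"
      using phi_edge(6)[OF e, of "snd w"] by (cases "snd w") (simp_all add: glide_def s_def)
    then show ?thesis
      using interleave_shift[OF pos(3,4), of "fst w" s "snd w"] by simp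
  qed
  have shift': "interleave (?p True) (?p False) (glide (tail \<Gamma> e) (xt e) w)
      = interleave (?p True) (?p False) w + s * (?p True + ?p False)" for w
  proof -
    have "glide (tail \<Gamma> e) (xt e) w = (fst w + s * (if snd w then ?p True else ?p False), snd w)"
      using phi_edge(5)[OF e, of "snd w"] by (cases "snd w") (simp_all add: glide_def s_def)
    then show ?thesis
      using interleave_shift[OF pos(1,2), of "fst w" s "snd w"] by simp
  qed
  have "interleave (?p True) (?p False) (join_walls e (glide (head \<Gamma> e) (xh e) w))
      = interleave (?q True) (?q False) w + s * (?q True + ?q False)"
    by (simp only: join_walls_def interleave_uninterleave[OF pos(1,2)] shift)
  also have "?q True + ?q False = ?p True + ?p False"
    using phi_edge(3,4)[OF e] by simp
  also have "interleave (?q True) (?q False) w + s * (?p True + ?p False)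
      = interleave (?p True) (?p False) (glide (tail \<Gamma> e) (xt e) (join_walls e w))"
    by (simp only: shift' join_walls_def interleave_uninterleave[OF pos(1,2)])
  finally show ?thesis
    using uninterleave_interleave[OF pos(1,2)] by metis
qed

lemma wall_action_exists:
  "\<exists>\<rho>\<in>hom P (commensurator upper). \<forall>v\<in>verts \<Gamma>. \<forall>a. a \<noteq> 0 \<longrightarrow> fixfree upper (\<rho> (vx v a))"
proof -
  let ?K = "commensurator upper"
  have "\<exists>\<rho>\<in>hom P ?K. \<exists>\<beta>. (\<forall>v. \<beta> v \<in> carrier ?K) \<and>
    (\<forall>v\<in>verts \<Gamma>. \<forall>a. \<rho> (vx v a) = \<beta> v \<otimes>\<^bsub>?K\<^esub> glide v a \<otimes>\<^bsub>?K\<^esub> inv\<^bsub>?K\<^esub> \<beta> v) \<and>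
    (\<forall>e\<in>arcs \<Gamma>. \<rho> (st e) = \<beta> (tail \<Gamma> e) \<otimes>\<^bsub>?K\<^esub> join_walls e \<otimes>\<^bsub>?K\<^esub> inv\<^bsub>?K\<^esub> \<beta> (head \<Gamma> e))"
  proof (rule P_hom_exists[OF group_commensurator])
    fix e assume "e \<in> arcs \<Gamma>"
    then show "join_walls e \<otimes>\<^bsub>?K\<^esub> glide (head \<Gamma> e) (xh e) = glide (tail \<Gamma> e) (xt e) \<otimes>\<^bsub>?K\<^esub> join_walls e"
      by (simp add: fun_eq_iff join_walls_glide)
  next
    fix v a a' show "glide v (a + a') = glide v a \<otimes>\<^bsub>?K\<^esub> glide v a'"
      by (simp add: glide_add)
  qed (rule glide_in_commensurator, erule join_walls_in_commensurator)
  then obtain \<rho> \<beta> where \<rho>: "\<rho> \<in> hom P ?K" and all\<beta>: "\<forall>v. \<beta> v \<in> carrier ?K" and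
    allvx: "\<forall>v\<in>verts \<Gamma>. \<forall>a. \<rho> (vx v a) = \<beta> v \<otimes>\<^bsub>?K\<^esub> glide v a \<otimes>\<^bsub>?K\<^esub> inv\<^bsub>?K\<^esub> \<beta> v" and
    "\<forall>e\<in>arcs \<Gamma>. \<rho> (st e) = \<beta> (tail \<Gamma> e) \<otimes>\<^bsub>?K\<^esub> join_walls e \<otimes>\<^bsub>?K\<^esub> inv\<^bsub>?K\<^esub> \<beta> (head \<Gamma> e)"
    by (elim bexE exE conjE)
  note \<beta> = spec[OF all\<beta>] and vx = spec[OF bspec[OF allvx]]
  have "fixfree upper (\<rho> (vx v a))" if "v \<in> verts \<Gamma>" "a \<noteq> 0" for v a
    unfolding vx[OF that(1)] inv_commensurator[OF \<beta>[of v]] commensurator_simps(2)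
    by (rule fixfree_conj[OF fixfree_glide[OF that(2)] \<beta>[of v]])
  then show ?thesis
    using \<rho> by blast
qed

lemma acts_freely: "acts_freely_on_CAT0_cube_complex P"
proof -
  obtain \<rho> \<beta> where act: "tree_action \<rho> \<beta>"
    using tree_action_exists by blast
  note \<rho> = tree_actionD(1)[OF act]
  obtain \<rho>' where \<rho>': "\<rho>' \<in> hom P (commensurator upper)"
    and free: "\<forall>v\<in>verts \<Gamma>. \<forall>a. a \<noteq> 0 \<longrightarrow> fixfree upper (\<rho>' (vx v a))"
    using wall_action_exists by (elim bexE)
  \<comment> \<open>Only the type matters here: a number is encoded by the length of a constant
    word, and the two singletons lift the word to the type of group elements and then to the type of
    sets of these.\<close>
  define \<iota> :: "(((int \<times> int) \<times> nat \<times> bool) list \<times> bool) + (int \<times> bool) \<Rightarrow>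
      ('v, 'a, 'e) gog_gen word set set"
    where "\<iota> = (\<lambda>w. {{replicate (to_nat w) (Stable_Letter undefined, True)}})"
  have "inj \<iota>"
  proof (rule injI)
    fix u w assume "\<iota> u = \<iota> w"
    then have "replicate (to_nat u) (Stable_Letter undefined :: ('v, 'a, 'e) gog_gen, True)
        = replicate (to_nat w) (Stable_Letter undefined, True)"
      unfolding \<iota>_def by (rule singleton_inject[OF singleton_inject])
    from arg_cong[OF this, of length] have "to_nat u = to_nat w"
      by (simp only: length_replicate)
    then show "u = w"
      by (simp only: inj_to_nat[THEN inj_eq])
  qed
  moreover have "(\<lambda>g. map_sum (\<rho> g) (\<rho>' g)) \<in> hom P (commensurator (R.outward <+> upper))"
    using \<rho> \<rho>' by (rule hom_map_sum)
  moreover have "fixfree (R.outward <+> upper) (map_sum (\<rho> g) (\<rho>' g))"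
    if g: "g \<in> carrier P" "g \<noteq> \<one>\<^bsub>P\<^esub>" for g
  proof (rule fixfree_map_sum)
    obtain k v where kv: "k \<in> carrier P" "v \<in> verts \<Gamma>" and
      cases: "(\<exists>a. g = k \<cdot> vx v a \<cdot> inv\<^bsub>P\<^esub> k) \<or>
        (\<exists>l. l \<noteq> [] \<and> path v l v \<and> successively no_turn (l @ l) \<and> g = k \<cdot> pval l \<cdot> inv\<^bsub>P\<^esub> k)"
      using conj_reduced_all[OF g(1)] unfolding conj_reduced_def by (elim bexE)
    from cases show "fixfree R.outward (\<rho> g) \<or> fixfree upper (\<rho>' g)"
    proof
      assume "\<exists>a. g = k \<cdot> vx v a \<cdot> inv\<^bsub>P\<^esub> k"
      then obtain a where a: "g = k \<cdot> vx v a \<cdot> inv\<^bsub>P\<^esub> k"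
        by blast
      have "a \<noteq> 0"
      proof
        assume "a = 0"
        then have "k \<cdot> vx v a \<cdot> inv\<^bsub>P\<^esub> k = \<one>\<^bsub>P\<^esub>"
          using kv by simp
        then show False
          using g(2) unfolding a by (rule notE[rotated])
      qed
      have "fixfree upper (\<rho>' g)"
        unfolding a
        by (rule fixfree_conj_P[OF \<rho>' kv(1) vx_closed[OF kv(2)] mp[OF spec[OF bspec[OF free kv(2)]] \<open>a \<noteq> 0\<close>]])
      then show ?thesis ..
    next
      assume "\<exists>l. l \<noteq> [] \<and> path v l v \<and> successively no_turn (l @ l) \<and> g = k \<cdot> pval l \<cdot> inv\<^bsub>P\<^esub> k"
      then obtain l where l: "l \<noteq> []" "path v l v" "successively no_turn (l @ l)"
        "g = k \<cdot> pval l \<cdot> inv\<^bsub>P\<^esub> k"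
        by blast
      have "fixfree R.outward (\<rho> g)"
        unfolding l(4)
        by (rule fixfree_conj_P[OF \<rho> kv(1) pval_closed[OF l(2)] fixfree_cyclically_reduced[OF act l(1-3)]])
      then show ?thesis ..
    qed
  qed
  ultimately show ?thesis
    by (rule acts_freely_on_CAT0_cube_complex_transport[OF group_P])
qed

end

theorem theorem2p4:
  fixes \<G> :: "('v, 'e, 'a, 'b) graph_of_groups" and T :: "'e set"
  assumes "tubular \<G>"
    and "spanning_tree_arcs (base \<G>) T"
    and "free_by_Z (fundamental_group \<G> T)"
  shows "(\<exists>S. equitable_set \<G> S) \<and>
         acts_freely_on_CAT0_cube_complex (fundamental_group \<G> T)"
proof -
  obtain \<psi> c where coords: "tubular_coordinates \<G> T \<psi> c"
    using tubular_coordinates_exist[OF assms(1,2)] by blast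
  interpret tubular_coordinates \<G> T \<psi> c
    by (rule coords)
  obtain \<pi> :: "('v, 'a, 'e) gog_gen word set \<Rightarrow> int" where
    mult: "\<forall>g\<in>carrier P. \<forall>h\<in>carrier P. \<pi> (g \<otimes>\<^bsub>P\<^esub> h) = \<pi> g + \<pi> h" and
    roots: "\<forall>x\<in>carrier P. \<pi> x = 0 \<longrightarrow> x \<noteq> \<one>\<^bsub>P\<^esub> \<longrightarrow>
      cyclic_roots (P\<lparr>carrier := {g \<in> carrier P. \<pi> g = 0}\<rparr>) x"
    using free_by_Z_projection[OF group_P assms(3)] by (elim exE conjE)
  interpret tubular_free_by_Z \<G> T \<psi> c \<pi>
  proof unfold_locales
    fix g h assume "g \<in> carrier P" "h \<in> carrier P"
    then show "\<pi> (g \<otimes>\<^bsub>P\<^esub> h) = \<pi> g + \<pi> h"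
      by (rule bspec[OF bspec[OF mult]])
  next
    fix g assume "g \<in> carrier P" "\<pi> g = 0" "g \<noteq> \<one>\<^bsub>P\<^esub>"
    then show "cyclic_roots (P\<lparr>carrier := {g \<in> carrier P. \<pi> g = 0}\<rparr>) g"
      by (rule mp[OF mp[OF bspec[OF roots]]])
  qed
  show ?thesis
    by (intro conjI exI) (rule equitable, rule acts_freely)
qed

end
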